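(* Let $\epsilon>0$. In the singly periodic setting (cell $\mathcal{C}_1$, $k=1$) and the doubly periodic setting (cell $\mathcal{C}_2$, $k=2$) let $\{w_{n,0,k},\lambda_{n,0,k}\}_{n=1}^{N_q^k}$ be quadratures of precision $\epsilon$ for the integral representing the Stokes kernel $\mathbf{K}_k^{west}$ (as defined in the context). Let $\mathbf{s}_j=(x'_j,y'_j)$, $j=1,\dots,N_S$, and $\mathbf{t}_l=(x_l,y_l)$, $l=1,\dots,N_T$, be sources and targets in the unit cell. Let $\mathbf{I}_2$ be the $2\times2$ identity and, for real $\lambda\ne0$, $$\mathbf{J}(\lambda)=\begin{bmatrix}-1&i\operatorname{sign}(\lambda)\\ i\operatorname{sign}(\lambda)&1\end{bmatrix}.$$ For $k=1,2$ define block matrices with $2\times2$ blocks $$\mathbf{L}_k^{west}(l,n)=e^{-|\lambda_{n,0,k}|x_l}e^{i\lambda_{n,0,k}y_l}\mathbf{I}_2,\qquad \mathbf{R}_k^{west}(n,j)=e^{|\lambda_{n,0,k}|x'_j}e^{-i\lambda_{n,0,k}y'_j}\mathbf{I}_2,$$ and block diagonal matrices $\mathbf{D}_S(j,j)=x'_j\mathbf{I}_2$, $\mathbf{D}_T(l,l)=x_l\mathbf{I}_2$ and, writing $\lambda=\lambda_{n,0,k}$, $$\mathbf{D}_{1,a}^{west}(n,n)=\frac{w_{n,0,1}}{8\pi}\frac{e^{-2|\lambda|d}}{1-e^{-|\lambda|d}}\left(\frac{1}{|\lambda|}\mathbf{I}_2-\frac{2-e^{-|\lambda|d}}{1-e^{-|\lambda|d}}\,d\,\mathbf{J}(\lambda)\right),\qquad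 \mathbf{D}_{1,b}^{west}(n,n)=\frac{w_{n,0,1}}{8\pi}\frac{e^{-2|\lambda|d}}{1-e^{-|\lambda|d}}\,\mathbf{J}(\lambda),$$ $$\mathbf{D}_{2,a}^{west}(n,n)=\frac{w_{n,0,2}}{8\pi}\frac{e^{-4|\lambda|d}}{1-e^{-|\lambda|d}}\Big(\big[e^{-|\lambda|\xi+i\lambda\eta}+e^{|\lambda|\xi-i\lambda\eta}+1\big]\Big(\frac{1}{|\lambda|}\mathbf{I}_2-\frac{4-3e^{-|\lambda|d}}{1-e^{-|\lambda|d}}\,d\,\mathbf{J}(\lambda)\Big)-\big[e^{-|\lambda|\xi+i\lambda\eta}-e^{|\lambda|\xi-i\lambda\eta}\big]\,\xi\,\mathbf{J}(\lambda)\Big),$$ $$\mathbf{D}_{2,b}^{west}(n,n)=\frac{w_{n,0,2}}{8\pi}\frac{e^{-4|\lambda|d}}{1-e^{-|\lambda|d}}\big[e^{-|\lambda|\xi+i\lambda\eta}+e^{|\lambda|\xi-i\lambda\eta}+1\big]\,\mathbf{J}(\lambda).$$ For $k=1,2$ let $$\mathbf{P}_k^{west}=\mathbf{L}_k^{west}\mathbf{D}_{k,a}^{west}\mathbf{R}_k^{west}-\mathbf{D}_T\mathbf{L}_k^{west}\mathbf{D}_{k,b}^{west}\mathbf{R}_k^{west}+\mathbf{L}_k^{west}\mathbf{D}_{k,b}^{west}\mathbf{R}_k^{west}\mathbf{D}_S .$$ Then for every charge-neutral $\mathbf{q}=(\mathbf{q}_1,\dots,\mathbf{q}_{N_S})$,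 $\mathbf{q}_j=(q_{j,1},q_{j,2})\in\mathbb{R}^2$, $\sum_j\mathbf{q}_j=0$, the real parts of $\mathbf{P}_1^{west}\mathbf{q}$ and $\mathbf{P}_2^{west}\mathbf{q}$ give, to precision $\epsilon$ and up to an additive constant vector, the contributions of the west image sources to the corresponding Stokes periodizing potentials: for $k=1,2$ and all $l,l'$ the limit $$\boldsymbol\Delta_{l,l'}=\lim_{\beta\to0^+}\sum_{j=1}^{N_S}\left(\mathbf{K}_{k,\beta}^{west}(\mathbf{t}_l,\mathbf{s}_j)-\mathbf{K}_{k,\beta}^{west}(\mathbf{t}_{l'},\mathbf{s}_j)\right)\mathbf{q}_j$$ exists and each component of $\boldsymbol\Delta_{l,l'}-\operatorname{Re}\left[(\mathbf{P}_k^{west}\mathbf{q})_l-(\mathbf{P}_k^{west}\mathbf{q})_{l'}\right]$ is bounded in absolute value by $\epsilon\sum_j(|q_{j,1}|+|q_{j,2}|)$.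
   Context: For $\beta>0$ the modified Stokeslet is, for $\mathbf{t}=(x,y)\ne0$, $$\mathbf{G}_\beta^{(\mathrm{MS})}(\mathbf{t})=\begin{pmatrix}-\partial_{yy}&\partial_{xy}\\ \partial_{xy}&-\partial_{xx}\end{pmatrix}G_{\mathrm{MB}}(\mathbf{t}),\qquad G_{\mathrm{MB}}(\mathbf{t})=-\frac{1}{2\pi\beta^2}\left[K_0(\beta|\mathbf{t}|)-\log(1/|\mathbf{t}|)\right]$$ ($K_0$ the modified Bessel function of the second kind). Singly periodic setting: $d,\eta>0$, $\mathcal{C}_1=[-\tfrac d2,\tfrac d2]\times[-\tfrac\eta2,\tfrac\eta2]$, $\mathbf{K}_{1,\beta}^{west}(\mathbf{t},\mathbf{s})=\sum_{m=-\infty}^{-2}\mathbf{G}_\beta^{(\mathrm{MS})}(\mathbf{t}-\mathbf{s}-(md,0))$. Doubly periodic setting: $d,\eta>0$, $\xi\in\mathbb{R}$, $d\ge\sqrt{\xi^2+\eta^2}$, $\mathbf{e}_1=(d,0)$, $\mathbf{e}_2=(\xi,\eta)$, $\mathcal{C}_2=\{x_1\mathbf{e}_1+x_2\mathbf{e}_2 : x_1,x_2\in[-\tfrac12,\tfrac12]\}$, $\mathbf{l}_{mn}=m\mathbf{e}_1+n\mathbf{e}_2$, $\mathbf{K}_{2,\beta}^{west}(\mathbf{t},\mathbf{s})=\sum_{m=-\infty}^{-4}\sum_{n=-1}^{1}\mathbf{G}_\beta^{(\mathrm{MS})}(\mathbf{t}-\mathbf{s}-\mathbf{l}_{mn})$.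 The Stokes potentials due to the west images are defined, for charge-neutral $\mathbf{q}$ and up to an additive constant vector, as limits $\beta\to0$ of the modified Stokes ones. Quadrature of precision $\epsilon$: with $\mathbf{t}=(x,y)$, $\mathbf{s}=(x',y')$, $\lambda\neq0$ real, and $\mathbf{J}(\lambda)=\begin{bmatrix}-1&i\operatorname{sign}(\lambda)\\ i\operatorname{sign}(\lambda)&1\end{bmatrix}$, let $$\boldsymbol\Phi_1(\lambda;\mathbf{t},\mathbf{s})=\frac{1}{8\pi}\frac{e^{-2|\lambda|d}}{1-e^{-|\lambda|d}}e^{-|\lambda|(x-x')}e^{i\lambda(y-y')}\Big\{\frac{1}{|\lambda|}\mathbf{I}_2-\Big(x-x'+\frac{2-e^{-|\lambda|d}}{1-e^{-|\lambda|d}}d\Big)\mathbf{J}(\lambda)\Big\},$$ $$\boldsymbol\Phi_2(\lambda;\mathbf{t},\mathbf{s})=\frac{1}{8\pi}\sum_{n=-1}^{1}\frac{e^{-4|\lambda|d}}{1-e^{-|\lambda|d}}e^{-|\lambda|(x-x'-n\xi)}e^{i\lambda(y-y'-n\eta)}\Big\{\frac{1}{|\lambda|}\mathbf{I}_2-\Big(x-x'-n\xi+\frac{4-3e^{-|\lambda|d}}{1-e^{-|\lambda|d}}d\Big)\mathbf{J}(\lambda)\Big\}.$$ For $\mathbf{t},\mathbf{t}_0,\mathbf{s},\mathbf{s}_0\in\mathcal{C}_k$ let $\boldsymbol\Psi_k(\lambda)=\boldsymbol\Phi_k(\lambda;\mathbf{t},\mathbf{s})-\boldsymbol\Phi_k(\lambda;\mathbf{t}_0,\mathbf{s})-\boldsymbol\Phi_k(\lambda;\mathbf{t},\mathbf{s}_0)+\boldsymbol\Phi_k(\lambda;\mathbf{t}_0,\mathbf{s}_0)$.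 Real weights $w_{n,0,k}$ and nonzero real nodes $\lambda_{n,0,k}$, $n=1,\dots,N_q^k$, form a quadrature of precision $\epsilon$ if every entry of $\int_{-\infty}^{\infty}\operatorname{Re}\boldsymbol\Psi_k(\lambda)\,d\lambda-\sum_n w_{n,0,k}\operatorname{Re}\boldsymbol\Psi_k(\lambda_{n,0,k})$ is at most $\epsilon$ in absolute value for all $\mathbf{t},\mathbf{t}_0,\mathbf{s},\mathbf{s}_0\in\mathcal{C}_k$. Block indices: $l=1,\dots,N_T$, $n=1,\dots,N_q^k$, $j=1,\dots,N_S$. *)

theory Defs
  imports "HOL-Analysis.Analysis"
begin

text \<open>Points, force vectors and \<open>2 \<times> 2\<close> matrices are elements of \<^typ>\<open>real^2\<close> and
  \<^typ>\<open>real^2^2\<close>; component \<open>1\<close> is \<open>x\<close> and component \<open>2\<close> is \<open>y\<close>.\<close>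

section \<open>The modified Stokeslet\<close>

text \<open>For \<open>x > 0\<close>, \<open>K\<^sub>0(x) = \<integral>\<^sub>0\<^sup>\<infinity> exp(-x cosh u) du\<close>; nothing is intended for \<open>x \<le> 0\<close>.\<close>

definition bessel_K0 :: "real \<Rightarrow> real" where
  "bessel_K0 x = (LBINT u:{0..}. exp (- (x * cosh u)))"

definition partial_deriv :: "2 \<Rightarrow> (real^2 \<Rightarrow> real) \<Rightarrow> real^2 \<Rightarrow> real" where
  "partial_deriv i f p = deriv (\<lambda>h. f (p + h *\<^sub>R axis i 1)) 0"

definition G_MB :: "real \<Rightarrow> real^2 \<Rightarrow> real" where
  "G_MB \<beta> p = - (1 / (2 * pi * \<beta>^2)) * (bessel_K0 (\<beta> * norm p) - ln (1 / norm p))"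

definition G_MS :: "real \<Rightarrow> real^2 \<Rightarrow> real^2^2" where
  "G_MS \<beta> p = vector
     [vector [- partial_deriv 2 (partial_deriv 2 (G_MB \<beta>)) p,
                partial_deriv 1 (partial_deriv 2 (G_MB \<beta>)) p],
      vector [  partial_deriv 1 (partial_deriv 2 (G_MB \<beta>)) p,
              - partial_deriv 1 (partial_deriv 1 (G_MB \<beta>)) p]]"

section \<open>Unit cells and west image kernels\<close>

definition cell1 :: "real \<Rightarrow> real \<Rightarrow> (real^2) set" where
  "cell1 d \<eta> = {p. p$1 \<in> {-(d/2)..d/2} \<and> p$2 \<in> {-(\<eta>/2)..\<eta>/2}}"

definition e1 :: "real \<Rightarrow> real^2" where
  "e1 d = vector [d, 0]"

definition e2 :: "real \<Rightarrow> real \<Rightarrow> real^2" where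
  "e2 \<xi> \<eta> = vector [\<xi>, \<eta>]"

definition cell2 :: "real \<Rightarrow> real \<Rightarrow> real \<Rightarrow> (real^2) set" where
  "cell2 d \<xi> \<eta> = {x1 *\<^sub>R e1 d + x2 *\<^sub>R e2 \<xi> \<eta> | x1 x2. x1 \<in> {-(1/2)..1/2} \<and> x2 \<in> {-(1/2)..1/2}}"

definition K1_west :: "real \<Rightarrow> real \<Rightarrow> real^2 \<Rightarrow> real^2 \<Rightarrow> real^2^2" where
  "K1_west d \<beta> t s =
     (\<Sum>\<^sub>\<infinity>m\<in>{..-2::int}. G_MS \<beta> (t - s - vector [of_int m * d, 0]))"

definition K2_west :: "real \<Rightarrow> real \<Rightarrow> real \<Rightarrow> real \<Rightarrow> real^2 \<Rightarrow> real^2 \<Rightarrow> real^2^2" where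
  "K2_west d \<xi> \<eta> \<beta> t s =
     (\<Sum>\<^sub>\<infinity>m\<in>{..-4::int}. \<Sum>n\<in>{-1..1::int}.
        G_MS \<beta> (t - s - (of_int m *\<^sub>R e1 d + of_int n *\<^sub>R e2 \<xi> \<eta>)))"

section \<open>The integrands and the quadratures\<close>

definition J_mat :: "real \<Rightarrow> complex^2^2" where
  "J_mat lam = vector [vector [-1, \<i> * complex_of_real (sgn lam)],
                       vector [\<i> * complex_of_real (sgn lam), 1]]"

definition cscale :: "complex \<Rightarrow> complex^2^2 \<Rightarrow> complex^2^2" where
  "cscale c A = (\<chi> a b. c * A$a$b)"

definition Phi1 :: "real \<Rightarrow> real \<Rightarrow> real^2 \<Rightarrow> real^2 \<Rightarrow> complex^2^2" where
  "Phi1 d lam t s =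
     cscale (complex_of_real (1 / (8 * pi) * (exp (- (2 * \<bar>lam\<bar> * d)) / (1 - exp (- (\<bar>lam\<bar> * d))))
                * exp (- (\<bar>lam\<bar> * (t$1 - s$1))))
             * exp (\<i> * complex_of_real (lam * (t$2 - s$2))))
       ((1 / \<bar>lam\<bar>) *\<^sub>R mat 1
        - (t$1 - s$1 + (2 - exp (- (\<bar>lam\<bar> * d))) / (1 - exp (- (\<bar>lam\<bar> * d))) * d) *\<^sub>R J_mat lam)"

definition Phi2 :: "real \<Rightarrow> real \<Rightarrow> real \<Rightarrow> real \<Rightarrow> real^2 \<Rightarrow> real^2 \<Rightarrow> complex^2^2" where
  "Phi2 d \<xi> \<eta> lam t s = (1 / (8 * pi)) *\<^sub>R (\<Sum>n\<in>{-1..1::int}.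
     cscale (complex_of_real (exp (- (4 * \<bar>lam\<bar> * d)) / (1 - exp (- (\<bar>lam\<bar> * d)))
                * exp (- (\<bar>lam\<bar> * (t$1 - s$1 - of_int n * \<xi>))))
             * exp (\<i> * complex_of_real (lam * (t$2 - s$2 - of_int n * \<eta>))))
       ((1 / \<bar>lam\<bar>) *\<^sub>R mat 1
        - (t$1 - s$1 - of_int n * \<xi>
             + (4 - 3 * exp (- (\<bar>lam\<bar> * d))) / (1 - exp (- (\<bar>lam\<bar> * d))) * d) *\<^sub>R J_mat lam))"

definition Psi ::
  "(real \<Rightarrow> real^2 \<Rightarrow> real^2 \<Rightarrow> complex^2^2) \<Rightarrow> real^2 \<Rightarrow> real^2 \<Rightarrow> real^2 \<Rightarrow> real^2 \<Rightarrow> real \<Rightarrow> complex^2^2"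
where
  "Psi \<Phi> t t0 s s0 lam = \<Phi> lam t s - \<Phi> lam t0 s - \<Phi> lam t s0 + \<Phi> lam t0 s0"

definition quadrature_of_precision ::
  "real \<Rightarrow> (real^2) set \<Rightarrow> (real \<Rightarrow> real^2 \<Rightarrow> real^2 \<Rightarrow> complex^2^2)
    \<Rightarrow> ('q::finite \<Rightarrow> real) \<Rightarrow> ('q \<Rightarrow> real) \<Rightarrow> bool"
where
  "quadrature_of_precision \<epsilon> C \<Phi> w lam \<longleftrightarrow>
     (\<forall>n. lam n \<noteq> 0) \<and>
     (\<forall>t\<in>C. \<forall>t0\<in>C. \<forall>s\<in>C. \<forall>s0\<in>C. \<forall>a b.
        \<bar>(LBINT x. Re (Psi \<Phi> t t0 s s0 x $a$b))
           - (\<Sum>n\<in>UNIV. w n * Re (Psi \<Phi> t t0 s s0 (lam n) $a$b))\<bar> \<le> \<epsilon>)"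

section \<open>Block matrices\<close>

text \<open>A block matrix with \<open>2 \<times> 2\<close> blocks, block rows indexed by \<open>'m\<close> and block columns by \<open>'n\<close>,
  is a matrix with row index type \<open>'m \<times> 2\<close> and column index type \<open>'n \<times> 2\<close>.\<close>

definition block_matrix ::
  "('m::finite \<Rightarrow> 'n::finite \<Rightarrow> complex^2^2) \<Rightarrow> complex^('n \<times> 2)^('m \<times> 2)" where
  "block_matrix B = (\<chi> p r. B (fst p) (fst r) $ snd p $ snd r)"

definition block_diag :: "('n::finite \<Rightarrow> complex^2^2) \<Rightarrow> complex^('n \<times> 2)^('n \<times> 2)" where
  "block_diag B = block_matrix (\<lambda>i j. if i = j then B i else 0)"

definition block_vector :: "('n::finite \<Rightarrow> real^2) \<Rightarrow> complex^('n \<times> 2)" where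
  "block_vector q = (\<chi> p. complex_of_real (q (fst p) $ snd p))"

definition L_west :: "('q::finite \<Rightarrow> real) \<Rightarrow> ('t::finite \<Rightarrow> real^2) \<Rightarrow> complex^('q \<times> 2)^('t \<times> 2)" where
  "L_west lam t = block_matrix (\<lambda>l n.
     mat (complex_of_real (exp (- (\<bar>lam n\<bar> * t l $ 1))) * exp (\<i> * complex_of_real (lam n * t l $ 2))))"

definition R_west :: "('q::finite \<Rightarrow> real) \<Rightarrow> ('s::finite \<Rightarrow> real^2) \<Rightarrow> complex^('s \<times> 2)^('q \<times> 2)" where
  "R_west lam s = block_matrix (\<lambda>n j.
     mat (complex_of_real (exp (\<bar>lam n\<bar> * s j $ 1)) * exp (- (\<i> * complex_of_real (lam n * s j $ 2)))))"

text \<open>Both \<open>D\<^sub>S\<close> and \<open>D\<^sub>T\<close> are instances of the following matrix.\<close>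

definition D_pos :: "('n::finite \<Rightarrow> real^2) \<Rightarrow> complex^('n \<times> 2)^('n \<times> 2)" where
  "D_pos p = block_diag (\<lambda>j. mat (complex_of_real (p j $ 1)))"

definition D1a_west ::
  "real \<Rightarrow> ('q::finite \<Rightarrow> real) \<Rightarrow> ('q \<Rightarrow> real) \<Rightarrow> complex^('q \<times> 2)^('q \<times> 2)" where
  "D1a_west d w lam = block_diag (\<lambda>n.
     (w n / (8 * pi) * (exp (- (2 * \<bar>lam n\<bar> * d)) / (1 - exp (- (\<bar>lam n\<bar> * d))))) *\<^sub>R
       ((1 / \<bar>lam n\<bar>) *\<^sub>R mat 1
        - ((2 - exp (- (\<bar>lam n\<bar> * d))) / (1 - exp (- (\<bar>lam n\<bar> * d))) * d) *\<^sub>R J_mat (lam n)))"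

definition D1b_west ::
  "real \<Rightarrow> ('q::finite \<Rightarrow> real) \<Rightarrow> ('q \<Rightarrow> real) \<Rightarrow> complex^('q \<times> 2)^('q \<times> 2)" where
  "D1b_west d w lam = block_diag (\<lambda>n.
     (w n / (8 * pi) * (exp (- (2 * \<bar>lam n\<bar> * d)) / (1 - exp (- (\<bar>lam n\<bar> * d))))) *\<^sub>R J_mat (lam n))"

definition E_minus :: "real \<Rightarrow> real \<Rightarrow> real \<Rightarrow> complex" where
  "E_minus \<xi> \<eta> lam = exp (- complex_of_real (\<bar>lam\<bar> * \<xi>) + \<i> * complex_of_real (lam * \<eta>))"

definition E_plus :: "real \<Rightarrow> real \<Rightarrow> real \<Rightarrow> complex" where
  "E_plus \<xi> \<eta> lam = exp (complex_of_real (\<bar>lam\<bar> * \<xi>) - \<i> * complex_of_real (lam * \<eta>))"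

definition D2a_west ::
  "real \<Rightarrow> real \<Rightarrow> real \<Rightarrow> ('q::finite \<Rightarrow> real) \<Rightarrow> ('q \<Rightarrow> real) \<Rightarrow> complex^('q \<times> 2)^('q \<times> 2)" where
  "D2a_west d \<xi> \<eta> w lam = block_diag (\<lambda>n.
     (w n / (8 * pi) * (exp (- (4 * \<bar>lam n\<bar> * d)) / (1 - exp (- (\<bar>lam n\<bar> * d))))) *\<^sub>R
       (cscale (E_minus \<xi> \<eta> (lam n) + E_plus \<xi> \<eta> (lam n) + 1)
          ((1 / \<bar>lam n\<bar>) *\<^sub>R mat 1
           - ((4 - 3 * exp (- (\<bar>lam n\<bar> * d))) / (1 - exp (- (\<bar>lam n\<bar> * d))) * d) *\<^sub>R J_mat (lam n))
        - cscale (E_minus \<xi> \<eta> (lam n) - E_plus \<xi> \<eta> (lam n)) (\<xi> *\<^sub>R J_mat (lam n))))"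

definition D2b_west ::
  "real \<Rightarrow> real \<Rightarrow> real \<Rightarrow> ('q::finite \<Rightarrow> real) \<Rightarrow> ('q \<Rightarrow> real) \<Rightarrow> complex^('q \<times> 2)^('q \<times> 2)" where
  "D2b_west d \<xi> \<eta> w lam = block_diag (\<lambda>n.
     (w n / (8 * pi) * (exp (- (4 * \<bar>lam n\<bar> * d)) / (1 - exp (- (\<bar>lam n\<bar> * d))))) *\<^sub>R
       cscale (E_minus \<xi> \<eta> (lam n) + E_plus \<xi> \<eta> (lam n) + 1) (J_mat (lam n)))"

definition P_west ::
  "complex^('q::finite \<times> 2)^('q \<times> 2) \<Rightarrow> complex^('q \<times> 2)^('q \<times> 2) \<Rightarrow> ('q \<Rightarrow> real)
    \<Rightarrow> ('t::finite \<Rightarrow> real^2) \<Rightarrow> ('s::finite \<Rightarrow> real^2) \<Rightarrow> complex^('s \<times> 2)^('t \<times> 2)"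
where
  "P_west Da Db lam t s =
     L_west lam t ** Da ** R_west lam s
     - D_pos t ** L_west lam t ** Db ** R_west lam s
     + L_west lam t ** Db ** R_west lam s ** D_pos s"

definition P1_west ::
  "real \<Rightarrow> ('q::finite \<Rightarrow> real) \<Rightarrow> ('q \<Rightarrow> real) \<Rightarrow> ('t::finite \<Rightarrow> real^2) \<Rightarrow> ('s::finite \<Rightarrow> real^2)
    \<Rightarrow> complex^('s \<times> 2)^('t \<times> 2)" where
  "P1_west d w lam = P_west (D1a_west d w lam) (D1b_west d w lam) lam"

definition P2_west ::
  "real \<Rightarrow> real \<Rightarrow> real \<Rightarrow> ('q::finite \<Rightarrow> real) \<Rightarrow> ('q \<Rightarrow> real) \<Rightarrow> ('t::finite \<Rightarrow> real^2)
    \<Rightarrow> ('s::finite \<Rightarrow> real^2) \<Rightarrow> complex^('s \<times> 2)^('t \<times> 2)" where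
  "P2_west d \<xi> \<eta> w lam = P_west (D2a_west d \<xi> \<eta> w lam) (D2b_west d \<xi> \<eta> w lam) lam"

end

theory Submission
  imports Defs
begin

text \<open>
  For \<open>x > 0\<close> the Bessel integral becomes, by \<open>\<lambda> = \<beta> sinh u\<close> and invariance under rotations,
  \<open>2 K\<^sub>0(\<beta> r) = \<integral> exp(-k x + i \<lambda> y) / k d\<lambda>\<close> with \<open>k = sqrt(\<lambda>\<^sup>2 + \<beta>\<^sup>2)\<close>; the gradient of the logarithm is a
  combination of the integrals of the same form with \<open>\<beta> = 0\<close>. Hence the entries of the modified Stokeslet are
  difference quotients in \<open>k\<^sup>2\<close>, between \<open>\<lambda>\<^sup>2\<close> and \<open>\<lambda>\<^sup>2 + \<beta>\<^sup>2\<close>, of one and the same Fourier integrand, and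
  summing over the images multiplies this integrand by \<open>1 / (1 - exp(-k d))\<close>.

  As \<open>\<beta> \<rightarrow> 0\<close> the difference quotient tends to a derivative, which is the integrand \<open>\<Phi>\<close>. A single integrand is
  not integrable at \<open>\<lambda> = 0\<close>, but by charge neutrality only mixed second differences in \<open>(t, s)\<close> occur;
  these gain a factor \<open>k\<^sup>2\<close> because
  \<open>e\<^sup>w - e\<^sup>w\<^sup>+\<^sup>a - e\<^sup>w\<^sup>+\<^sup>b + e\<^sup>w\<^sup>+\<^sup>a\<^sup>+\<^sup>b = e\<^sup>w (e\<^sup>a - 1) (e\<^sup>b - 1)\<close>, which makes the difference quotients bounded by a
  multiple of \<open>exp(- c |\<lambda>| / 2)\<close> uniformly in \<open>\<beta>\<close>, so that dominated convergence applies. The matrices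
  \<open>P\<close> are exactly the quadrature sums of \<open>\<Phi>\<close>, so the error is the quadrature error of the mixed
  differences with one source fixed.
\<close>

section \<open>Integration on the real line\<close>

text \<open>West images lie to the left of the cell, so every displacement that occurs has a
  positive first component \<open>X\<close>. Only there do the waves decay in \<open>lam\<close>,
  which confines all integral representations to \<open>X > 0\<close>. The logarithm itself has no
  such representation: the weight \<open>1 / |lam|\<close> is not integrable at 0. Its gradient has
  one, so the subtraction of the part at \<beta> = 0 is possible only after one differentiation.
  Since \<open>k^2 - lam^2 = \<beta>^2\<close>, the prefactor \<open>1 / \<beta>^2\<close> is
  exactly the denominator of the difference quotient, and the limit is \<open>1 / (2 k)\<close>
  times a derivative in \<open>k\<close> at \<open>k = |lam|\<close>. The obstacle is the behaviour
  near \<open>k = 0\<close>. The symbol is of order \<open>k\<close> and the geometric factor has a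
  simple pole, so their product is merely bounded; differentiating and dividing by
  \<open>2 k\<close> can produce order \<open>k^(-2)\<close>. A single difference would leave a
  non-integrable \<open>1 / k\<close>. Neutrality supplies the difference in the source, and the
  freedom of an additive constant supplies the one in the target.\<close>

lemma integrable_exp_neg_abs:
  assumes "c > 0"
  shows "integrable lborel (\<lambda>x::real. exp (- (c * \<bar>x\<bar>)))"
proof -
  have *: "set_integrable lborel {0..} (\<lambda>x::real. exp (- (c * x)))"
  proof -
    have "(\<lambda>x. exp (- c * x)) absolutely_integrable_on {0..}"
      using assms by (intro nonnegative_absolutely_integrable_1 integrable_on_exp_minus_to_infinity) auto
    then show ?thesis
      unfolding set_integrable_def
      by (subst (asm) integrable_completion) (auto intro!: borel_measurable_continuous_on_indicator continuous_intros)
  qed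
  then have **: "integrable lborel (\<lambda>x. indicator {0..} (- x) *\<^sub>R exp (- (c * - x)))"
    unfolding set_integrable_def
    using lborel_integrable_real_affine_iff[of "-1" "\<lambda>x. indicator {0..} x *\<^sub>R exp (- (c * x))" 0] by simp
  have "integrable lborel (\<lambda>x. indicator {0..} x *\<^sub>R exp (- (c * x)) + indicator {0..} (- x) *\<^sub>R exp (- (c * - x)))"
    using * ** unfolding set_integrable_def by (rule Bochner_Integration.integrable_add)
  then show ?thesis
    by (rule Bochner_Integration.integrable_bound) (auto simp: indicator_def)
qed

lemma lborel_integral_split_reflect:
  fixes f :: "real \<Rightarrow> 'a::{banach, second_countable_topology}"
  assumes f: "integrable lborel f"
  shows "(\<integral>x. f x \<partial>lborel) = (LBINT x:{0..}. f x + f (- x))"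
proof -
  have i: "set_integrable lborel A f" if "A \<in> sets lborel" for A
    using f that unfolding set_integrable_def by (intro integrable_mult_indicator) auto
  have *: "indicator {0..} (- x) = (indicator {..0} x :: real)" for x :: real
    by (auto simp: indicator_def)
  have r: "set_integrable lborel {0..} (\<lambda>x. f (- x))"
    using lborel_integrable_real_affine_iff[of "-1" "\<lambda>x. indicator {0..} x *\<^sub>R f (- x)" 0] i[of "{..0}"]
    unfolding set_integrable_def by (simp add: *)
  have e: "(LBINT x:{0..}. f (- x)) = (LBINT x:{..0}. f x)"
    using lborel_integral_real_affine[of "-1" "\<lambda>x. indicator {0..} x *\<^sub>R f (- x)" 0]
    unfolding set_lebesgue_integral_def by (simp add: *)
  have "(\<integral>x. f x \<partial>lborel) = (\<integral>x. indicator {0..} x *\<^sub>R f x + indicator {..0} x *\<^sub>R f x \<partial>lborel)"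
    using f AE_lborel_singleton[of 0]
    by (intro integral_cong_AE) (auto simp: indicator_def)
  also have "\<dots> = (LBINT x:{0..}. f x) + (LBINT x:{..0}. f x)"
    using i[of "{0..}"] i[of "{..0}"] unfolding set_integrable_def set_lebesgue_integral_def
    by (intro Bochner_Integration.integral_add) auto
  also have "\<dots> = (LBINT x:{0..}. f x + f (- x))"
    using r i[of "{0..}"] e by (subst set_integral_add) auto
  finally show "(\<integral>x. f x \<partial>lborel) = (LBINT x:{0..}. f x + f (- x))" .
qed

text \<open>Differentiation under the integral sign. The mean value inequality bounds the normalized
  first-order remainder by \<open>2 * g\<close>, it tends to 0 pointwise, and dominated convergence
  carries this to the integral.\<close>

lemma has_vector_derivative_lebesgue_integral:
  fixes f f' :: "real \<Rightarrow> 'm \<Rightarrow> 'b::{banach, second_countable_topology}"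
  assumes e: "e > 0"
    and f: "\<And>x. \<bar>x - x0\<bar> < e \<Longrightarrow> integrable M (f x)"
    and deriv: "\<And>x y. \<bar>x - x0\<bar> < e \<Longrightarrow> ((\<lambda>x. f x y) has_vector_derivative f' x y) (at x)"
    and bound: "\<And>x y. \<bar>x - x0\<bar> < e \<Longrightarrow> norm (f' x y) \<le> g y"
    and g: "integrable M g"
    and meas: "f' x0 \<in> borel_measurable M"
  shows "((\<lambda>x. \<integral>y. f x y \<partial>M) has_vector_derivative (\<integral>y. f' x0 y \<partial>M)) (at x0)"
proof -
  have f': "integrable M (f' x0)"
    using bound[of x0] e
    by (intro Bochner_Integration.integrable_bound[OF g meas] AE_I2) (auto intro: order_trans[OF _ abs_ge_self])
  let ?R = "\<lambda>x y. (1 / norm (x - x0)) *\<^sub>R (f x y - (f x0 y + (x - x0) *\<^sub>R f' x0 y))"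
  have bR: "norm (?R x y) \<le> 2 * g y" if "\<bar>x - x0\<bar> < e" "x \<noteq> x0" for x y
  proof -
    have "norm (f x y - f x0 y) \<le> g y * norm (x - x0)"
    proof (rule differentiable_bound[where S="{z. \<bar>z - x0\<bar> < e}" and f'="\<lambda>z h. h *\<^sub>R f' z y"])
      show "convex {z. \<bar>z - x0\<bar> < e}"
        using convex_ball[of x0 e] by (simp add: ball_def dist_real_def abs_minus_commute)
      fix z assume z: "z \<in> {z. \<bar>z - x0\<bar> < e}"
      then show "((\<lambda>x. f x y) has_derivative (\<lambda>h. h *\<^sub>R f' z y)) (at z within {z. \<bar>z - x0\<bar> < e})"
        using deriv[of z y] unfolding has_vector_derivative_def by (auto intro: has_derivative_at_withinI)
      show "onorm (\<lambda>h. h *\<^sub>R f' z y) \<le> g y"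
        using bound[of z y] z by (intro onorm_le) (auto simp: mult.commute mult_left_mono)
    qed (use that e in auto)
    moreover have "norm ((x - x0) *\<^sub>R f' x0 y) \<le> g y * norm (x - x0)"
      using mult_right_mono[OF bound[of x0 y], of "norm (x - x0)"] e by (simp add: mult.commute)
    ultimately have "norm (f x y - (f x0 y + (x - x0) *\<^sub>R f' x0 y)) \<le> 2 * g y * norm (x - x0)"
      using norm_triangle_ineq4[of "f x y - f x0 y" "(x - x0) *\<^sub>R f' x0 y"] by (simp add: algebra_simps)
    then have "norm (f x y - (f x0 y + (x - x0) *\<^sub>R f' x0 y)) / norm (x - x0) \<le> 2 * g y"
      using that by (simp add: pos_divide_le_eq)
    then show ?thesis by simp
  qed
  have "((\<lambda>x. \<integral>y. ?R x y \<partial>M) \<longlongrightarrow> 0) (at x0)"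
  proof (subst tendsto_at_iff_sequentially, intro allI impI)
    fix X :: "nat \<Rightarrow> real" assume X: "\<forall>i. X i \<in> UNIV - {x0}" "X \<longlonglongrightarrow> x0"
    then have "\<forall>\<^sub>F i in sequentially. \<bar>X i - x0\<bar> < e"
      using e by (auto simp: tendsto_iff dist_real_def)
    then obtain N where N: "\<And>i. i \<ge> N \<Longrightarrow> \<bar>X i - x0\<bar> < e"
      by (auto simp: eventually_sequentially)
    \<comment> \<open>Dominated convergence is sequential, so the limit is tested along sequences;
      the shift by \<open>N\<close> discards the terms outside the neighbourhood on which the bound
      holds.\<close>
    have "(\<lambda>i. \<integral>y. ?R (X (i + N)) y \<partial>M) \<longlonglongrightarrow> (\<integral>y. 0 \<partial>M)"
    proof (rule integral_dominated_convergence[where w="\<lambda>y. 2 * g y"])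
      show "integrable M (\<lambda>y. 2 * g y)" using g by simp
      show "(\<lambda>y. ?R (X (i + N)) y) \<in> borel_measurable M" for i
        using borel_measurable_integrable[OF f[OF N[of "i + N"]]] borel_measurable_integrable[OF f[of x0]] meas e
        by auto
      show "AE y in M. norm (?R (X (i + N)) y) \<le> 2 * g y" for i
        using bR[of "X (i + N)"] X(1) N[of "i+N"] by auto
      have "((\<lambda>x. ?R x y) \<longlongrightarrow> 0) (at x0)" for y
        using deriv[of x0 y] e
        by (simp add: has_vector_derivative_def has_derivative_within)
      then have "(\<lambda>i. ?R (X i) y) \<longlonglongrightarrow> 0" for y
        using X unfolding tendsto_at_iff_sequentially comp_def by blast
      then have "(\<lambda>i. ?R (X (i + N)) y) \<longlonglongrightarrow> 0" for y
        by (rule LIMSEQ_ignore_initial_segment)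
      then show "AE y in M. (\<lambda>i. ?R (X (i + N)) y) \<longlonglongrightarrow> 0" by simp
    qed auto
    then have "(\<lambda>i. \<integral>y. ?R (X i) y \<partial>M) \<longlonglongrightarrow> 0"
      using LIMSEQ_offset[of "\<lambda>i. \<integral>y. ?R (X i) y \<partial>M"] by simp
    then show "((\<lambda>x. \<integral>y. ?R x y \<partial>M) \<circ> X) \<longlonglongrightarrow> 0" by (simp add: o_def)
  qed
  moreover have "\<forall>\<^sub>F x in at x0. \<bar>x - x0\<bar> < e"
    using e by (auto simp: eventually_at dist_real_def)
  then have "\<forall>\<^sub>F x in at x0. (\<integral>y. ?R x y \<partial>M)
      = (1 / norm (x - x0)) *\<^sub>R ((\<integral>y. f x y \<partial>M) - ((\<integral>y. f x0 y \<partial>M) + (x - x0) *\<^sub>R (\<integral>y. f' x0 y \<partial>M)))"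
  proof eventually_elim
    case (elim x)
    show ?case
      using f[OF elim] f[of x0] f' e
      by (simp add: integral_scaleR_right)
  qed
  ultimately have "((\<lambda>x. (1 / norm (x - x0)) *\<^sub>R ((\<integral>y. f x y \<partial>M)
      - ((\<integral>y. f x0 y \<partial>M) + (x - x0) *\<^sub>R (\<integral>y. f' x0 y \<partial>M)))) \<longlongrightarrow> 0) (at x0)"
    by (rule Lim_transform_eventually)
  then show ?thesis
    unfolding has_vector_derivative_def has_derivative_within
    by (auto intro: bounded_linear_scaleR_left)
qed

section \<open>Superpositions of decaying waves\<close>

text \<open>Decay rate in \<open>x\<close> of the solution of the modified Helmholtz equation that
  oscillates like \<open>exp (i * lam * y)\<close>: the equation forces
  \<open>k^2 - lam^2 = \<beta>^2\<close>. At \<beta> = 0 the waves are harmonic.\<close>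

definition wavenum :: "real \<Rightarrow> real \<Rightarrow> real" where
  "wavenum \<beta> lam = sqrt (lam\<^sup>2 + \<beta>\<^sup>2)"

lemma wavenum_ge: "\<bar>lam\<bar> \<le> wavenum \<beta> lam"
  by (auto simp: wavenum_def intro!: real_le_rsqrt)

lemma wavenum_ge': "\<bar>\<beta>\<bar> \<le> wavenum \<beta> lam"
  by (auto simp: wavenum_def intro!: real_le_rsqrt)

lemma wavenum_le: "wavenum \<beta> lam \<le> \<bar>lam\<bar> + \<bar>\<beta>\<bar>"
  unfolding wavenum_def using sqrt_add_le_add_sqrt[of "lam\<^sup>2" "\<beta>\<^sup>2"] by simp

lemma wavenum_nonneg: "0 \<le> wavenum \<beta> lam"
  by (simp add: wavenum_def)

lemma wavenum_pos: "\<beta> > 0 \<or> lam \<noteq> 0 \<Longrightarrow> 0 < wavenum \<beta> lam"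
  by (auto simp: wavenum_def add_pos_nonneg add_nonneg_pos)

lemma wavenum_zero [simp]: "wavenum 0 lam = \<bar>lam\<bar>"
  by (simp add: wavenum_def)

lemma wavenum_minus [simp]: "wavenum \<beta> (- lam) = wavenum \<beta> lam"
  by (simp add: wavenum_def)

lemma wavenum_square: "(wavenum \<beta> lam)\<^sup>2 = lam\<^sup>2 + \<beta>\<^sup>2"
  by (simp add: wavenum_def)

lemma continuous_on_wavenum [continuous_intros]:
  "continuous_on A f \<Longrightarrow> continuous_on A (\<lambda>x. wavenum \<beta> (f x))"
  unfolding wavenum_def by (intro continuous_intros)

lemma measurable_wavenum [measurable]: "wavenum \<beta> \<in> borel_measurable borel"
  by (intro borel_measurable_continuous_onI continuous_intros)

text \<open>A class of weights closed under multiplication by \<open>k\<close> and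
  \<open>lam\<close>, the factors that derivatives bring down, and integrable against any wave with
  \<open>X > 0\<close>.\<close>

definition subexp :: "(real \<Rightarrow> complex) \<Rightarrow> bool" where
  "subexp g \<longleftrightarrow> g \<in> borel_measurable borel \<and> (\<forall>\<epsilon>>0. \<exists>C. \<forall>x. norm (g x) \<le> C * exp (\<epsilon> * \<bar>x\<bar>))"

lemma subexpD: "subexp g \<Longrightarrow> g \<in> borel_measurable borel"
  by (simp add: subexp_def)

lemma subexp_mult:
  assumes "subexp f" "subexp g"
  shows "subexp (\<lambda>x. f x * g x)"
  unfolding subexp_def
proof (intro conjI allI impI)
  show "(\<lambda>x. f x * g x) \<in> borel_measurable borel"
    using assms[THEN subexpD] by auto
  fix \<epsilon> :: real assume "\<epsilon> > 0"
  then have "\<epsilon> / 2 > 0" by simp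
  then obtain C D where C: "\<And>x. norm (f x) \<le> C * exp (\<epsilon> / 2 * \<bar>x\<bar>)" and D: "\<And>x. norm (g x) \<le> D * exp (\<epsilon> / 2 * \<bar>x\<bar>)"
    using assms unfolding subexp_def by meson
  have "norm (f x * g x) \<le> C * D * exp (\<epsilon> * \<bar>x\<bar>)" for x
  proof -
    have "norm (f x * g x) \<le> (C * exp (\<epsilon> / 2 * \<bar>x\<bar>)) * (D * exp (\<epsilon> / 2 * \<bar>x\<bar>))"
      unfolding norm_mult using C[of x] D[of x] by (intro mult_mono) (auto intro: order_trans[OF norm_ge_zero])
    also have "\<dots> = C * D * (exp (\<epsilon> / 2 * \<bar>x\<bar>) * exp (\<epsilon> / 2 * \<bar>x\<bar>))" by simp
    also have "exp (\<epsilon> / 2 * \<bar>x\<bar>) * exp (\<epsilon> / 2 * \<bar>x\<bar>) = exp (\<epsilon> * \<bar>x\<bar>)"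
      by (simp flip: exp_add)
    finally show ?thesis .
  qed
  then show "\<exists>C. \<forall>x. norm (f x * g x) \<le> C * exp (\<epsilon> * \<bar>x\<bar>)" by blast
qed

lemma subexp_bounded:
  assumes [measurable]: "g \<in> borel_measurable borel" and "\<And>x. norm (g x) \<le> C"
  shows "subexp g"
  unfolding subexp_def
proof (intro conjI allI impI)
  fix \<epsilon> :: real assume "\<epsilon> > 0"
  have "norm (g x) \<le> C * exp (\<epsilon> * \<bar>x\<bar>)" for x
  proof -
    have "0 \<le> C" using assms(2)[of 0] norm_ge_zero[of "g 0"] by linarith
    then have "C * 1 \<le> C * exp (\<epsilon> * \<bar>x\<bar>)" using \<open>\<epsilon> > 0\<close> by (intro mult_left_mono) auto
    then show ?thesis using assms(2)[of x] by simp
  qed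
  then show "\<exists>C. \<forall>x. norm (g x) \<le> C * exp (\<epsilon> * \<bar>x\<bar>)" by blast
qed simp

lemma subexp_linear:
  assumes [measurable]: "g \<in> borel_measurable borel" and b: "\<And>x. norm (g x) \<le> C + \<bar>x\<bar>"
  shows "subexp g"
  unfolding subexp_def
proof (intro conjI allI impI)
  fix \<epsilon> :: real assume "\<epsilon> > 0"
  have C: "C \<ge> 0" using b[of 0] norm_ge_zero[of "g 0"] by linarith
  have "norm (g x) \<le> (C + 1 / \<epsilon>) * exp (\<epsilon> * \<bar>x\<bar>)" for x
  proof -
    have "C * 1 \<le> C * exp (\<epsilon> * \<bar>x\<bar>)" using \<open>\<epsilon> > 0\<close> C by (intro mult_left_mono) auto
    moreover have "\<epsilon> * \<bar>x\<bar> \<le> exp (\<epsilon> * \<bar>x\<bar>)" using exp_ge_add_one_self[of "\<epsilon> * \<bar>x\<bar>"] by linarith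
    then have "\<bar>x\<bar> \<le> 1 / \<epsilon> * exp (\<epsilon> * \<bar>x\<bar>)" using \<open>\<epsilon> > 0\<close> by (simp add: field_simps)
    ultimately show ?thesis using b[of x] by (simp add: algebra_simps)
  qed
  then show "\<exists>C. \<forall>x. norm (g x) \<le> C * exp (\<epsilon> * \<bar>x\<bar>)" by blast
qed simp

lemma subexp_const: "subexp (\<lambda>x. c)"
  by (rule subexp_bounded[where C="norm c"]) auto

lemma subexp_wavenum: "subexp (\<lambda>x. of_real (wavenum \<beta> x))"
  by (rule subexp_linear[where C="\<bar>\<beta>\<bar>"]) (use wavenum_le[of \<beta>] wavenum_nonneg in \<open>auto simp: add.commute\<close>)

lemma subexp_ident: "subexp of_real"
  by (rule subexp_linear[where C=0]) auto

lemma subexp_minus: "subexp f \<Longrightarrow> subexp (\<lambda>x. - f x)"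
  using subexp_mult[OF subexp_const[of "-1"]] by simp

lemmas subexp_intros = subexp_mult subexp_const subexp_wavenum subexp_ident subexp_minus

definition wave :: "real \<Rightarrow> real \<Rightarrow> real \<Rightarrow> real \<Rightarrow> complex" where
  "wave \<beta> X Y lam = exp (complex_of_real (- (wavenum \<beta> lam * X)) + \<i> * complex_of_real (lam * Y))"

lemma norm_wave: "norm (wave \<beta> X Y lam) = exp (- (wavenum \<beta> lam * X))"
  by (simp add: wave_def)

lemma norm_wave_le:
  assumes "X \<ge> 0" shows "norm (wave \<beta> X Y lam) \<le> exp (- (X * \<bar>lam\<bar>))"
  unfolding norm_wave using mult_right_mono[OF wavenum_ge[of lam \<beta>] assms] by (simp add: mult.commute)

lemma continuous_on_wave [continuous_intros]: "continuous_on A (wave \<beta> X Y)"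
  unfolding wave_def[abs_def] by (intro continuous_intros)

lemma measurable_wave [measurable]: "wave \<beta> X Y \<in> borel_measurable borel"
  by (intro borel_measurable_continuous_onI continuous_intros)

text \<open>Half of the decay rate absorbs the growth of \<open>g\<close>. The constant serves all
  \<open>X \<ge> c\<close> and all \<open>Y\<close> at once, as domination of the derivatives in
  \<open>X\<close> and \<open>Y\<close> requires.\<close>

lemma subexp_wave_bound:
  assumes "subexp g" "c > 0"
  obtains C where "\<And>X Y lam. X \<ge> c \<Longrightarrow> norm (g lam * wave \<beta> X Y lam) \<le> C * exp (- (c / 2 * \<bar>lam\<bar>))"
proof -
  have "c / 2 > 0" using assms by simp
  then obtain C where C: "\<And>x. norm (g x) \<le> C * exp (c / 2 * \<bar>x\<bar>)"
    using assms unfolding subexp_def by meson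
  have "norm (g lam * wave \<beta> X Y lam) \<le> C * exp (- (c / 2 * \<bar>lam\<bar>))" if "X \<ge> c" for X Y lam
  proof -
    have "norm (wave \<beta> X Y lam) \<le> exp (- (X * \<bar>lam\<bar>))" using that assms by (intro norm_wave_le) auto
    also have "\<dots> \<le> exp (- (c * \<bar>lam\<bar>))" using that by (auto intro: mult_right_mono)
    finally have "norm (g lam * wave \<beta> X Y lam) \<le> (C * exp (c / 2 * \<bar>lam\<bar>)) * exp (- (c * \<bar>lam\<bar>))"
      unfolding norm_mult using C[of lam] by (intro mult_mono) (auto intro: order_trans[OF norm_ge_zero])
    also have "\<dots> = C * (exp (c / 2 * \<bar>lam\<bar>) * exp (- (c * \<bar>lam\<bar>)))" by simp
    also have "exp (c / 2 * \<bar>lam\<bar>) * exp (- (c * \<bar>lam\<bar>)) = exp (- (c / 2 * \<bar>lam\<bar>))"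
      by (simp flip: exp_add add: field_simps)
    finally show ?thesis .
  qed
  then show ?thesis using that by blast
qed

lemma integrable_subexp_wave:
  assumes "subexp g" "X > 0"
  shows "integrable lborel (\<lambda>lam. g lam * wave \<beta> X Y lam)"
proof -
  obtain C where C: "\<And>lam. norm (g lam * wave \<beta> X Y lam) \<le> C * exp (- (X / 2 * \<bar>lam\<bar>))"
    using subexp_wave_bound[OF assms] by (metis order_refl)
  have "integrable lborel (\<lambda>lam. C * exp (- (X / 2 * \<bar>lam\<bar>)))"
    using assms by (intro integrable_mult_right integrable_exp_neg_abs) auto
  then show ?thesis
    by (rule Bochner_Integration.integrable_bound)
      (use C subexpD[OF assms(1)] in \<open>auto intro!: AE_I2 intro: order_trans[OF _ abs_ge_self]\<close>)
qed

definition wave_int :: "(real \<Rightarrow> complex) \<Rightarrow> real \<Rightarrow> real \<Rightarrow> real \<Rightarrow> complex" where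
  "wave_int g \<beta> X Y = (\<integral>lam. g lam * wave \<beta> X Y lam \<partial>lborel)"

lemma wave_int_cong: "(\<And>x. g x = h x) \<Longrightarrow> wave_int g \<beta> X Y = wave_int h \<beta> X Y"
  by (simp add: wave_int_def)

lemma has_vector_derivative_wave_X:
  "((\<lambda>X. wave \<beta> X Y lam) has_vector_derivative - of_real (wavenum \<beta> lam) * wave \<beta> X Y lam) (at X)"
proof -
  have "((\<lambda>X. complex_of_real (- (wavenum \<beta> lam * X)) + \<i> * complex_of_real (lam * Y)) has_vector_derivative - of_real (wavenum \<beta> lam)) (at X)"
    by (auto intro!: derivative_eq_intros simp: has_vector_derivative_def scaleR_conv_of_real algebra_simps)
  from field_vector_diff_chain_at[OF this DERIV_exp] show ?thesis
    unfolding wave_def o_def .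
qed

lemma has_vector_derivative_wave_int_X:
  assumes g: "subexp g" and X: "X > 0"
  shows "((\<lambda>X. wave_int g \<beta> X Y) has_vector_derivative
           wave_int (\<lambda>lam. - of_real (wavenum \<beta> lam) * g lam) \<beta> X Y) (at X)"
proof -
  have g': "subexp (\<lambda>lam. - of_real (wavenum \<beta> lam) * g lam)"
    using g by (intro subexp_intros)
  obtain C where C: "\<And>x lam. x \<ge> X / 2 \<Longrightarrow> norm (- of_real (wavenum \<beta> lam) * g lam * wave \<beta> x Y lam)
      \<le> C * exp (- (X / 2 / 2 * \<bar>lam\<bar>))"
    using subexp_wave_bound[OF g', of "X / 2"] X by (metis half_gt_zero)
  have "((\<lambda>x. \<integral>lam. g lam * wave \<beta> x Y lam \<partial>lborel) has_vector_derivative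
     (\<integral>lam. - of_real (wavenum \<beta> lam) * g lam * wave \<beta> X Y lam \<partial>lborel)) (at X)"
  proof (rule has_vector_derivative_lebesgue_integral)
    show "X / 2 > 0" using X by simp
    show "integrable lborel (\<lambda>lam. g lam * wave \<beta> x Y lam)" if "\<bar>x - X\<bar> < X / 2" for x
      using that g X by (intro integrable_subexp_wave) linarith+
    show "((\<lambda>x. g lam * wave \<beta> x Y lam) has_vector_derivative - of_real (wavenum \<beta> lam) * g lam * wave \<beta> x Y lam) (at x)" for x lam
      by (rule has_vector_derivative_eq_rhs, rule has_vector_derivative_mult_right, rule has_vector_derivative_wave_X)
         simp
    show "norm (- of_real (wavenum \<beta> lam) * g lam * wave \<beta> x Y lam) \<le> C * exp (- (X / 2 / 2 * \<bar>lam\<bar>))"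
      if "\<bar>x - X\<bar> < X / 2" for x lam
      using that by (intro C) (auto simp: abs_if split: if_splits)
    show "integrable lborel (\<lambda>lam. C * exp (- (X / 2 / 2 * \<bar>lam\<bar>)))"
      using X by (intro integrable_mult_right integrable_exp_neg_abs) auto
    show "(\<lambda>lam. - of_real (wavenum \<beta> lam) * g lam * wave \<beta> X Y lam) \<in> borel_measurable lborel"
      using subexpD[OF g'] by simp
  qed
  then show ?thesis by (simp add: wave_int_def)
qed

lemma has_vector_derivative_wave_Y:
  "((\<lambda>Y. wave \<beta> X Y lam) has_vector_derivative \<i> * of_real lam * wave \<beta> X Y lam) (at Y)"
proof -
  have "((\<lambda>Y. complex_of_real (- (wavenum \<beta> lam * X)) + \<i> * complex_of_real (lam * Y)) has_vector_derivative \<i> * of_real lam) (at Y)"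
    by (auto intro!: derivative_eq_intros simp: has_vector_derivative_def scaleR_conv_of_real algebra_simps)
  from field_vector_diff_chain_at[OF this DERIV_exp] show ?thesis
    unfolding wave_def o_def .
qed

lemma has_vector_derivative_wave_int_Y:
  assumes g: "subexp g" and X: "X > 0"
  shows "((\<lambda>Y. wave_int g \<beta> X Y) has_vector_derivative
           wave_int (\<lambda>lam. \<i> * of_real lam * g lam) \<beta> X Y) (at Y)"
proof -
  have g': "subexp (\<lambda>lam. \<i> * of_real lam * g lam)"
    using g by (intro subexp_intros)
  obtain C where C: "\<And>y lam. norm (\<i> * of_real lam * g lam * wave \<beta> X y lam) \<le> C * exp (- (X / 2 * \<bar>lam\<bar>))"
    using subexp_wave_bound[OF g' X] by (metis order_refl)
  have "((\<lambda>y. \<integral>lam. g lam * wave \<beta> X y lam \<partial>lborel) has_vector_derivative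
     (\<integral>lam. \<i> * of_real lam * g lam * wave \<beta> X Y lam \<partial>lborel)) (at Y)"
  proof (rule has_vector_derivative_lebesgue_integral)
    show "(1::real) > 0" by simp
    show "integrable lborel (\<lambda>lam. g lam * wave \<beta> X y lam)" for y
      using g X by (intro integrable_subexp_wave) auto
    show "((\<lambda>y. g lam * wave \<beta> X y lam) has_vector_derivative \<i> * of_real lam * g lam * wave \<beta> X y lam) (at y)" for y lam
      by (rule has_vector_derivative_eq_rhs, rule has_vector_derivative_mult_right, rule has_vector_derivative_wave_Y)
         simp
    show "norm (\<i> * of_real lam * g lam * wave \<beta> X y lam) \<le> C * exp (- (X / 2 * \<bar>lam\<bar>))" for y lam
      by (intro C)
    show "integrable lborel (\<lambda>lam. C * exp (- (X / 2 * \<bar>lam\<bar>)))"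
      using X by (intro integrable_mult_right integrable_exp_neg_abs) auto
    show "(\<lambda>lam. \<i> * of_real lam * g lam * wave \<beta> X Y lam) \<in> borel_measurable lborel"
      using subexpD[OF g'] by simp
  qed
  then show ?thesis by (simp add: wave_int_def)
qed

section \<open>The Bessel function as a wave integral\<close>

lemma filterlim_abs_at_bot: "filterlim (\<lambda>x::real. \<bar>x\<bar>) at_top at_bot"
  by (subst filterlim_at_bot_mirror) (auto intro: filterlim_abs_real)

lemma tendsto_wave_at_infinity:
  assumes "X > 0" "filterlim (\<lambda>x::real. \<bar>x\<bar>) at_top F"
  shows "(wave \<beta> X Y \<longlongrightarrow> 0) F"
proof (rule tendsto_norm_zero_cancel, rule tendsto_sandwich[OF _ _ tendsto_const])
  show "\<forall>\<^sub>F x in F. 0 \<le> norm (wave \<beta> X Y x)" by simp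
  show "\<forall>\<^sub>F x in F. norm (wave \<beta> X Y x) \<le> exp (- (X * \<bar>x\<bar>))"
    using assms by (intro always_eventually allI norm_wave_le) auto
  have "filterlim (\<lambda>x. X * \<bar>x\<bar>) at_top F"
    using assms by (intro filterlim_tendsto_pos_mult_at_top[OF tendsto_const])
  then show "((\<lambda>x. exp (- (X * \<bar>x\<bar>))) \<longlongrightarrow> 0) F"
    by (intro filterlim_compose[OF exp_at_bot]) (simp add: filterlim_uminus_at_top)
qed

lemma has_real_derivative_wavenum:
  assumes "\<beta> > 0"
  shows "(wavenum \<beta> has_real_derivative lam / wavenum \<beta> lam) (at lam)"
proof -
  have "lam\<^sup>2 + \<beta>\<^sup>2 > 0" using assms by (simp add: add_nonneg_pos)
  then show ?thesis
    unfolding wavenum_def[abs_def] by (auto intro!: derivative_eq_intros simp: field_simps)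
qed

lemma has_vector_derivative_wave_lam:
  assumes "\<beta> > 0"
  shows "(wave \<beta> X Y has_vector_derivative
      (\<i> * of_real Y - of_real (lam * X / wavenum \<beta> lam)) * wave \<beta> X Y lam) (at lam)"
proof -
  have "((\<lambda>lam. - (wavenum \<beta> lam * X)) has_real_derivative - (lam * X / wavenum \<beta> lam)) (at lam)"
    using has_real_derivative_wavenum[OF assms] by (auto intro!: derivative_eq_intros)
  then have "((\<lambda>lam. complex_of_real (- (wavenum \<beta> lam * X)) + \<i> * complex_of_real (lam * Y)) has_vector_derivative
      of_real (- (lam * X / wavenum \<beta> lam)) + \<i> * of_real Y) (at lam)"
    by (intro has_vector_derivative_add has_vector_derivative_mult_right has_vector_derivative_of_real)
      (auto intro!: derivative_eq_intros)
  from field_vector_diff_chain_at[OF this DERIV_exp] show ?thesis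
    unfolding wave_def[abs_def] o_def by (simp add: algebra_simps)
qed

text \<open>The integrand is the \<open>lam\<close>-derivative of a wave that vanishes at both
  infinities. This identity is what annihilates the angular derivative in the rotation
  argument.\<close>

lemma integral_wave_deriv:
  assumes "\<beta> > 0" "X > 0"
  shows "(\<integral>lam. (\<i> * of_real Y - of_real (lam * X / wavenum \<beta> lam)) * wave \<beta> X Y lam \<partial>lborel) = 0"
proof -
  have b: "norm (\<i> * complex_of_real Y - of_real (lam * X / wavenum \<beta> lam)) \<le> \<bar>Y\<bar> + X" for lam
  proof -
    have "\<bar>lam\<bar> / wavenum \<beta> lam \<le> 1"
      using wavenum_ge[of lam \<beta>] wavenum_pos[of \<beta> lam] assms by (simp add: divide_le_eq)
    then have "\<bar>lam\<bar> / wavenum \<beta> lam * X \<le> 1 * X" using assms by (intro mult_right_mono) auto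
    then have "norm (complex_of_real (lam * X / wavenum \<beta> lam)) \<le> X"
      using assms wavenum_nonneg[of \<beta> lam] by (simp add: norm_mult norm_divide)
    then show ?thesis using norm_triangle_ineq4[of "\<i> * of_real Y" "of_real (lam * X / wavenum \<beta> lam)"]
      by (simp add: norm_mult)
  qed
  have c: "continuous_on UNIV (\<lambda>lam. (\<i> * complex_of_real Y - of_real (lam * X / wavenum \<beta> lam)) * wave \<beta> X Y lam)"
    using wavenum_pos[of \<beta>] assms by (intro continuous_intros) (auto simp: less_le)
  have i: "integrable lborel (\<lambda>lam. (\<i> * of_real Y - of_real (lam * X / wavenum \<beta> lam)) * wave \<beta> X Y lam)"
    using assms b by (intro integrable_subexp_wave subexp_bounded[where C="\<bar>Y\<bar> + X"]) measurable
  have "(LBINT lam=-\<infinity>..\<infinity>. (\<i> * of_real Y - of_real (lam * X / wavenum \<beta> lam)) * wave \<beta> X Y lam) = 0 - 0"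
  proof (rule interval_integral_FTC_integrable)
    show "(wave \<beta> X Y has_vector_derivative (\<i> * of_real Y - of_real (lam * X / wavenum \<beta> lam)) * wave \<beta> X Y lam) (at lam)" for lam
      by (rule has_vector_derivative_wave_lam[OF assms(1)])
    show "isCont (\<lambda>lam. (\<i> * complex_of_real Y - of_real (lam * X / wavenum \<beta> lam)) * wave \<beta> X Y lam) lam" for lam
      using c by (simp add: continuous_on_eq_continuous_at)
    show "set_integrable lborel (einterval (-\<infinity>) \<infinity>)
        (\<lambda>lam. (\<i> * complex_of_real Y - of_real (lam * X / wavenum \<beta> lam)) * wave \<beta> X Y lam)"
      using i by (simp add: set_integrable_def)
    show "((wave \<beta> X Y \<circ> real_of_ereal) \<longlongrightarrow> 0) (at_right (- \<infinity>))"
      unfolding ereal_tendsto_simps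
      by (rule tendsto_wave_at_infinity[OF assms(2) filterlim_abs_at_bot])
    show "((wave \<beta> X Y \<circ> real_of_ereal) \<longlongrightarrow> 0) (at_left \<infinity>)"
      unfolding ereal_tendsto_simps
      by (rule tendsto_wave_at_infinity[OF assms(2) filterlim_abs_real])
  qed simp
  then show "(\<integral>lam. (\<i> * of_real Y - of_real (lam * X / wavenum \<beta> lam)) * wave \<beta> X Y lam \<partial>lborel) = 0"
    by (simp add: interval_lebesgue_integral_def set_lebesgue_integral_def)
qed

abbreviation inv_wavenum :: "real \<Rightarrow> real \<Rightarrow> complex" where
  "inv_wavenum \<beta> \<equiv> (\<lambda>lam. of_real (1 / wavenum \<beta> lam))"

lemma subexp_inv_wavenum:
  assumes "\<beta> > 0" shows "subexp (inv_wavenum \<beta>)"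
proof (rule subexp_bounded[where C="1 / \<beta>"])
  show "norm (complex_of_real (1 / wavenum \<beta> x)) \<le> 1 / \<beta>" for x
    using wavenum_ge'[of \<beta> x] assms by (simp add: norm_divide frac_le)
qed measurable

text \<open>In polar coordinates the integrand of the angular derivative is \<open>- \<i>\<close> times the total \<open>\<lambda>\<close>-derivative of the wave.\<close>

lemma wave_int_rotation_invariant:
  assumes \<beta>: "\<beta> > 0" and X: "X > 0"
  shows "wave_int (inv_wavenum \<beta>) \<beta> X Y = wave_int (inv_wavenum \<beta>) \<beta> (sqrt (X\<^sup>2 + Y\<^sup>2)) 0"
proof -
  define r where "r = sqrt (X\<^sup>2 + Y\<^sup>2)"
  have r: "r > 0" using X by (simp add: r_def add_pos_nonneg)
  let ?W = "\<lambda>\<phi> lam. wave \<beta> (r * cos \<phi>) (r * sin \<phi>) lam"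
  have D: "((\<lambda>\<phi>. wave_int (inv_wavenum \<beta>) \<beta> (r * cos \<phi>) (r * sin \<phi>)) has_vector_derivative 0) (at \<phi>0)"
    if \<phi>0: "\<bar>\<phi>0\<bar> < pi / 2" for \<phi>0
  proof -
    \<comment> \<open>With half the distance to the ends of the angular interval, the cosine stays
      above \<open>c > 0\<close> on the whole neighbourhood, so the waves decay there at the uniform
      rate \<open>r * c\<close>.\<close>
    define e where "e = (pi / 2 - \<bar>\<phi>0\<bar>) / 2"
    have e: "e > 0" "\<bar>\<phi>0\<bar> + e < pi / 2" using that by (auto simp: e_def field_simps)
    define c where "c = cos (\<bar>\<phi>0\<bar> + e)"
    have c: "c > 0" unfolding c_def using e that by (intro cos_gt_zero_pi) linarith+
    have cc: "cos \<phi> \<ge> c" if "\<bar>\<phi> - \<phi>0\<bar> < e" for \<phi>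
    proof -
      have "cos \<bar>\<phi>\<bar> \<ge> c" unfolding c_def using that e by (intro cos_monotone_0_pi_le) linarith+
      then show ?thesis by simp
    qed
    let ?d = "\<lambda>\<phi> lam. (of_real (wavenum \<beta> lam * r * sin \<phi>) + \<i> * of_real (lam * r * cos \<phi>)) / of_real (wavenum \<beta> lam)"
    have dd: "?d \<phi> lam = - \<i> * (\<i> * of_real (r * sin \<phi>) - of_real (lam * (r * cos \<phi>) / wavenum \<beta> lam))" for \<phi> lam
      using wavenum_pos[of \<beta> lam] \<beta> by (simp add: field_simps)
    have "((\<lambda>\<phi>. \<integral>lam. inv_wavenum \<beta> lam * ?W \<phi> lam \<partial>lborel) has_vector_derivative
        (\<integral>lam. ?d \<phi>0 lam * ?W \<phi>0 lam \<partial>lborel)) (at \<phi>0)"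
    proof (rule has_vector_derivative_lebesgue_integral)
      show "e > 0" by fact
      show "integrable lborel (\<lambda>lam. inv_wavenum \<beta> lam * ?W \<phi> lam)" if "\<bar>\<phi> - \<phi>0\<bar> < e" for \<phi>
        using cc[OF that] c r by (intro integrable_subexp_wave subexp_inv_wavenum \<beta>) auto
      show "((\<lambda>\<phi>. inv_wavenum \<beta> lam * ?W \<phi> lam) has_vector_derivative ?d \<phi> lam * ?W \<phi> lam) (at \<phi>)" for \<phi> lam
      proof -
        have "((\<lambda>\<phi>. complex_of_real (- (wavenum \<beta> lam * (r * cos \<phi>))) + \<i> * of_real (lam * (r * sin \<phi>))) has_vector_derivative
            of_real (wavenum \<beta> lam * r * sin \<phi>) + \<i> * of_real (lam * r * cos \<phi>)) (at \<phi>)"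
          by (intro has_vector_derivative_add has_vector_derivative_mult_right has_vector_derivative_of_real)
            (auto intro!: derivative_eq_intros)
        from has_vector_derivative_mult_right[OF field_vector_diff_chain_at[OF this DERIV_exp], of "inv_wavenum \<beta> lam"]
        show ?thesis unfolding wave_def[abs_def] o_def
          using wavenum_pos[of \<beta> lam] \<beta> by (simp add: add_divide_distrib algebra_simps)
      qed
      show "norm (?d \<phi> lam * ?W \<phi> lam) \<le> 2 * r * exp (- (r * c * \<bar>lam\<bar>))" if "\<bar>\<phi> - \<phi>0\<bar> < e" for \<phi> lam
        unfolding norm_mult
      proof (rule mult_mono)
        have k: "wavenum \<beta> lam > 0" using wavenum_pos \<beta> by blast
        have "norm (of_real (wavenum \<beta> lam * r * sin \<phi>) + \<i> * of_real (lam * r * cos \<phi>))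
          \<le> \<bar>wavenum \<beta> lam * r * sin \<phi>\<bar> + \<bar>lam * r * cos \<phi>\<bar>"
          by (rule order_trans[OF norm_triangle_ineq]) (simp add: norm_mult abs_mult)
        also have "\<dots> \<le> wavenum \<beta> lam * r * 1 + wavenum \<beta> lam * r * 1"
          unfolding abs_mult using r k wavenum_ge[of lam \<beta>]
          by (intro add_mono mult_mono) auto
        finally have "norm (of_real (wavenum \<beta> lam * r * sin \<phi>) + \<i> * of_real (lam * r * cos \<phi>))
          \<le> 2 * r * wavenum \<beta> lam" by simp
        then show "norm (?d \<phi> lam) \<le> 2 * r"
          using k unfolding norm_divide by (subst pos_divide_le_eq) auto
        have "r * c \<le> r * cos \<phi>" using cc[OF that] r by simp
        then show "norm (?W \<phi> lam) \<le> exp (- (r * c * \<bar>lam\<bar>))"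
          using r c cc[OF that] by (intro order_trans[OF norm_wave_le]) (auto intro!: mult_right_mono)
      qed (use r in auto)
      show "integrable lborel (\<lambda>lam. 2 * r * exp (- (r * c * \<bar>lam\<bar>)))"
        using r c by (intro integrable_mult_right integrable_exp_neg_abs) auto
      show "(\<lambda>lam. ?d \<phi>0 lam * ?W \<phi>0 lam) \<in> borel_measurable lborel" by measurable
    qed
    also have "(\<integral>lam. ?d \<phi>0 lam * ?W \<phi>0 lam \<partial>lborel) =
       - \<i> * (\<integral>lam. (\<i> * of_real (r * sin \<phi>0) - of_real (lam * (r * cos \<phi>0) / wavenum \<beta> lam)) * ?W \<phi>0 lam \<partial>lborel)"
      unfolding dd mult.assoc[of "- \<i>"] by (rule integral_mult_right_zero)
    also have "\<dots> = 0"
      using cc[of \<phi>0] e c r integral_wave_deriv[OF \<beta>, of "r * cos \<phi>0" "r * sin \<phi>0"] by simp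
    finally show ?thesis by (simp add: wave_int_def)
  qed
  obtain C where C: "\<And>\<phi>. \<bar>\<phi>\<bar> < pi / 2 \<Longrightarrow> wave_int (inv_wavenum \<beta>) \<beta> (r * cos \<phi>) (r * sin \<phi>) = C"
  proof -
    let ?I = "{- (pi/2)<..<pi/2}" and ?F = "\<lambda>\<phi>. wave_int (inv_wavenum \<beta>) \<beta> (r * cos \<phi>) (r * sin \<phi>)"
    have "convex ?I" by (rule convex_real_interval)
    moreover have "(?F has_vector_derivative 0) (at \<phi> within ?I)" if "\<phi> \<in> ?I" for \<phi>
      using that by (intro has_vector_derivative_at_within[OF D]) (auto simp: abs_less_iff)
    ultimately obtain C where C: "\<And>\<phi>. \<phi> \<in> ?I \<Longrightarrow> ?F \<phi> = C"
      using has_vector_derivative_zero_constant[of ?I ?F] by blast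
    have "\<phi> \<in> ?I" if "\<bar>\<phi>\<bar> < pi / 2" for \<phi> using that by (simp only: greaterThanLessThan_iff) linarith
    then show ?thesis using C that by blast
  qed
  \<comment> \<open>Because \<open>X > 0\<close>, this is the polar angle of \<open>(X, Y)\<close>
    and lies in the interval of constancy; angle 0 gives the point \<open>(r, 0)\<close>.\<close>
  define \<phi> where "\<phi> = arctan (Y / X)"
  have r2: "r = X * sqrt (1 + (Y / X)\<^sup>2)"
  proof -
    have "X * sqrt (1 + (Y / X)\<^sup>2) = sqrt (X\<^sup>2 * (1 + (Y / X)\<^sup>2))"
      using X by (simp add: real_sqrt_mult)
    also have "X\<^sup>2 * (1 + (Y / X)\<^sup>2) = X\<^sup>2 + Y\<^sup>2" using X by (simp add: field_simps)
    finally show ?thesis by (simp add: r_def)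
  qed
  have "sqrt (1 + (Y / X)\<^sup>2) > 0" by (simp add: add_pos_nonneg)
  then have "r * cos \<phi> = X" "r * sin \<phi> = Y"
    unfolding \<phi>_def cos_arctan sin_arctan r2 using X by auto
  moreover have "\<bar>\<phi>\<bar> < pi / 2" unfolding \<phi>_def using arctan_bounded[of "Y / X"] by auto
  ultimately show ?thesis using C[of \<phi>] C[of 0] by (simp add: r_def)
qed

lemma cosh_ge_half: "u / 2 \<le> cosh (u::real)"
proof -
  have "cosh u \<ge> exp u / 2" by (simp add: cosh_field_def)
  then show ?thesis using exp_ge_add_one_self[of u] by linarith
qed

lemma bessel_K0_wave_int:
  assumes \<beta>: "\<beta> > 0" and r: "r > 0"
  shows "wave_int (inv_wavenum \<beta>) \<beta> r 0 = of_real (2 * bessel_K0 (\<beta> * r))"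
proof -
  let ?f = "\<lambda>lam. exp (- (wavenum \<beta> lam * r)) / wavenum \<beta> lam"
  have w: "wavenum \<beta> (\<beta> * sinh u) = \<beta> * cosh u" for u
  proof -
    have "(\<beta> * sinh u)\<^sup>2 + \<beta>\<^sup>2 = (\<beta> * cosh u)\<^sup>2"
      using cosh_square_eq[of u] by (simp add: power_mult_distrib algebra_simps)
    then show ?thesis using \<beta> by (simp add: wavenum_def)
  qed
  have ii: "set_integrable lborel (einterval 0 \<infinity>) (\<lambda>u. exp (- (\<beta> * r * cosh u)))"
  proof -
    have "integrable lborel (\<lambda>u. exp (- (\<beta> * r / 2 * \<bar>u\<bar>)))"
      using \<beta> r by (intro integrable_exp_neg_abs) auto
    then show ?thesis unfolding set_integrable_def
    proof (rule Bochner_Integration.integrable_bound, goal_cases)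
      case 2
      have "norm (indicator (einterval 0 \<infinity>) u *\<^sub>R exp (- (\<beta> * r * cosh u))) \<le> exp (- (\<beta> * r / 2 * \<bar>u\<bar>))" for u
      proof (cases "u > 0")
        case True
        then have "\<beta> * r * (u / 2) \<le> \<beta> * r * cosh u" using \<beta> r by (intro mult_left_mono cosh_ge_half) auto
        then show ?thesis using True by (auto simp: indicator_def)
      qed (auto simp: indicator_def einterval_def)
      then show ?case by simp
    next
      case 1
      have "(\<lambda>u. exp (- (\<beta> * r * cosh u))) \<in> borel_measurable borel"
        by (intro borel_measurable_continuous_onI continuous_intros)
      then show ?case by measurable
    qed
  qed
  have sub: "(LBINT lam=0..\<infinity>. ?f lam) = (LBINT u=0..\<infinity>. ?f (\<beta> * sinh u) * (\<beta> * cosh u))"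
  proof (rule interval_integral_substitution_nonneg)
    show "((\<lambda>u. \<beta> * sinh u) has_real_derivative \<beta> * cosh u) (at u)" for u
      by (auto intro!: derivative_eq_intros)
    have "continuous_on UNIV ?f"
      using wavenum_pos[of \<beta>] \<beta> by (intro continuous_intros) (auto simp: less_le)
    then show "isCont ?f (\<beta> * sinh u)" for u by (simp add: continuous_on_eq_continuous_at)
    show "isCont (\<lambda>u. \<beta> * cosh u) u" for u by (intro continuous_intros)
    show "0 \<le> ?f (\<beta> * sinh u)" for u by (simp add: wavenum_nonneg)
    show "0 \<le> \<beta> * cosh u" for u using \<beta> by simp
    show "((ereal \<circ> (\<lambda>u. \<beta> * sinh u) \<circ> real_of_ereal) \<longlongrightarrow> 0) (at_right 0)"
    proof -
      have "((\<lambda>u. \<beta> * sinh u) \<longlongrightarrow> \<beta> * sinh 0) (at_right 0)" by (intro tendsto_intros)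
      then show ?thesis unfolding zero_ereal_def ereal_tendsto_simps by simp
    qed
    show "((ereal \<circ> (\<lambda>u. \<beta> * sinh u) \<circ> real_of_ereal) \<longlongrightarrow> \<infinity>) (at_left \<infinity>)"
      unfolding ereal_tendsto_simps
      by (intro filterlim_tendsto_pos_mult_at_top[OF tendsto_const \<beta>] sinh_real_at_top)
    show "set_integrable lborel (einterval 0 \<infinity>) (\<lambda>u. ?f (\<beta> * sinh u) * (\<beta> * cosh u))"
      using ii \<beta> by (simp add: w mult_ac)
  qed simp
  \<comment> \<open>The substitution rule yields integrals over the open half-line, whereas
    \<open>bessel_K0\<close> uses the closed one.\<close>
  have ic: "(LBINT x:{0<..}. h x) = (LBINT x:{0..}. h x)" if "h \<in> borel_measurable borel" for h :: "real \<Rightarrow> real"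
    unfolding set_lebesgue_integral_def using that AE_lborel_singleton[of 0]
    by (intro integral_cong_AE) (auto simp: indicator_def)
  have "(\<lambda>u. exp (- (\<beta> * r * cosh u))) \<in> borel_measurable borel"
    by (intro borel_measurable_continuous_onI continuous_intros)
  then have "bessel_K0 (\<beta> * r) = (LBINT u:{0<..}. exp (- (\<beta> * r * cosh u)))"
    by (simp add: bessel_K0_def ic)
  also have "\<dots> = (LBINT u=0..\<infinity>. ?f (\<beta> * sinh u) * (\<beta> * cosh u))"
    using \<beta> by (simp add: w mult_ac zero_ereal_def interval_integral_to_infinity_eq)
  also have "\<dots> = (LBINT lam:{0<..}. ?f lam)"
    using sub by (simp add: zero_ereal_def interval_integral_to_infinity_eq)
  also have "\<dots> = (LBINT lam:{0..}. ?f lam)"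
    by (intro ic) measurable
  finally have K: "bessel_K0 (\<beta> * r) = (LBINT lam:{0..}. ?f lam)" .
  \<comment> \<open>At height \<open>Y = 0\<close> the integrand is real and even in
    \<open>lam\<close>; folding the line at 0 yields the factor 2.\<close>
  have e: "inv_wavenum \<beta> lam * wave \<beta> r 0 lam = of_real (?f lam)" for lam
    by (simp add: wave_def exp_of_real[symmetric])
  have "wave_int (inv_wavenum \<beta>) \<beta> r 0 = (LBINT lam:{0..}. inv_wavenum \<beta> lam * wave \<beta> r 0 lam
      + inv_wavenum \<beta> (- lam) * wave \<beta> r 0 (- lam))"
    unfolding wave_int_def
    using integrable_subexp_wave[OF subexp_inv_wavenum[OF \<beta>] r] by (rule lborel_integral_split_reflect)
  also have "\<dots> = (LBINT lam:{0..}. complex_of_real (2 * ?f lam))"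
    unfolding e by simp
  also have "\<dots> = of_real (2 * bessel_K0 (\<beta> * r))"
    unfolding K set_integral_complex_of_real by (simp only: set_integral_mult_right)
  finally show ?thesis .
qed

section \<open>The modified Stokeslet as a wave integral\<close>

lemma integral_exp_complex_half_line:
  assumes z: "Re z > 0"
  shows "set_integrable lborel {0..} (\<lambda>x. exp (- (z * of_real x)))"
    and "(LBINT x:{0..}. exp (- (z * of_real x))) = 1 / z"
proof -
  have nz: "z \<noteq> 0" using z by auto
  have m: "(\<lambda>x. exp (- (z * of_real x))) \<in> borel_measurable borel"
    by (intro borel_measurable_continuous_onI continuous_intros)
  have i: "set_integrable lborel A (\<lambda>x. exp (- (z * of_real x)))" if "A \<subseteq> {0..}" "A \<in> sets borel" for A
    unfolding set_integrable_def
  proof (rule Bochner_Integration.integrable_bound[OF integrable_exp_neg_abs[OF z]])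
    show "AE x in lborel. norm (indicator A x *\<^sub>R exp (- (z * of_real x))) \<le> norm (exp (- (Re z * \<bar>x\<bar>)))"
      using that by (intro AE_I2) (auto simp: indicator_def)
  qed (use m that in measurable)
  show "set_integrable lborel {0..} (\<lambda>x. exp (- (z * of_real x)))" by (rule i) auto
  have "(LBINT x=0..\<infinity>. exp (- (z * of_real x))) = 0 - (- 1 / z)"
  proof (rule interval_integral_FTC_integrable)
    show "((\<lambda>x. - exp (- (z * of_real x)) / z) has_vector_derivative exp (- (z * of_real x))) (at x)" for x
    proof -
      have "((\<lambda>x. - (z * complex_of_real x)) has_vector_derivative - z) (at x)"
        by (auto intro!: derivative_eq_intros simp: has_vector_derivative_def scaleR_conv_of_real)
      from has_vector_derivative_mult_right[OF field_vector_diff_chain_at[OF this DERIV_exp], of "- 1 / z"]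
      show ?thesis using nz by (simp add: o_def)
    qed
    show "isCont (\<lambda>x. exp (- (z * of_real x))) x" for x by (intro continuous_intros)
    show "set_integrable lborel (einterval 0 \<infinity>) (\<lambda>x. exp (- (z * of_real x)))"
      by (rule i) (auto simp: einterval_def)
    have "((\<lambda>x. - exp (- (z * complex_of_real x)) / z) \<longlongrightarrow> - exp (- (z * complex_of_real 0)) / z) (at_right 0)"
      by (intro tendsto_intros nz)
    then show "(((\<lambda>x. - exp (- (z * of_real x)) / z) \<circ> real_of_ereal) \<longlongrightarrow> - 1 / z) (at_right 0)"
      unfolding zero_ereal_def ereal_tendsto_simps by simp
    have "((\<lambda>x. - exp (- (z * complex_of_real x)) / z) \<longlongrightarrow> 0) at_top"
    proof (rule tendsto_norm_zero_cancel)
      have "filterlim (\<lambda>x. Re z * x) at_top at_top"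
        by (intro filterlim_tendsto_pos_mult_at_top[OF tendsto_const z] filterlim_ident)
      then have "((\<lambda>x. exp (- (Re z * x))) \<longlongrightarrow> 0) at_top"
        by (intro filterlim_compose[OF exp_at_bot]) (simp add: filterlim_uminus_at_top)
      then have "((\<lambda>x. exp (- (Re z * x)) / norm z) \<longlongrightarrow> 0 / norm z) at_top"
        using nz by (intro tendsto_intros) auto
      then show "((\<lambda>x. norm (- exp (- (z * complex_of_real x)) / z)) \<longlongrightarrow> 0) at_top"
        by (simp add: norm_divide)
    qed
    then show "(((\<lambda>x. - exp (- (z * of_real x)) / z) \<circ> real_of_ereal) \<longlongrightarrow> 0) (at_left \<infinity>)"
      unfolding ereal_tendsto_simps .
  qed simp
  also have "(LBINT x=0..\<infinity>. exp (- (z * of_real x))) = (LBINT x:{0<..}. exp (- (z * of_real x)))"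
    by (simp add: zero_ereal_def interval_integral_to_infinity_eq)
  also have "\<dots> = (LBINT x:{0..}. exp (- (z * of_real x)))"
    unfolding set_lebesgue_integral_def using m AE_lborel_singleton[of 0]
    by (intro integral_cong_AE) (auto simp: indicator_def)
  finally show "(LBINT x:{0..}. exp (- (z * of_real x))) = 1 / z" by simp
qed

text \<open>A weight that is constant on each half-line leaves two exponential integrals with
  conjugate rates, hence \<open>a / (X - iY) + b / (X + iY)\<close>. In these values the gradient of
  the logarithm will be recognized.\<close>

lemma wave_int_zero_split:
  assumes g: "subexp g" and X: "X > 0"
    and gp: "\<And>x. x > 0 \<Longrightarrow> g x = a" and gm: "\<And>x. x > 0 \<Longrightarrow> g (- x) = b"
  shows "wave_int g 0 X Y = (a * Complex X Y + b * Complex X (- Y)) / of_real (X\<^sup>2 + Y\<^sup>2)"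
proof -
  have "X\<^sup>2 + Y\<^sup>2 > 0" using X by (simp add: add_pos_nonneg)
  then have nz: "complex_of_real (X\<^sup>2 + Y\<^sup>2) \<noteq> 0" "Complex X Y \<noteq> 0" "Complex X (- Y) \<noteq> 0"
    using X by (auto simp del: of_real_add of_real_power simp: complex_eq_iff)
  have zz: "Complex X Y * Complex X (- Y) = of_real (X\<^sup>2 + Y\<^sup>2)"
    by (simp add: complex_eq_iff power2_eq_square)
  note int = integral_exp_complex_half_line[of "Complex X (- Y)"] integral_exp_complex_half_line[of "Complex X Y"]
  have "wave_int g 0 X Y = (LBINT x:{0..}. g x * wave 0 X Y x + g (- x) * wave 0 X Y (- x))"
    unfolding wave_int_def by (rule lborel_integral_split_reflect[OF integrable_subexp_wave[OF g X]])
  also have "\<dots> = (LBINT x:{0..}. a * exp (- (Complex X (- Y) * of_real x)) + b * exp (- (Complex X Y * of_real x)))"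
    unfolding set_lebesgue_integral_def
  proof (rule integral_cong_AE)
    show "AE x in lborel. indicator {0..} x *\<^sub>R (g x * wave 0 X Y x + g (- x) * wave 0 X Y (- x)) =
      indicator {0..} x *\<^sub>R (a * exp (- (Complex X (- Y) * of_real x)) + b * exp (- (Complex X Y * of_real x)))"
      using AE_lborel_singleton[of 0]
    proof eventually_elim
      case (elim x)
      show ?case
      proof (cases "x > 0")
        case True
        then have "complex_of_real (- (wavenum 0 x * X)) + \<i> * of_real (x * Y) = - (Complex X (- Y) * of_real x)"
          and "complex_of_real (- (wavenum 0 (- x) * X)) + \<i> * of_real (- x * Y) = - (Complex X Y * of_real x)"
          by (simp_all add: complex_eq_iff)
        then have "wave 0 X Y x = exp (- (Complex X (- Y) * of_real x))"
          and "wave 0 X Y (- x) = exp (- (Complex X Y * of_real x))"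
          unfolding wave_def by (simp_all only:)
        with True gp gm show ?thesis by simp
      qed (use elim in \<open>auto simp: indicator_def\<close>)
    qed
    have [measurable]: "g \<in> borel_measurable borel" by (rule subexpD[OF g])
    show "(\<lambda>x. indicator {0..} x *\<^sub>R (g x * wave 0 X Y x + g (- x) * wave 0 X Y (- x))) \<in> borel_measurable lborel"
      by measurable
    have [measurable]: "(\<lambda>x. exp (- (z * complex_of_real x))) \<in> borel_measurable borel" for z
      by (intro borel_measurable_continuous_onI continuous_intros)
    show "(\<lambda>x. indicator {0..} x *\<^sub>R (a * exp (- (Complex X (- Y) * of_real x)) + b * exp (- (Complex X Y * of_real x))))
        \<in> borel_measurable lborel" by measurable
  qed
  also have "\<dots> = a * (1 / Complex X (- Y)) + b * (1 / Complex X Y)"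
    using int X by (subst set_integral_add) auto
  also have "1 / Complex X (- Y) = Complex X Y / of_real (X\<^sup>2 + Y\<^sup>2)"
    using nz zz by (simp add: frac_eq_eq mult.commute)
  also have "1 / Complex X Y = Complex X (- Y) / of_real (X\<^sup>2 + Y\<^sup>2)"
    using nz zz by (simp add: frac_eq_eq mult.commute)
  finally show ?thesis by (simp add: add_divide_distrib)
qed

lemma subexp_ratio: "subexp (\<lambda>lam. of_real (lam / wavenum \<beta> lam))"
proof (rule subexp_bounded[where C=1])
  show "norm (complex_of_real (x / wavenum \<beta> x)) \<le> 1" for x
    using wavenum_ge[of x \<beta>] wavenum_nonneg[of \<beta> x] by (simp add: norm_divide divide_le_eq)
qed measurable

lemma partial_deriv_1_eq:
  assumes "p$1 > 0" and f: "\<And>q. q$1 > 0 \<Longrightarrow> f q = F (q$1) (q$2)"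
    and D: "((\<lambda>x. F x (p$2)) has_real_derivative D) (at (p$1))"
  shows "partial_deriv 1 f p = D"
proof -
  have "((\<lambda>h. F (p$1 + h) (p$2)) has_real_derivative D) (at 0)"
    using D by (intro DERIV_chain2[where f="\<lambda>x. F x (p$2)" and g="\<lambda>h. p$1 + h" and Db=1, simplified])
      (auto intro!: derivative_eq_intros)
  then have "((\<lambda>h. f (p + h *\<^sub>R axis 1 1)) has_real_derivative D) (at 0)"
    by (rule has_field_derivative_transform_within_open[of _ _ _ "{- (p$1)<..}"])
      (use assms(1) in \<open>auto simp: f axis_def\<close>)
  then show ?thesis unfolding partial_deriv_def by (rule DERIV_imp_deriv)
qed

lemma partial_deriv_2_eq:
  assumes "p$1 > 0" and f: "\<And>q. q$1 > 0 \<Longrightarrow> f q = F (q$1) (q$2)"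
    and D: "((\<lambda>y. F (p$1) y) has_real_derivative D) (at (p$2))"
  shows "partial_deriv 2 f p = D"
proof -
  have "((\<lambda>h. F (p$1) (p$2 + h)) has_real_derivative D) (at 0)"
    using D by (intro DERIV_chain2[where f="F (p$1)" and g="\<lambda>h. p$2 + h" and Db=1, simplified])
      (auto intro!: derivative_eq_intros)
  moreover have "(\<lambda>h. F (p$1) (p$2 + h)) = (\<lambda>h. f (p + h *\<^sub>R axis 2 1))"
    using assms(1) by (auto simp: f axis_def)
  ultimately show ?thesis unfolding partial_deriv_def by (simp add: DERIV_imp_deriv)
qed

text \<open>The subtracted integral at \<open>\<beta> = 0\<close> represents the derivatives of the logarithm in \<^const>\<open>G_MB\<close>.\<close>

definition wave_diff :: "(real \<Rightarrow> real \<Rightarrow> complex) \<Rightarrow> real \<Rightarrow> real \<Rightarrow> real \<Rightarrow> real" where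
  "wave_diff g \<beta> X Y = - (1 / (4 * pi * \<beta>\<^sup>2)) * Re (wave_int (g \<beta>) \<beta> X Y - wave_int (g 0) 0 X Y)"

lemma has_real_derivative_Re:
  "(f has_vector_derivative D) F \<Longrightarrow> ((\<lambda>x. Re (f x)) has_real_derivative Re D) F"
  unfolding has_real_derivative_iff_has_vector_derivative
  by (rule bounded_linear.has_vector_derivative[OF bounded_linear_Re])

lemma has_real_derivative_wave_diff:
  assumes "\<And>\<beta>. subexp (g \<beta>)" "X > 0"
  shows "((\<lambda>X. wave_diff g \<beta> X Y) has_real_derivative
           wave_diff (\<lambda>\<beta> lam. - of_real (wavenum \<beta> lam) * g \<beta> lam) \<beta> X Y) (at X)"
    and "((\<lambda>Y. wave_diff g \<beta> X Y) has_real_derivative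
           wave_diff (\<lambda>\<beta> lam. \<i> * of_real lam * g \<beta> lam) \<beta> X Y) (at Y)"
  unfolding wave_diff_def using assms
  by (intro DERIV_cmult has_real_derivative_Re has_vector_derivative_diff
      has_vector_derivative_wave_int_X has_vector_derivative_wave_int_Y; simp)+

lemma norm_vec2: "norm (p::real^2) = sqrt ((p$1)\<^sup>2 + (p$2)\<^sup>2)"
  by (simp add: norm_vec_def L2_set_def sum_2)

text \<open>The logarithm stays explicit: the integral that would represent it at \<beta> = 0
  diverges at \<open>lam = 0\<close>. The factor 4 in place of 2 comes from
  \<open>2 * bessel_K0\<close> and from \<open>ln (r^2) = 2 * ln r\<close>.\<close>

lemma G_MB_wave_int:
  assumes "\<beta> > 0" "p$1 > 0"
  shows "G_MB \<beta> p = - (1 / (4 * pi * \<beta>\<^sup>2)) * (Re (wave_int (inv_wavenum \<beta>) \<beta> (p$1) (p$2)) + ln ((p$1)\<^sup>2 + (p$2)\<^sup>2))"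
proof -
  have n: "(p$1)\<^sup>2 + (p$2)\<^sup>2 > 0" using assms by (simp add: add_pos_nonneg)
  then have "ln (1 / norm p) = - (1/2) * ln ((p$1)\<^sup>2 + (p$2)\<^sup>2)"
    unfolding norm_vec2 by (simp add: ln_div ln_sqrt)
  moreover have "bessel_K0 (\<beta> * norm p) = Re (wave_int (inv_wavenum \<beta>) \<beta> (p$1) (p$2)) / 2"
    using bessel_K0_wave_int[OF assms(1), of "norm p"] n wave_int_rotation_invariant[OF assms, of "p$2"]
    unfolding norm_vec2 by simp
  moreover have "- (1 / (2 * c)) * (x / 2 - - (1/2) * y) = - (1 / (4 * c)) * (x + y)" for c x y :: real
    by (simp add: field_simps)
  from this[of "pi * \<beta>\<^sup>2"] have "- (1 / (2 * pi * \<beta>\<^sup>2)) * (x / 2 - - (1/2) * y) = - (1 / (4 * pi * \<beta>\<^sup>2)) * (x + y)" for x y :: real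
    by (simp only: mult.assoc)
  ultimately show ?thesis unfolding G_MB_def by (simp only:)
qed

text \<open>Differentiation multiplies the weight \<open>1 / k\<close> by \<open>- k\<close> or
  \<open>i * lam\<close>. At \<beta> = 0 the resulting weights are \<open>- 1\<close> and
  \<open>i * sgn lam\<close>, whose integrals are minus the components of the gradient of
  \<open>ln (x^2 + y^2)\<close>; the logarithmic term thus becomes the subtracted integral.\<close>

lemma partial_G_MB:
  assumes "\<beta> > 0" "p$1 > 0"
  shows "partial_deriv 1 (G_MB \<beta>) p = wave_diff (\<lambda>\<beta> lam. - 1) \<beta> (p$1) (p$2)"
    and "partial_deriv 2 (G_MB \<beta>) p = wave_diff (\<lambda>\<beta> lam. \<i> * of_real (lam / wavenum \<beta> lam)) \<beta> (p$1) (p$2)"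
proof -
  have r: "(p$1)\<^sup>2 + (p$2)\<^sup>2 > 0" using assms by (simp add: add_pos_nonneg)
  let ?F = "\<lambda>x y. - (1 / (4 * pi * \<beta>\<^sup>2)) * (Re (wave_int (inv_wavenum \<beta>) \<beta> x y) + ln (x\<^sup>2 + y\<^sup>2))"
  have "((\<lambda>x. ?F x (p$2)) has_real_derivative
      - (1 / (4 * pi * \<beta>\<^sup>2)) * (Re (wave_int (\<lambda>lam. - of_real (wavenum \<beta> lam) * inv_wavenum \<beta> lam) \<beta> (p$1) (p$2))
         + 2 * p$1 / ((p$1)\<^sup>2 + (p$2)\<^sup>2))) (at (p$1))"
    by (intro DERIV_cmult DERIV_add has_real_derivative_Re has_vector_derivative_wave_int_X subexp_inv_wavenum assms)
      (use r in \<open>auto intro!: derivative_eq_intros\<close>)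
  note partial_deriv_1_eq[where F="?F" and f="G_MB \<beta>", OF assms(2) _ this, OF G_MB_wave_int[OF assms(1)]]
  moreover have "wave_int (\<lambda>lam. - of_real (wavenum \<beta> lam) * inv_wavenum \<beta> lam) \<beta> (p$1) (p$2) = wave_int (\<lambda>lam. - 1) \<beta> (p$1) (p$2)"
    using wavenum_pos[of \<beta>] assms by (intro wave_int_cong) (auto simp: less_le)
  moreover have "wave_int (\<lambda>lam. - 1) 0 (p$1) (p$2) = of_real (- (2 * p$1 / ((p$1)\<^sup>2 + (p$2)\<^sup>2)))"
    by (subst wave_int_zero_split[of _ _ "- 1" "- 1"]) (auto intro: subexp_const assms simp: complex_eq_iff)
  ultimately show "partial_deriv 1 (G_MB \<beta>) p = wave_diff (\<lambda>\<beta> lam. - 1) \<beta> (p$1) (p$2)"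
    by (simp add: wave_diff_def)
  have "((\<lambda>y. ?F (p$1) y) has_real_derivative
      - (1 / (4 * pi * \<beta>\<^sup>2)) * (Re (wave_int (\<lambda>lam. \<i> * of_real lam * inv_wavenum \<beta> lam) \<beta> (p$1) (p$2))
         + 2 * p$2 / ((p$1)\<^sup>2 + (p$2)\<^sup>2))) (at (p$2))"
    by (intro DERIV_cmult DERIV_add has_real_derivative_Re has_vector_derivative_wave_int_Y subexp_inv_wavenum assms)
      (use r in \<open>auto intro!: derivative_eq_intros\<close>)
  note partial_deriv_2_eq[where F="?F" and f="G_MB \<beta>", OF assms(2) _ this, OF G_MB_wave_int[OF assms(1)]]
  moreover have "wave_int (\<lambda>lam. \<i> * of_real lam * inv_wavenum \<beta> lam) \<beta> (p$1) (p$2)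
      = wave_int (\<lambda>lam. \<i> * of_real (lam / wavenum \<beta> lam)) \<beta> (p$1) (p$2)"
    by (intro wave_int_cong) auto
  moreover have "wave_int (\<lambda>lam. \<i> * of_real (lam / wavenum 0 lam)) 0 (p$1) (p$2)
      = of_real (- (2 * p$2 / ((p$1)\<^sup>2 + (p$2)\<^sup>2)))"
    by (subst wave_int_zero_split[OF subexp_mult[OF subexp_const subexp_ratio] assms(2), where a="\<i>" and b="- \<i>"])
      (auto simp: complex_eq_iff)
  ultimately show "partial_deriv 2 (G_MB \<beta>) p = wave_diff (\<lambda>\<beta> lam. \<i> * of_real (lam / wavenum \<beta> lam)) \<beta> (p$1) (p$2)"
    by (simp add: wave_diff_def)
qed

text \<open>The operator matrix of the Stokeslet applied to
  \<open>exp (- k x + i lam y) / k\<close>: minus the second \<open>y\<close>-derivative gives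
  \<open>lam^2 / k\<close>, the mixed derivative \<open>- i lam\<close>, and minus the second
  \<open>x\<close>-derivative \<open>- k\<close>.\<close>

definition stokes_symbol :: "real \<Rightarrow> real \<Rightarrow> complex^2^2" where
  "stokes_symbol k lam = vector [vector [of_real (lam\<^sup>2 / k), - (\<i> * of_real lam)],
                                 vector [- (\<i> * of_real lam), - of_real k]]"

lemma G_MS_wave_diff:
  assumes "\<beta> > 0" "p$1 > 0"
  shows "G_MS \<beta> p $ a $ b = wave_diff (\<lambda>\<beta> lam. stokes_symbol (wavenum \<beta> lam) lam $ a $ b) \<beta> (p$1) (p$2)"
proof -
  have s: "subexp (\<lambda>lam. \<i> * of_real (lam / wavenum \<beta> lam))" "subexp (\<lambda>lam. - 1)" for \<beta>
    by (intro subexp_mult subexp_const subexp_ratio)+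
  have 11: "partial_deriv 1 (partial_deriv 1 (G_MB \<beta>)) p
      = wave_diff (\<lambda>\<beta> lam. - of_real (wavenum \<beta> lam) * - 1) \<beta> (p$1) (p$2)"
    by (rule partial_deriv_1_eq[OF assms(2) partial_G_MB(1)[OF assms(1)] has_real_derivative_wave_diff(1)])
      (use s assms in auto)
  have 22: "partial_deriv 2 (partial_deriv 2 (G_MB \<beta>)) p
      = wave_diff (\<lambda>\<beta> lam. \<i> * of_real lam * (\<i> * of_real (lam / wavenum \<beta> lam))) \<beta> (p$1) (p$2)"
    by (rule partial_deriv_2_eq[OF assms(2) partial_G_MB(2)[OF assms(1)] has_real_derivative_wave_diff(2)])
      (use s assms in auto)
  have 12: "partial_deriv 1 (partial_deriv 2 (G_MB \<beta>)) p
      = wave_diff (\<lambda>\<beta> lam. - of_real (wavenum \<beta> lam) * (\<i> * of_real (lam / wavenum \<beta> lam))) \<beta> (p$1) (p$2)"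
    by (rule partial_deriv_1_eq[OF assms(2) partial_G_MB(2)[OF assms(1)] has_real_derivative_wave_diff(1)])
      (use s assms in auto)
  have e2: "\<i> * of_real lam * (\<i> * of_real (lam / wavenum \<beta> lam)) = - of_real (lam\<^sup>2 / wavenum \<beta> lam)" for \<beta> lam
    by (simp add: power2_eq_square complex_eq_iff)
  \<comment> \<open>At \<open>k = 0\<close> both sides vanish, because \<open>k \<ge> |lam|\<close>
    then forces \<open>lam = 0\<close>.\<close>
  have e: "- of_real (wavenum \<beta> lam) * (\<i> * of_real (lam / wavenum \<beta> lam)) = - (\<i> * of_real lam)" for \<beta> lam
    by (cases "wavenum \<beta> lam = 0") (use wavenum_ge[of lam \<beta>] in auto)
  have m: "- wave_diff g \<beta> (p$1) (p$2) = wave_diff (\<lambda>\<beta> lam. - g \<beta> lam) \<beta> (p$1) (p$2)" for g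
    by (simp add: wave_diff_def wave_int_def right_diff_distrib)
  have "a \<in> {1, 2}" "b \<in> {1, 2}" by (use exhaust_2 in blast)+
  then show ?thesis
    using 11 22[unfolded e2] 12[unfolded e] by (auto simp: G_MS_def stokes_symbol_def m)
qed

section \<open>Sums over the images\<close>

text \<open>The order \<open>k\<close> at the origin is the essential point: it compensates the pole
  of the geometric factor.\<close>

lemma norm_stokes_symbol_le:
  assumes "\<bar>lam\<bar> \<le> k"
  shows "norm (stokes_symbol k lam $ a $ b) \<le> k"
proof -
  have "lam\<^sup>2 / k \<le> k"
  proof (cases "k = 0")
    case False
    then have "k > 0" using assms by linarith
    moreover have "lam\<^sup>2 \<le> k\<^sup>2" using assms by (simp add: abs_le_square_iff[symmetric])
    ultimately show ?thesis by (simp add: divide_le_eq power2_eq_square)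
  qed (use assms in auto)
  then have "norm (complex_of_real (lam\<^sup>2 / k)) \<le> k"
    using assms unfolding norm_of_real by (simp add: abs_of_nonneg)
  moreover have "a \<in> {1, 2}" "b \<in> {1, 2}" by (use exhaust_2 in blast)+
  ultimately show ?thesis using assms by (auto simp: stokes_symbol_def norm_mult)
qed

lemma one_minus_exp_pos: "k > 0 \<Longrightarrow> d > 0 \<Longrightarrow> 1 - exp (- (k * d)) > (0::real)"
  by simp

text \<open>With \<open>x = k * d\<close> the claim reduces to
  \<open>(x + 1) * exp (- x) \<le> 1\<close>. The pole of the geometric factor at 0 is simple, so a
  factor \<open>k\<close> removes it at the price of \<open>1 / d\<close>.\<close>

lemma div_one_minus_exp_le:
  assumes "k \<ge> 0" "d > (0::real)"
  shows "k / (1 - exp (- (k * d))) \<le> k + 1 / d"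
proof (cases "k = 0")
  case False
  then have k: "k > 0" using assms by simp
  have "k \<le> (k + 1 / d) * (1 - exp (- (k * d)))"
  proof -
    have "(k * d + 1) * exp (- (k * d)) \<le> 1"
      using exp_ge_add_one_self[of "k * d"] by (simp add: exp_minus divide_simps add.commute)
    then have "k * d \<le> (k * d + 1) * (1 - exp (- (k * d)))" by (simp add: algebra_simps)
    then have "k * d / d \<le> (k * d + 1) * (1 - exp (- (k * d))) / d"
      using assms by (intro divide_right_mono) auto
    moreover have "(k * d + 1) * (1 - exp (- (k * d))) / d = (k + 1 / d) * (1 - exp (- (k * d)))"
      using assms by (simp add: field_simps)
    ultimately show ?thesis using assms by simp
  qed
  then show ?thesis using one_minus_exp_pos[OF k assms(2)] by (simp add: divide_le_eq)
qed (use assms in auto)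

lemma wave_add: "wave \<beta> (X + real m * d) Y lam = wave \<beta> X Y lam * of_real (exp (- (wavenum \<beta> lam * d)) ^ m)"
  by (simp add: wave_def exp_of_real[symmetric] exp_of_nat_mult[symmetric] exp_add[symmetric] algebra_simps)

text \<open>A shift by one period multiplies the wave by \<open>exp (- k d)\<close>, so the images
  form a geometric series. Its absolute partial sums are dominated by \<open>(k + 1 / d)\<close>
  times the wave, which permits exchanging sum and integral. Since \<beta> = 0 is allowed, the
  subtracted part is covered too.\<close>

lemma wave_int_lattice_sums:
  assumes X: "X > 0" and d: "d > 0"
    and g: "g \<in> borel_measurable borel" and gb: "\<And>lam. norm (g lam) \<le> wavenum \<beta> lam"
  shows "(\<lambda>m. wave_int g \<beta> (X + real m * d) Y) sums
           wave_int (\<lambda>lam. g lam / of_real (1 - exp (- (wavenum \<beta> lam * d)))) \<beta> X Y"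
    and "summable (\<lambda>m. norm (wave_int g \<beta> (X + real m * d) Y))"
proof -
  let ?q = "\<lambda>lam. exp (- (wavenum \<beta> lam * d))"
  let ?f = "\<lambda>m lam. g lam * wave \<beta> (X + real m * d) Y lam"
  let ?b = "\<lambda>lam. complex_of_real (wavenum \<beta> lam + 1 / d)"
  have sg: "subexp g"
    by (rule subexp_linear[where C="\<bar>\<beta>\<bar>"]) (use g gb wavenum_le[of \<beta>] in \<open>auto intro: order_trans simp: add.commute\<close>)
  have sb: "subexp ?b"
    by (rule subexp_linear[where C="\<bar>\<beta>\<bar> + 1 / d"])
      (use wavenum_nonneg[of \<beta>] wavenum_le[of \<beta>] d in \<open>auto simp: add_ac simp flip: of_real_add\<close>)
  have XM: "X + real m * d > 0" for m using X d by (simp add: add_pos_nonneg)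
  have i: "integrable lborel (?f m)" for m
    by (rule integrable_subexp_wave[OF sg XM])
  have ib: "integrable lborel (\<lambda>lam. norm (?b lam * wave \<beta> X Y lam))"
    by (intro integrable_norm integrable_subexp_wave sb X)
  have q: "0 < ?q lam" "?q lam < 1" if "lam \<noteq> 0" for lam
    using wavenum_pos[of \<beta> lam] that d by auto
  have gs: "(\<lambda>m. of_real (?q lam ^ m)) sums (1 / of_real (1 - ?q lam) :: complex)"
      "summable (\<lambda>m. ?q lam ^ m)" "(\<Sum>m. ?q lam ^ m) = 1 / (1 - ?q lam)" if "lam \<noteq> 0" for lam
    using geometric_sums[of "complex_of_real (?q lam)"] suminf_geometric[of "?q lam"] summable_geometric[of "?q lam"] q[OF that]
    by auto
  have part: "(\<Sum>m<M. norm (?f m lam)) \<le> norm (?b lam * wave \<beta> X Y lam)" for M lam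
  proof (cases "wavenum \<beta> lam = 0")
    case True
    then show ?thesis using gb[of lam] by simp
  next
    case False
    then have k: "wavenum \<beta> lam > 0" using wavenum_nonneg[of \<beta> lam] by simp
    then have q: "0 < ?q lam" "?q lam < 1" using d by auto
    have "(\<Sum>m<M. norm (?f m lam)) = norm (g lam) * norm (wave \<beta> X Y lam) * (\<Sum>m<M. ?q lam ^ m)"
      unfolding wave_add by (simp add: norm_mult norm_power sum_distrib_left mult_ac)
    also have "(\<Sum>m<M. ?q lam ^ m) \<le> (\<Sum>m. ?q lam ^ m)"
      using q by (intro sum_le_suminf summable_geometric) auto
    also have "\<dots> = 1 / (1 - ?q lam)" using q by (intro suminf_geometric) auto
    finally have "(\<Sum>m<M. norm (?f m lam)) \<le> norm (g lam) * norm (wave \<beta> X Y lam) * (1 / (1 - ?q lam))"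
      by (simp add: mult_left_mono)
    also have "\<dots> \<le> wavenum \<beta> lam * norm (wave \<beta> X Y lam) * (1 / (1 - ?q lam))"
      using gb[of lam] q by (intro mult_right_mono) auto
    also have "\<dots> = (wavenum \<beta> lam / (1 - ?q lam)) * norm (wave \<beta> X Y lam)" by simp
    also have "\<dots> \<le> (wavenum \<beta> lam + 1 / d) * norm (wave \<beta> X Y lam)"
      using k d by (intro mult_right_mono div_one_minus_exp_le) auto
    also have "\<dots> = norm (?b lam * wave \<beta> X Y lam)"
      using k d by (simp add: norm_mult flip: of_real_add)
    finally show ?thesis .
  qed
  have s: "summable (\<lambda>m. \<integral>lam. norm (?f m lam) \<partial>lborel)"
  proof (rule summableI_nonneg_bounded)
    fix M
    have "(\<Sum>m<M. \<integral>lam. norm (?f m lam) \<partial>lborel) = (\<integral>lam. (\<Sum>m<M. norm (?f m lam)) \<partial>lborel)"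
      using i by (subst Bochner_Integration.integral_sum) (auto intro: integrable_norm)
    also have "\<dots> \<le> (\<integral>lam. norm (?b lam * wave \<beta> X Y lam) \<partial>lborel)"
      using i ib part by (intro integral_mono) (auto intro: integrable_norm)
    finally show "(\<Sum>m<M. \<integral>lam. norm (?f m lam) \<partial>lborel) \<le> (\<integral>lam. norm (?b lam * wave \<beta> X Y lam) \<partial>lborel)" .
  qed auto
  have AE0: "AE lam in lborel. lam \<noteq> (0::real)" by (rule AE_lborel_singleton)
  have "(\<lambda>m. integral\<^sup>L lborel (?f m)) sums (\<integral>lam. (\<Sum>m. ?f m lam) \<partial>lborel)"
  proof (rule sums_integral[OF i _ s])
    show "AE lam in lborel. summable (\<lambda>m. norm (?f m lam))"
      using AE0
    proof eventually_elim
      case (elim lam)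
      have "summable (\<lambda>m. norm (g lam) * norm (wave \<beta> X Y lam) * ?q lam ^ m)"
        by (intro summable_mult gs elim)
      then show ?case unfolding wave_add by (simp add: norm_mult norm_power mult_ac)
    qed
  qed
  also have "(\<integral>lam. (\<Sum>m. ?f m lam) \<partial>lborel) = wave_int (\<lambda>lam. g lam / of_real (1 - ?q lam)) \<beta> X Y"
    unfolding wave_int_def
  proof (rule integral_cong_AE)
    show "(\<lambda>lam. \<Sum>m. ?f m lam) \<in> borel_measurable lborel" using g by measurable
    show "(\<lambda>lam. g lam / of_real (1 - ?q lam) * wave \<beta> X Y lam) \<in> borel_measurable lborel" using g by measurable
    show "AE lam in lborel. (\<Sum>m. ?f m lam) = g lam / of_real (1 - ?q lam) * wave \<beta> X Y lam"
      using AE0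
    proof eventually_elim
      case (elim lam)
      have "(\<lambda>m. g lam * wave \<beta> X Y lam * of_real (?q lam ^ m)) sums (g lam * wave \<beta> X Y lam * (1 / of_real (1 - ?q lam)))"
        by (intro sums_mult gs elim)
      then show ?case unfolding wave_add by (simp add: mult_ac sums_iff)
    qed
  qed
  finally show "(\<lambda>m. wave_int g \<beta> (X + real m * d) Y) sums wave_int (\<lambda>lam. g lam / of_real (1 - ?q lam)) \<beta> X Y"
    unfolding wave_int_def .
  show "summable (\<lambda>m. norm (wave_int g \<beta> (X + real m * d) Y))"
    unfolding wave_int_def by (rule summable_comparison_test'[OF s]) (auto intro: integral_norm_bound)
qed

section \<open>Unordered sums over half-infinite rows of images\<close>

lemma has_sum_vecI:
  fixes f :: "'i \<Rightarrow> ('a::{topological_comm_monoid_add})^'n"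
  assumes "\<And>a. ((\<lambda>x. f x $ a) has_sum (S $ a)) A"
  shows "(f has_sum S) A"
  using assms unfolding has_sum_def by (intro vec_tendstoI) simp

lemma has_sum_sum:
  fixes f :: "'n \<Rightarrow> 'i \<Rightarrow> 'a::topological_comm_monoid_add"
  assumes "\<And>n. n \<in> N \<Longrightarrow> (f n has_sum S n) A"
  shows "((\<lambda>x. \<Sum>n\<in>N. f n x) has_sum (\<Sum>n\<in>N. S n)) A"
proof -
  have "sum (\<lambda>x. \<Sum>n\<in>N. f n x) = (\<lambda>B. \<Sum>n\<in>N. sum (f n) B)"
    by (rule ext, rule sum.swap)
  then show ?thesis using assms unfolding has_sum_def by (auto intro!: tendsto_sum)
qed

definition lattice_symbol :: "real \<Rightarrow> 2 \<Rightarrow> 2 \<Rightarrow> real \<Rightarrow> real \<Rightarrow> complex" where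
  "lattice_symbol d a b \<beta> lam =
     stokes_symbol (wavenum \<beta> lam) lam $ a $ b / of_real (1 - exp (- (wavenum \<beta> lam * d)))"

lemma measurable_stokes_symbol [measurable]:
  "(\<lambda>lam. stokes_symbol (wavenum \<beta> lam) lam $ a $ b) \<in> borel_measurable borel"
proof -
  have "a \<in> {1, 2}" "b \<in> {1, 2}" by (use exhaust_2 in blast)+
  then show ?thesis by (auto simp: stokes_symbol_def)
qed

text \<open>Here \<open>p\<close> counts the periods up to the first image: the index
  \<open>- p - m\<close> with \<open>m \<ge> 0\<close> displaces the point to abscissa
  \<open>u$1 + p d + m d\<close>, which is positive as soon as it is so for
  \<open>m = 0\<close>.\<close>

lemma has_sum_G_MS:
  assumes \<beta>: "\<beta> > 0" and d: "d > 0" and u: "u$1 + real p * d > 0"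
  shows "((\<lambda>m::int. G_MS \<beta> (u - vector [of_int m * d, 0])) has_sum
      (\<chi> a b. wave_diff (lattice_symbol d a b) \<beta> (u$1 + real p * d) (u$2))) {..- int p}"
proof (rule has_sum_vecI, rule has_sum_vecI)
  fix a b :: 2
  let ?X = "u$1 + real p * d"
  let ?s = "\<lambda>\<beta> lam. stokes_symbol (wavenum \<beta> lam) lam $ a $ b"
  have L: "(\<lambda>m. wave_int (?s \<beta>) \<beta> (?X + real m * d) (u$2)) sums wave_int (lattice_symbol d a b \<beta>) \<beta> ?X (u$2)"
      "summable (\<lambda>m. norm (wave_int (?s \<beta>) \<beta> (?X + real m * d) (u$2)))" for \<beta>
    using wave_int_lattice_sums[OF u d measurable_stokes_symbol[of \<beta> a b] norm_stokes_symbol_le[OF wavenum_ge]]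
    unfolding lattice_symbol_def[abs_def] by auto
  let ?h = "\<lambda>m. wave_diff ?s \<beta> (?X + real m * d) (u$2)"
  have "?h sums wave_diff (lattice_symbol d a b) \<beta> ?X (u$2)"
    unfolding wave_diff_def using L(1) by (intro sums_mult sums_Re sums_diff)
  \<comment> \<open>\<open>has_sum\<close> is unordered, so absolute summability is required; it
    holds separately for the part at \<beta> and the part at 0.\<close>
  moreover have "summable (\<lambda>m. norm (?h m))"
  proof (rule summable_comparison_test')
    show "summable (\<lambda>m. \<bar>1 / (4 * pi * \<beta>\<^sup>2)\<bar> * (norm (wave_int (?s \<beta>) \<beta> (?X + real m * d) (u$2))
       + norm (wave_int (?s 0) 0 (?X + real m * d) (u$2))))"
      using L(2) by (intro summable_mult summable_add)
    show "norm (norm (?h m)) \<le> \<bar>1 / (4 * pi * \<beta>\<^sup>2)\<bar> * (norm (wave_int (?s \<beta>) \<beta> (?X + real m * d) (u$2))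
       + norm (wave_int (?s 0) 0 (?X + real m * d) (u$2)))" for m
      unfolding wave_diff_def real_norm_def abs_idempotent abs_mult abs_minus_cancel
      by (intro mult_left_mono order_trans[OF abs_Re_le_cmod norm_triangle_ineq4]) auto
  qed
  ultimately have "(?h has_sum wave_diff (lattice_symbol d a b) \<beta> ?X (u$2)) UNIV"
    by (intro norm_summable_imp_has_sum)
  moreover have "?h m = G_MS \<beta> (u - vector [of_int (- int p - int m) * d, 0]) $ a $ b" for m
  proof -
    define v where "v = u - vector [of_int (- int p - int m) * d, 0]"
    have "v $ 1 = ?X + real m * d" "v $ 2 = u$2"
      by (simp_all add: v_def algebra_simps)
    moreover have "?X + real m * d > 0" using u d by (simp add: add_pos_nonneg)
    ultimately have "?h m = G_MS \<beta> v $ a $ b" using G_MS_wave_diff[OF \<beta>, of v a b] by simp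
    then show ?thesis by (simp only: v_def)
  qed
  moreover have "bij_betw (\<lambda>m. - int p - int m) UNIV {..- int p}"
    by (rule bij_betwI[where g="\<lambda>i. nat (- int p - i)"]) auto
  ultimately show "((\<lambda>m. G_MS \<beta> (u - vector [of_int m * d, 0]) $ a $ b) has_sum
      (\<chi> a b. wave_diff (lattice_symbol d a b) \<beta> ?X (u$2)) $ a $ b) {..- int p}"
    using has_sum_reindex_bij_betw[of "\<lambda>m. - int p - int m" UNIV "{..- int p}"
      "\<lambda>m. G_MS \<beta> (u - vector [of_int m * d, 0]) $ a $ b"] by simp
qed

lemma K1_west_eq:
  assumes "\<beta> > 0" "d > 0" "t$1 - s$1 + 2 * d > 0"
  shows "K1_west d \<beta> t s = (\<chi> a b. wave_diff (lattice_symbol d a b) \<beta> (t$1 - s$1 + 2 * d) (t$2 - s$2))"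
  unfolding K1_west_def using has_sum_G_MS[of \<beta> d "t - s" 2] assms by (intro infsumI) simp

lemma K2_west_eq:
  assumes "\<beta> > 0" "d > 0" "\<And>n. n \<in> {-1..1::int} \<Longrightarrow> t$1 - s$1 - of_int n * \<xi> + 4 * d > 0"
  shows "K2_west d \<xi> \<eta> \<beta> t s = (\<Sum>n\<in>{-1..1::int}. (\<chi> a b.
     wave_diff (lattice_symbol d a b) \<beta> (t$1 - s$1 - of_int n * \<xi> + 4 * d) (t$2 - s$2 - of_int n * \<eta>)))"
  unfolding K2_west_def
proof (intro infsumI has_sum_sum)
  fix n :: int assume n: "n \<in> {-1..1}"
  define v where "v = t - s - of_int n *\<^sub>R e2 \<xi> \<eta>"
  have v: "t - s - (of_int m *\<^sub>R e1 d + of_int n *\<^sub>R e2 \<xi> \<eta>) = v - vector [of_int m * d, 0]" for m :: int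
    by (simp add: vec_eq_iff forall_2 e1_def e2_def v_def)
  have v12: "v $ 1 = t$1 - s$1 - of_int n * \<xi>" "v $ 2 = t$2 - s$2 - of_int n * \<eta>"
    by (simp_all add: v_def e2_def)
  show "((\<lambda>m. G_MS \<beta> (t - s - (of_int m *\<^sub>R e1 d + of_int n *\<^sub>R e2 \<xi> \<eta>))) has_sum (\<chi> a b.
     wave_diff (lattice_symbol d a b) \<beta> (t$1 - s$1 - of_int n * \<xi> + 4 * d) (t$2 - s$2 - of_int n * \<eta>))) {..-4}"
    unfolding v using has_sum_G_MS[of \<beta> d v 4] assms(1,2) assms(3)[OF n] v12 by simp
qed

section \<open>Mixed differences of waves\<close>

text \<open>Mean value inequality on the segment from 0 to \<open>a\<close>. The bound is a sum
  rather than a maximum so that, multiplied by \<open>exp (Re w)\<close>, it becomes a sum of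
  exponentials at corner points.\<close>

lemma norm_exp_minus_one_le: "norm (exp a - 1) \<le> norm a * (1 + exp (Re a))" for a :: complex
proof -
  have "norm (exp a - exp 0) \<le> (1 + exp (Re a)) * norm (a - 0)"
  proof (rule field_differentiable_bound[OF convex_closed_segment[of 0 a], of exp exp])
    fix z assume "z \<in> closed_segment 0 a"
    then obtain t where "0 \<le> t" "t \<le> 1" "z = t *\<^sub>R a" by (auto simp: in_segment)
    then have "Re z \<le> max 0 (Re a)" by (auto simp: max_def mult_left_le_one_le mult_nonneg_nonpos)
    then have "exp (Re z) \<le> max 1 (exp (Re a))" by (simp add: max_def split: if_splits)
    then show "norm (exp z) \<le> 1 + exp (Re a)" by (auto simp: max_def split: if_splits intro: order_trans)
  qed (auto intro!: derivative_eq_intros)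
  then show ?thesis by (simp add: mult.commute)
qed

text \<open>Expanding the product of the one-variable bounds reproduces the moduli at exactly the
  four corners, so control at the corners suffices. The two first-difference bounds serve the terms
  that appear when the wave carries an additional factor \<open>X\<close>.\<close>

lemma norm_mixed_exp_le:
  fixes w a b :: complex
  assumes "\<And>z. z \<in> {w, w + a, w + b, w + a + b} \<Longrightarrow> exp (Re z) \<le> B"
  shows "norm (exp w - exp (w + a) - exp (w + b) + exp (w + a + b)) \<le> 4 * norm a * norm b * B"
    and "norm (exp (w + a) * (exp b - 1)) \<le> 2 * norm b * B"
    and "norm (exp (w + b) * (exp a - 1)) \<le> 2 * norm a * B"
proof -
  have B: "exp (Re w) \<le> B" "exp (Re w + Re a) \<le> B" "exp (Re w + Re b) \<le> B" "exp (Re w + Re a + Re b) \<le> B"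
    using assms[of w] assms[of "w + a"] assms[of "w + b"] assms[of "w + a + b"] by auto
  have "exp w - exp (w + a) - exp (w + b) + exp (w + a + b) = exp w * ((exp a - 1) * (exp b - 1))"
    by (simp add: exp_add algebra_simps)
  then have "norm (exp w - exp (w + a) - exp (w + b) + exp (w + a + b))
      \<le> exp (Re w) * ((norm a * (1 + exp (Re a))) * (norm b * (1 + exp (Re b))))"
    by (simp only: norm_mult norm_exp_eq_Re)
      (intro mult_left_mono mult_mono norm_exp_minus_one_le mult_nonneg_nonneg add_nonneg_nonneg norm_ge_zero exp_ge_zero zero_le_one)
  also have "\<dots> = norm a * norm b * (exp (Re w) + exp (Re w + Re a) + exp (Re w + Re b) + exp (Re w + Re a + Re b))"
    by (simp add: exp_add algebra_simps)
  also have "\<dots> \<le> norm a * norm b * (4 * B)"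
    using B by (intro mult_left_mono) auto
  finally show "norm (exp w - exp (w + a) - exp (w + b) + exp (w + a + b)) \<le> 4 * norm a * norm b * B" by simp
  have "norm (exp (w + a) * (exp b - 1)) \<le> exp (Re w + Re a) * (norm b * (1 + exp (Re b)))"
    by (simp only: norm_mult norm_exp_eq_Re plus_complex.simps) (intro mult_left_mono norm_exp_minus_one_le exp_ge_zero)
  also have "\<dots> = norm b * (exp (Re w + Re a) + exp (Re w + Re a + Re b))"
    by (simp add: exp_add algebra_simps)
  also have "\<dots> \<le> norm b * (2 * B)" using B by (intro mult_left_mono) auto
  finally show "norm (exp (w + a) * (exp b - 1)) \<le> 2 * norm b * B" by simp
  have "norm (exp (w + b) * (exp a - 1)) \<le> exp (Re w + Re b) * (norm a * (1 + exp (Re a)))"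
    by (simp only: norm_mult norm_exp_eq_Re plus_complex.simps) (intro mult_left_mono norm_exp_minus_one_le exp_ge_zero)
  also have "\<dots> = norm a * (exp (Re w + Re b) + exp (Re w + Re a + Re b))"
    by (simp add: exp_add algebra_simps)
  also have "\<dots> \<le> norm a * (2 * B)" using B by (intro mult_left_mono) auto
  finally show "norm (exp (w + b) * (exp a - 1)) \<le> 2 * norm a * B" by simp
qed

text \<open>Alternating sum over the corners of a parallelogram; \<open>a\<close> will be a
  displacement of the target and \<open>b\<close> one of the source.\<close>

definition mixed_diff :: "(real \<Rightarrow> real \<Rightarrow> 'a::real_normed_vector) \<Rightarrow> real \<times> real \<Rightarrow> real \<times> real \<Rightarrow> real \<times> real \<Rightarrow> 'a" where
  "mixed_diff f p a b = f (fst p) (snd p) - f (fst p + fst a) (snd p + snd a) - f (fst p + fst b) (snd p + snd b)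
     + f (fst p + fst a + fst b) (snd p + snd a + snd b)"

text \<open>The decay rate becomes a complex variable \<open>z\<close> independent of
  \<open>lam\<close>, so that complex differentiation in the rate applies.\<close>

definition cwave :: "real \<Rightarrow> complex \<Rightarrow> real \<Rightarrow> real \<Rightarrow> complex" where
  "cwave lam z X Y = exp (- (z * of_real X) + \<i> * of_real (lam * Y))"

lemma mixed_cwave_bounds:
  fixes p a b :: "real \<times> real"
  assumes c: "c > 0" "fst p \<ge> c" "fst p + fst a \<ge> c" "fst p + fst b \<ge> c" "fst p + fst a + fst b \<ge> c"
    and k: "\<bar>lam\<bar> \<le> k" "k > 0"
    and M: "\<bar>fst a\<bar> + \<bar>snd a\<bar> \<le> M" "\<bar>fst b\<bar> + \<bar>snd b\<bar> \<le> M"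
  shows "norm (mixed_diff (cwave lam (of_real k)) p a b) \<le> 4 * M\<^sup>2 * k\<^sup>2 * exp (- (k * c))"
    and "norm (mixed_diff (\<lambda>X Y. - of_real X * cwave lam (of_real k) X Y) p a b)
      \<le> (4 * fst p * M\<^sup>2 * k\<^sup>2 + 4 * M\<^sup>2 * k) * exp (- (k * c))"
proof -
  let ?w = "complex_of_real (- k * fst p) + \<i> * of_real (lam * snd p)"
  let ?a = "complex_of_real (- k * fst a) + \<i> * of_real (lam * snd a)"
  let ?b = "complex_of_real (- k * fst b) + \<i> * of_real (lam * snd b)"
  let ?B = "exp (- (k * c))"
  have e: "cwave lam (of_real k) (fst p) (snd p) = exp ?w"
    "cwave lam (of_real k) (fst p + fst a) (snd p + snd a) = exp (?w + ?a)"
    "cwave lam (of_real k) (fst p + fst b) (snd p + snd b) = exp (?w + ?b)"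
    "cwave lam (of_real k) (fst p + fst a + fst b) (snd p + snd a + snd b) = exp (?w + ?a + ?b)"
    by (simp_all add: cwave_def algebra_simps)
  have B: "exp (Re z) \<le> ?B" if "z \<in> {?w, ?w + ?a, ?w + ?b, ?w + ?a + ?b}" for z
  proof -
    have "exp (- (k * x)) \<le> ?B" if "x \<ge> c" for x using that k by simp
    from this[OF c(2)] this[OF c(3)] this[OF c(4)] this[OF c(5)]
    have "exp (Re ?w) \<le> ?B" "exp (Re (?w + ?a)) \<le> ?B" "exp (Re (?w + ?b)) \<le> ?B" "exp (Re (?w + ?a + ?b)) \<le> ?B"
      by (auto simp: algebra_simps)
    with that show ?thesis by blast
  qed
  note mb = norm_mixed_exp_le[of ?w ?a ?b ?B, OF B]
  have nb: "norm (complex_of_real (- k * x) + \<i> * of_real (lam * y)) \<le> k * M" if "\<bar>x\<bar> + \<bar>y\<bar> \<le> M" for x y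
  proof -
    have "norm (complex_of_real (- k * x) + \<i> * of_real (lam * y)) \<le> k * \<bar>x\<bar> + \<bar>lam\<bar> * \<bar>y\<bar>"
      by (rule order_trans[OF norm_triangle_ineq]) (use k in \<open>simp add: norm_mult abs_mult\<close>)
    also have "\<dots> \<le> k * \<bar>x\<bar> + k * \<bar>y\<bar>" using k by (intro add_left_mono mult_right_mono) auto
    also have "\<dots> = k * (\<bar>x\<bar> + \<bar>y\<bar>)" by (simp add: distrib_left)
    also have "\<dots> \<le> k * M" using that k by (intro mult_left_mono) auto
    finally show ?thesis .
  qed
  have M0: "M \<ge> 0" using M(1) by linarith
  have ab: "norm ?a * norm ?b \<le> (k * M) * (k * M)"
    using nb M k M0 by (intro mult_mono) auto
  have D: "mixed_diff (cwave lam (of_real k)) p a b = exp ?w - exp (?w + ?a) - exp (?w + ?b) + exp (?w + ?a + ?b)"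
    unfolding mixed_diff_def e ..
  have "norm (mixed_diff (cwave lam (of_real k)) p a b) \<le> 4 * (norm ?a * norm ?b) * ?B"
    using mb(1) unfolding D by (simp add: mult_ac)
  also have "\<dots> \<le> 4 * ((k * M) * (k * M)) * ?B" using ab by (intro mult_right_mono mult_left_mono) auto
  finally show 1: "norm (mixed_diff (cwave lam (of_real k)) p a b) \<le> 4 * M\<^sup>2 * k\<^sup>2 * ?B"
    by (simp add: power2_eq_square mult_ac)
  \<comment> \<open>The factor \<open>X\<close> differs from corner to corner. Its common part
    \<open>fst p\<close> multiplies the full mixed difference; the increments \<open>fst a\<close>
    and \<open>fst b\<close> multiply first differences, which gain only one power of
    \<open>k\<close>.\<close>
  have "mixed_diff (\<lambda>X Y. - of_real X * cwave lam (of_real k) X Y) p a b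
     = - of_real (fst p) * mixed_diff (cwave lam (of_real k)) p a b
       - (of_real (fst a) * (exp (?w + ?a) * (exp ?b - 1)) + of_real (fst b) * (exp (?w + ?b) * (exp ?a - 1)))"
    unfolding mixed_diff_def e by (simp add: exp_add) (simp add: algebra_simps)
  also have "norm \<dots> \<le> fst p * norm (mixed_diff (cwave lam (of_real k)) p a b)
      + (\<bar>fst a\<bar> * norm (exp (?w + ?a) * (exp ?b - 1)) + \<bar>fst b\<bar> * norm (exp (?w + ?b) * (exp ?a - 1)))"
    using c by (intro order_trans[OF norm_triangle_ineq4] add_mono order_trans[OF norm_triangle_ineq])
      (auto simp: norm_mult)
  also have "\<dots> \<le> fst p * (4 * M\<^sup>2 * k\<^sup>2 * ?B) + (M * (2 * (k * M) * ?B) + M * (2 * (k * M) * ?B))"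
  proof -
    have "norm (exp (?w + ?a) * (exp ?b - 1)) \<le> 2 * (k * M) * ?B"
      using mb(2) nb[OF M(2)] by (rule order_trans[OF _ mult_right_mono[OF mult_left_mono]]) auto
    moreover have "norm (exp (?w + ?b) * (exp ?a - 1)) \<le> 2 * (k * M) * ?B"
      using mb(3) nb[OF M(1)] by (rule order_trans[OF _ mult_right_mono[OF mult_left_mono]]) auto
    ultimately show ?thesis using 1 M M0 c by (intro add_mono mult_mono mult_left_mono) auto
  qed
  finally show "norm (mixed_diff (\<lambda>X Y. - of_real X * cwave lam (of_real k) X Y) p a b)
      \<le> (4 * fst p * M\<^sup>2 * k\<^sup>2 + 4 * M\<^sup>2 * k) * ?B"
    by (simp add: power2_eq_square algebra_simps)
qed

text \<open>The geometric factor of the image sum merged with the factor \<open>k\<close> of the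
  symbol; the quotient stays bounded as \<open>z\<close> tends to 0.\<close>

definition bose :: "real \<Rightarrow> complex \<Rightarrow> complex" where
  "bose d z = z / (1 - exp (- (z * of_real d)))"

definition bose' :: "real \<Rightarrow> complex \<Rightarrow> complex" where
  "bose' d z = 1 / (1 - exp (- (z * of_real d))) - z * of_real d * exp (- (z * of_real d)) / (1 - exp (- (z * of_real d)))\<^sup>2"

lemma diff_div_square: "(q - x) / q\<^sup>2 = 1 / q - x / q\<^sup>2" for q x :: "'a::field"
  by (simp add: diff_divide_distrib power2_eq_square)

lemma bose_field_derivative:
  assumes "exp (- (z * of_real d)) \<noteq> 1"
  shows "(bose d has_field_derivative bose' d z) (at z)"
proof -
  have "((\<lambda>z. 1 - exp (- (z * of_real d))) has_field_derivative of_real d * exp (- (z * of_real d))) (at z)"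
    by (auto intro!: derivative_eq_intros)
  from DERIV_divide[OF DERIV_ident this] assms show ?thesis
    unfolding bose_def[abs_def] bose'_def
    using diff_div_square[of "1 - exp (- (z * of_real d))" "z * of_real d * exp (- (z * of_real d))"]
    by (simp add: power2_eq_square mult.assoc)
qed

text \<open>With \<open>x = k d\<close> and \<open>e = exp (- x)\<close> the derivative equals
  \<open>(1 - e - x e) / (1 - e)^2\<close>. It lies between 0 and 1: the lower bound is
  \<open>1 + x \<le> exp x\<close>, the upper one \<open>1 - x \<le> exp (- x)\<close>.\<close>

lemma norm_bose_le:
  assumes "k > 0" "d > 0"
  shows "norm (bose d (of_real k)) \<le> k + 1 / d" "norm (bose' d (of_real k)) \<le> 1"
proof -
  have pos: "1 - exp (- (k * d)) > 0" using assms by simp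
  have "bose d (of_real k) = of_real (k / (1 - exp (- (k * d))))" by (simp add: bose_def exp_of_real[symmetric])
  then have "norm (bose d (of_real k)) = k / (1 - exp (- (k * d)))" using pos assms by (simp del: of_real_divide)
  then show "norm (bose d (of_real k)) \<le> k + 1 / d" using div_one_minus_exp_le[of k d] assms by simp
  define x e where "x = k * d" and "e = exp (- (k * d))"
  have "bose' d (of_real k) = of_real (1 / (1 - e) - x * e / (1 - e)\<^sup>2)"
    by (simp add: bose'_def e_def x_def exp_of_real[symmetric])
  moreover have "1 / (1 - e) - x * e / (1 - e)\<^sup>2 = (1 - e - x * e) / (1 - e)\<^sup>2"
    by (simp add: diff_div_square)
  moreover have "0 \<le> 1 - e - x * e"
  proof -
    have "(x + 1) * e \<le> 1" by (simp add: e_def x_def[symmetric] exp_minus divide_simps add.commute)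
    then show ?thesis by (simp add: algebra_simps)
  qed
  moreover have "1 - e - x * e \<le> (1 - e)\<^sup>2"
  proof -
    have "(1 - x) * e \<le> e * e" using exp_ge_add_one_self[of "- x"] by (intro mult_right_mono) (auto simp: e_def x_def)
    then show ?thesis by (simp add: power2_eq_square algebra_simps)
  qed
  ultimately show "norm (bose' d (of_real k)) \<le> 1"
    using pos by (simp add: e_def[symmetric] divide_le_eq del: of_real_divide of_real_diff)
qed

section \<open>The limit of vanishing \<open>\<beta>\<close>\<close>

text \<open>For \<open>k > 0\<close> every entry of \<^const>\<open>stokes_symbol\<close> is a constant times \<open>(\<lambda> / k) ^ n * k\<close>; in this form \<open>k\<close> may be
  complex, so that complex derivatives are available.\<close>

definition symbol_ord :: "2 \<Rightarrow> 2 \<Rightarrow> nat" where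
  "symbol_ord i j = (if i \<noteq> j then 1 else if i = 1 then 2 else 0)"

definition symbol_coeff :: "2 \<Rightarrow> 2 \<Rightarrow> complex" where
  "symbol_coeff i j = (if i \<noteq> j then - \<i> else if i = 1 then 1 else - 1)"

text \<open>The lattice symbol at fixed \<open>lam\<close>, seen as a function of the decay rate
  alone. Its values for \<beta> and for 0 are then values of one function, at
  \<open>wavenum \<beta> lam\<close> and at \<open>|lam|\<close>.\<close>

definition radial :: "real \<Rightarrow> 2 \<Rightarrow> 2 \<Rightarrow> real \<Rightarrow> complex \<Rightarrow> complex" where
  "radial d i j lam z = symbol_coeff i j * (of_real lam / z) ^ symbol_ord i j * bose d z"

definition radial' :: "real \<Rightarrow> 2 \<Rightarrow> 2 \<Rightarrow> real \<Rightarrow> complex \<Rightarrow> complex" where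
  "radial' d i j lam z = symbol_coeff i j * (of_real lam / z) ^ symbol_ord i j *
     (bose' d z - of_nat (symbol_ord i j) / z * bose d z)"

lemma lattice_symbol_wave:
  assumes "wavenum \<beta> lam > 0"
  shows "lattice_symbol d i j \<beta> lam * wave \<beta> X Y lam
    = radial d i j lam (of_real (wavenum \<beta> lam)) * cwave lam (of_real (wavenum \<beta> lam)) X Y"
proof -
  have "i \<in> {1, 2}" "j \<in> {1, 2}" by (use exhaust_2 in blast)+
  moreover have "wave \<beta> X Y lam = cwave lam (of_real (wavenum \<beta> lam)) X Y"
    by (simp add: wave_def cwave_def)
  ultimately show ?thesis
    using assms by (auto simp: lattice_symbol_def radial_def stokes_symbol_def symbol_ord_def symbol_coeff_def
        bose_def exp_of_real[symmetric] power2_eq_square)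
qed

lemma radial_field_derivative:
  assumes "exp (- (z * of_real d)) \<noteq> 1"
  shows "(radial d i j lam has_field_derivative radial' d i j lam z) (at z)"
proof -
  have z: "z \<noteq> 0" using assms by auto
  have "((\<lambda>z. (of_real lam / z) ^ n) has_field_derivative - (of_nat n / z) * (of_real lam / z) ^ n) (at z)" for n
  proof -
    have "((\<lambda>z. of_real lam / z) has_field_derivative - (of_real lam / z) / z) (at z)"
      using z by (auto intro!: derivative_eq_intros simp: power2_eq_square)
    from DERIV_power[OF this, of n] show ?thesis
      by (rule DERIV_cong) (cases n, auto simp: mult_ac)
  qed
  from DERIV_mult[OF DERIV_cmult[OF this, of "symbol_coeff i j"] bose_field_derivative[OF assms]]
  show ?thesis unfolding radial_def[abs_def] radial'_def
    by (rule DERIV_cong) (simp add: algebra_simps)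
qed

text \<open>The powers of \<open>lam / k\<close> have modulus at most 1, and their logarithmic
  derivative is at most \<open>2 / k\<close> because the order is at most 2. This
  \<open>1 / k\<close> is the singularity that the mixed difference has to absorb.\<close>

lemma norm_radial_le:
  assumes "\<bar>lam\<bar> \<le> k" "k > 0" "d > 0"
  shows "norm (radial d i j lam (of_real k)) \<le> k + 1 / d"
    and "norm (radial' d i j lam (of_real k)) \<le> 1 + 2 / k * (k + 1 / d)"
proof -
  have c: "norm (symbol_coeff i j) = 1" by (simp add: symbol_coeff_def)
  have r: "norm ((complex_of_real lam / of_real k) ^ n) \<le> 1" for n
    unfolding norm_power using assms by (intro power_le_one) (auto simp: norm_divide divide_le_eq)
  have o: "real (symbol_ord i j) \<le> 2" by (simp add: symbol_ord_def)
  have "norm (radial d i j lam (of_real k)) \<le> (1 * 1) * norm (bose d (of_real k))"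
    unfolding radial_def norm_mult c using r by (intro mult_right_mono mult_left_mono) auto
  then show "norm (radial d i j lam (of_real k)) \<le> k + 1 / d"
    using norm_bose_le(1)[OF assms(2,3)] by simp
  have "norm (bose' d (of_real k) - of_nat (symbol_ord i j) / of_real k * bose d (of_real k))
      \<le> norm (bose' d (of_real k)) + real (symbol_ord i j) / k * norm (bose d (of_real k))"
    using assms by (intro order_trans[OF norm_triangle_ineq4]) (auto simp: norm_mult norm_divide)
  also have "\<dots> \<le> 1 + 2 / k * (k + 1 / d)"
    using norm_bose_le[OF assms(2,3)] o assms by (intro add_mono mult_mono divide_right_mono) auto
  finally have "norm (radial' d i j lam (of_real k)) \<le> (1 * 1) * (1 + 2 / k * (k + 1 / d))"
    unfolding radial'_def norm_mult c using r by (intro mult_mono) auto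
  then show "norm (radial' d i j lam (of_real k)) \<le> 1 + 2 / k * (k + 1 / d)" by simp
qed

lemma cwave_field_derivative:
  "((\<lambda>z. cwave lam z X Y) has_field_derivative - of_real X * cwave lam z X Y) (at z)"
  unfolding cwave_def by (auto intro!: derivative_eq_intros)

lemma mixed_cwave_field_derivative:
  "((\<lambda>z. mixed_diff (cwave lam z) p a b) has_field_derivative
     mixed_diff (\<lambda>X Y. - of_real X * cwave lam z X Y) p a b) (at z)"
  unfolding mixed_diff_def by (intro DERIV_add DERIV_diff cwave_field_derivative)

lemma mixed_diff_mult_left: "mixed_diff (\<lambda>X Y. s * f X Y) p a b = (s :: 'a::real_normed_algebra) * mixed_diff f p a b"
  by (simp add: mixed_diff_def algebra_simps)

section \<open>Mixed differences with all four corners at abscissa at least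
  \<open>c > 0\<close>\<close>

context
  fixes d c :: real and p a b :: "real \<times> real" and i j :: 2
  assumes d: "d > 0"
    and c: "c > 0" "fst p \<ge> c" "fst p + fst a \<ge> c" "fst p + fst b \<ge> c" "fst p + fst a + fst b \<ge> c"
begin

definition mixed_radial :: "real \<Rightarrow> complex \<Rightarrow> complex" where
  "mixed_radial lam z = radial d i j lam z * mixed_diff (cwave lam z) p a b"

definition mixed_radial' :: "real \<Rightarrow> complex \<Rightarrow> complex" where
  "mixed_radial' lam z = radial' d i j lam z * mixed_diff (cwave lam z) p a b
     + mixed_diff (\<lambda>X Y. - of_real X * cwave lam z X Y) p a b * radial d i j lam z"

lemma mixed_radial_field_derivative:
  assumes "k > 0"
  shows "(mixed_radial lam has_field_derivative mixed_radial' lam (of_real k)) (at (of_real k))"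
proof -
  have "exp (- (k * d)) < 1" using assms d by simp
  then have "complex_of_real (exp (- (k * d))) \<noteq> 1" using assms d by (simp del: of_real_exp add: of_real_eq_1_iff)
  then have "exp (- (complex_of_real k * of_real d)) \<noteq> 1" by (simp add: exp_of_real[symmetric])
  from DERIV_mult[OF radial_field_derivative[OF this] mixed_cwave_field_derivative] show ?thesis
    unfolding mixed_radial_def[abs_def] mixed_radial'_def .
qed

text \<open>The mixed difference is of order \<open>k^2\<close> against a radial derivative of order
  \<open>1 / k\<close>, and its own derivative is of order \<open>k\<close> against a bounded radial
  factor. The remaining factor \<open>k\<close> is exactly what a quotient in \<open>k^2\<close> can
  afford.\<close>

lemma mixed_radial'_bound:
  obtains C where "C \<ge> 0"
    "\<And>lam k. \<bar>lam\<bar> \<le> k \<Longrightarrow> k > 0 \<Longrightarrow> norm (mixed_radial' lam (of_real k)) \<le> k * (C * exp (- (c / 2 * \<bar>lam\<bar>)))"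
proof -
  define M where "M = max (\<bar>fst a\<bar> + \<bar>snd a\<bar>) (\<bar>fst b\<bar> + \<bar>snd b\<bar>)"
  define x where "x = fst p"
  \<comment> \<open>\<open>Q\<close> is the polynomial
    \<open>2 (k + 1/d) + k + (k + 1/d) (x k + 1)\<close> with \<open>k\<close> replaced by
    \<open>4 / c\<close>. Each linear factor is bounded at the cost of \<open>exp (k c / 4)\<close>;
    at most two of them meet in a product, which leaves half of the decay
    \<open>exp (- k c)\<close>.\<close>
  define Q where "Q = 2 * (4 / c + 1 / d) + 4 / c + (4 / c + 1 / d) * (x * (4 / c) + 1)"
  have x: "x > 0" using c by (simp add: x_def)
  have Q: "Q \<ge> 0" using c d x by (simp add: Q_def)
  have "norm (mixed_radial' lam (of_real k)) \<le> k * (4 * M\<^sup>2 * Q * exp (- (c / 2 * \<bar>lam\<bar>)))"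
    if k: "\<bar>lam\<bar> \<le> k" "k > 0" for lam k
  proof -
    let ?B = "exp (- (k * c))" and ?T = "exp (k * c / 4)"
    have "k * c / 4 \<le> ?T" using exp_ge_add_one_self[of "k * c / 4"] by linarith
    then have kT: "k \<le> 4 / c * ?T" using c by (simp add: field_simps)
    have T1: "1 \<le> ?T" using k c by simp
    then have dT: "1 / d \<le> 1 / d * ?T" using d by (simp add: divide_right_mono)
    have k1: "k + 1 / d \<le> (4 / c + 1 / d) * ?T" using kT dT by (simp add: distrib_right)
    have "x * k \<le> x * (4 / c * ?T)" using kT x by (intro mult_left_mono) auto
    then have k2: "x * k + 1 \<le> (x * (4 / c) + 1) * ?T" using T1 by (simp only: distrib_right mult.assoc mult_1)
    have x4: "x * (4 / c) + 1 \<ge> 0" using x c by simp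
    have TT: "z * ?T \<le> z * ?T\<^sup>2" if "z \<ge> 0" for z
      using T1 that by (intro mult_left_mono) (auto simp: power2_eq_square)
    have "2 * (k + 1 / d) + k + (k + 1 / d) * (x * k + 1)
        \<le> 2 * ((4 / c + 1 / d) * ?T) + 4 / c * ?T + ((4 / c + 1 / d) * ?T) * ((x * (4 / c) + 1) * ?T)"
      using k1 k2 kT k d x c x4 by (intro add_mono mult_left_mono mult_mono) auto
    also have "\<dots> \<le> 2 * ((4 / c + 1 / d) * ?T\<^sup>2) + 4 / c * ?T\<^sup>2 + ((4 / c + 1 / d) * ?T) * ((x * (4 / c) + 1) * ?T)"
      using TT[of "4 / c"] TT[of "4 / c + 1 / d"] c d by simp
    also have "\<dots> = Q * ?T\<^sup>2" by (simp add: Q_def power2_eq_square algebra_simps)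
    finally have poly: "2 * (k + 1 / d) + k + (k + 1 / d) * (x * k + 1) \<le> Q * ?T\<^sup>2" .
    have TB: "?T\<^sup>2 * ?B \<le> exp (- (c / 2 * \<bar>lam\<bar>))"
    proof -
      have "?T\<^sup>2 * ?B = exp (- (c / 2 * k))"
        by (simp add: power2_eq_square flip: exp_add)
      also have "\<dots> \<le> exp (- (c / 2 * \<bar>lam\<bar>))" using k c by simp
      finally show ?thesis .
    qed
    have MM: "\<bar>fst a\<bar> + \<bar>snd a\<bar> \<le> M" "\<bar>fst b\<bar> + \<bar>snd b\<bar> \<le> M" by (simp_all add: M_def)
    note D = mixed_cwave_bounds[OF c k MM, folded x_def]
    have "norm (mixed_radial' lam (of_real k))
      \<le> norm (radial' d i j lam (of_real k)) * norm (mixed_diff (cwave lam (of_real k)) p a b)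
        + norm (mixed_diff (\<lambda>X Y. - of_real X * cwave lam (of_real k) X Y) p a b) * norm (radial d i j lam (of_real k))"
      unfolding mixed_radial'_def by (rule order_trans[OF norm_triangle_ineq]) (simp add: norm_mult)
    also have "\<dots> \<le> (1 + 2 / k * (k + 1 / d)) * (4 * M\<^sup>2 * k\<^sup>2 * ?B)
        + ((4 * x * M\<^sup>2 * k\<^sup>2 + 4 * M\<^sup>2 * k) * ?B) * (k + 1 / d)"
    proof (rule add_mono[OF mult_mono[OF norm_radial_le(2)[OF k d] D(1)] mult_mono[OF D(2) norm_radial_le(1)[OF k d]]])
      show "0 \<le> 1 + 2 / k * (k + 1 / d)" using k d by simp
      show "0 \<le> (4 * x * M\<^sup>2 * k\<^sup>2 + 4 * M\<^sup>2 * k) * ?B" using k x by simp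
    qed simp_all
    also have "\<dots> = k * (4 * M\<^sup>2 * (2 * (k + 1 / d) + k + (k + 1 / d) * (x * k + 1)) * ?B)"
      using k d by (simp add: field_simps power2_eq_square)
    also have "\<dots> \<le> k * (4 * M\<^sup>2 * (Q * ?T\<^sup>2) * ?B)"
      using poly k by (intro mult_left_mono mult_right_mono) auto
    also have "\<dots> = k * (4 * M\<^sup>2 * Q * (?T\<^sup>2 * ?B))" by (simp add: mult_ac)
    also have "\<dots> \<le> k * (4 * M\<^sup>2 * Q * exp (- (c / 2 * \<bar>lam\<bar>)))"
      using TB k Q by (intro mult_left_mono) auto
    finally show ?thesis .
  qed
  then show ?thesis using that[of "4 * M\<^sup>2 * Q"] Q by simp
qed

definition mixed_quotient :: "real \<Rightarrow> real \<Rightarrow> complex" where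
  "mixed_quotient \<beta> lam = (mixed_diff (\<lambda>X Y. lattice_symbol d i j \<beta> lam * wave \<beta> X Y lam) p a b
      - mixed_diff (\<lambda>X Y. lattice_symbol d i j 0 lam * wave 0 X Y lam) p a b) / of_real (\<beta>\<^sup>2)"

lemma mixed_quotient_radial:
  assumes "lam \<noteq> 0"
  shows "mixed_quotient \<beta> lam = (mixed_radial lam (of_real (wavenum \<beta> lam)) - mixed_radial lam (of_real \<bar>lam\<bar>)) / of_real (\<beta>\<^sup>2)"
  using assms lattice_symbol_wave[of \<beta> lam d i j] lattice_symbol_wave[of 0 lam d i j] wavenum_pos[of \<beta> lam]
  by (simp add: mixed_quotient_def mixed_radial_def mixed_diff_mult_left)

text \<open>Mean value inequality between \<open>|lam|\<close> and \<open>k\<close>: the increment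
  is at most \<open>k A (k - |lam|)\<close>, which is at most
  \<open>A (k^2 - lam^2) = A \<beta>^2\<close>. The bound is therefore free of \<beta>.\<close>

lemma mixed_quotient_bound:
  assumes C: "\<And>lam k. \<bar>lam\<bar> \<le> k \<Longrightarrow> k > 0 \<Longrightarrow> norm (mixed_radial' lam (of_real k)) \<le> k * (C * exp (- (c / 2 * \<bar>lam\<bar>)))"
    and "C \<ge> 0" "lam \<noteq> 0" "\<beta> > 0"
  shows "norm (mixed_quotient \<beta> lam) \<le> C * exp (- (c / 2 * \<bar>lam\<bar>))"
proof -
  let ?k = "wavenum \<beta> lam" and ?A = "C * exp (- (c / 2 * \<bar>lam\<bar>))"
  have k: "\<bar>lam\<bar> \<le> ?k" "?k > 0" using wavenum_ge wavenum_pos assms(3) by auto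
  have "norm (mixed_radial lam (of_real ?k) - mixed_radial lam (of_real \<bar>lam\<bar>)) \<le> ?k * ?A * norm (complex_of_real ?k - of_real \<bar>lam\<bar>)"
  proof (rule field_differentiable_bound[OF convex_closed_segment[of "of_real \<bar>lam\<bar>" "of_real ?k"], of _ "mixed_radial' lam"])
    fix z assume "z \<in> closed_segment (complex_of_real \<bar>lam\<bar>) (of_real ?k)"
    then obtain \<kappa> where \<kappa>: "z = of_real \<kappa>" "\<kappa> \<in> closed_segment \<bar>lam\<bar> ?k" by (auto simp: closed_segment_of_real)
    then have \<kappa>': "\<bar>lam\<bar> \<le> \<kappa>" "\<kappa> \<le> ?k" "\<kappa> > 0" using k assms(3) by (auto simp: closed_segment_eq_real_ivl)
    show "(mixed_radial lam has_field_derivative mixed_radial' lam z) (at z within closed_segment (of_real \<bar>lam\<bar>) (of_real ?k))"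
      unfolding \<kappa> by (rule has_field_derivative_at_within[OF mixed_radial_field_derivative[OF \<kappa>'(3)]])
    have "norm (mixed_radial' lam z) \<le> \<kappa> * ?A" unfolding \<kappa> using C \<kappa>' by simp
    also have "\<dots> \<le> ?k * ?A" using \<kappa>' assms by (intro mult_right_mono) auto
    finally show "norm (mixed_radial' lam z) \<le> ?k * ?A" .
  qed auto
  also have "norm (complex_of_real ?k - of_real \<bar>lam\<bar>) = ?k - \<bar>lam\<bar>"
    using k by (simp flip: of_real_diff)
  also have "?k * ?A * (?k - \<bar>lam\<bar>) \<le> (?k + \<bar>lam\<bar>) * ?A * (?k - \<bar>lam\<bar>)"
    using k assms by (intro mult_right_mono) auto
  also have "\<dots> = ?A * (?k\<^sup>2 - \<bar>lam\<bar>\<^sup>2)" by (simp add: power2_eq_square algebra_simps)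
  also have "\<dots> = ?A * \<beta>\<^sup>2" by (simp add: wavenum_square)
  finally show ?thesis using assms(4) unfolding mixed_quotient_radial[OF assms(3)]
    by (simp add: norm_divide norm_power divide_le_eq)
qed

text \<open>Split \<open>\<beta>^2 = (k - |lam|) (k + |lam|)\<close>: the first factor gives a
  complex difference quotient at \<open>|lam|\<close>, the second tends to \<open>2 |lam|\<close>.
  Positivity of \<open>B n\<close> keeps \<open>k\<close> away from \<open>|lam|\<close>.\<close>

lemma mixed_quotient_tendsto:
  assumes "lam \<noteq> 0" and B: "\<And>n. B n > 0" "B \<longlonglongrightarrow> 0"
  shows "(\<lambda>n. mixed_quotient (B n) lam) \<longlonglongrightarrow> mixed_radial' lam (of_real \<bar>lam\<bar>) / of_real (2 * \<bar>lam\<bar>)"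
proof -
  let ?k = "\<lambda>n. wavenum (B n) lam"
  have kl: "?k \<longlonglongrightarrow> \<bar>lam\<bar>"
  proof -
    have "?k \<longlonglongrightarrow> sqrt (lam\<^sup>2 + 0\<^sup>2)" unfolding wavenum_def by (intro tendsto_intros B)
    then show ?thesis by simp
  qed
  have k: "?k n > \<bar>lam\<bar>" for n
    unfolding wavenum_def using B(1)[of n] by (intro real_less_rsqrt) simp
  have "((\<lambda>z. (mixed_radial lam z - mixed_radial lam (of_real \<bar>lam\<bar>)) / (z - of_real \<bar>lam\<bar>)) \<longlongrightarrow>
      mixed_radial' lam (of_real \<bar>lam\<bar>)) (at (of_real \<bar>lam\<bar>))"
    using mixed_radial_field_derivative[of "\<bar>lam\<bar>" lam] assms(1) by (simp add: has_field_derivative_iff)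
  moreover have "filterlim (\<lambda>n. complex_of_real (?k n)) (at (of_real \<bar>lam\<bar>)) sequentially"
  proof -
    have "(\<lambda>n. complex_of_real (?k n)) \<longlonglongrightarrow> of_real \<bar>lam\<bar>" by (intro tendsto_of_real kl)
    moreover have "complex_of_real (?k n) \<noteq> of_real \<bar>lam\<bar>" for n using k[of n] unfolding of_real_eq_iff by simp
    ultimately show ?thesis unfolding filterlim_at by (auto intro: always_eventually)
  qed
  ultimately have "(\<lambda>n. (mixed_radial lam (of_real (?k n)) - mixed_radial lam (of_real \<bar>lam\<bar>)) / (of_real (?k n) - of_real \<bar>lam\<bar>))
      \<longlonglongrightarrow> mixed_radial' lam (of_real \<bar>lam\<bar>)"
    by (rule filterlim_compose)
  moreover have "(\<lambda>n. complex_of_real (1 / (?k n + \<bar>lam\<bar>))) \<longlonglongrightarrow> of_real (1 / (\<bar>lam\<bar> + \<bar>lam\<bar>))"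
    using assms(1) by (intro tendsto_intros kl) auto
  ultimately have "(\<lambda>n. (mixed_radial lam (of_real (?k n)) - mixed_radial lam (of_real \<bar>lam\<bar>)) / (of_real (?k n) - of_real \<bar>lam\<bar>)
      * of_real (1 / (?k n + \<bar>lam\<bar>))) \<longlonglongrightarrow> mixed_radial' lam (of_real \<bar>lam\<bar>) * of_real (1 / (\<bar>lam\<bar> + \<bar>lam\<bar>))"
    by (rule tendsto_mult)
  moreover have "u / (of_real (?k n) - of_real \<bar>lam\<bar>) * of_real (1 / (?k n + \<bar>lam\<bar>)) = u / of_real ((B n)\<^sup>2)" for n and u :: complex
  proof -
    have "(?k n - \<bar>lam\<bar>) * (?k n + \<bar>lam\<bar>) = (B n)\<^sup>2"
      using wavenum_square[of "B n" lam] by (simp add: power2_eq_square algebra_simps)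
    then show ?thesis by (simp flip: of_real_diff of_real_mult of_real_add)
  qed
  ultimately have "(\<lambda>n. (mixed_radial lam (of_real (?k n)) - mixed_radial lam (of_real \<bar>lam\<bar>)) / of_real ((B n)\<^sup>2))
      \<longlonglongrightarrow> mixed_radial' lam (of_real \<bar>lam\<bar>) * of_real (1 / (\<bar>lam\<bar> + \<bar>lam\<bar>))"
    by (simp only:)
  then show ?thesis unfolding mixed_quotient_radial[OF assms(1)] by simp
qed

lemma subexp_lattice_symbol: "subexp (lattice_symbol d i j \<beta>)"
proof (rule subexp_linear[where C="\<bar>\<beta>\<bar> + 1 / d"])
  show "lattice_symbol d i j \<beta> \<in> borel_measurable borel"
    unfolding lattice_symbol_def[abs_def] by measurable
  fix lam :: real
  let ?k = "wavenum \<beta> lam"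
  have "?k \<ge> 0" by (rule wavenum_nonneg)
  then have "exp (- (?k * d)) \<le> 1" using d by simp
  then have "norm (lattice_symbol d i j \<beta> lam) \<le> ?k / (1 - exp (- (?k * d)))"
    unfolding lattice_symbol_def norm_divide norm_of_real
    using \<open>exp (- (?k * d)) \<le> 1\<close> norm_stokes_symbol_le[OF wavenum_ge[of lam \<beta>], of i j] by (simp add: divide_right_mono)
  also have "\<dots> \<le> ?k + 1 / d" using d by (intro div_one_minus_exp_le wavenum_nonneg)
  also have "\<dots> \<le> (\<bar>\<beta>\<bar> + 1 / d) + \<bar>lam\<bar>" using wavenum_le[of \<beta> lam] by simp
  finally show "norm (lattice_symbol d i j \<beta> lam) \<le> \<bar>\<beta>\<bar> + 1 / d + \<bar>lam\<bar>" .
qed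

lemma mixed_wave_int:
  "integrable lborel (\<lambda>lam. mixed_diff (\<lambda>X Y. lattice_symbol d i j \<beta> lam * wave \<beta> X Y lam) p a b)"
  "(\<integral>lam. mixed_diff (\<lambda>X Y. lattice_symbol d i j \<beta> lam * wave \<beta> X Y lam) p a b \<partial>lborel)
    = mixed_diff (wave_int (lattice_symbol d i j \<beta>) \<beta>) p a b"
proof -
  have "integrable lborel (\<lambda>lam. lattice_symbol d i j \<beta> lam * wave \<beta> X Y lam)" if "X \<ge> c" for X Y
    using that c by (intro integrable_subexp_wave subexp_lattice_symbol) auto
  with c show "integrable lborel (\<lambda>lam. mixed_diff (\<lambda>X Y. lattice_symbol d i j \<beta> lam * wave \<beta> X Y lam) p a b)"
  "(\<integral>lam. mixed_diff (\<lambda>X Y. lattice_symbol d i j \<beta> lam * wave \<beta> X Y lam) p a b \<partial>lborel)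
    = mixed_diff (wave_int (lattice_symbol d i j \<beta>) \<beta>) p a b"
    unfolding mixed_diff_def wave_int_def by auto
qed

lemma mixed_wave_diff:
  "mixed_diff (wave_diff (lattice_symbol d i j) \<beta>) p a b = - (1 / (4 * pi)) * Re (\<integral>lam. mixed_quotient \<beta> lam \<partial>lborel)"
proof -
  have "(\<integral>lam. mixed_quotient \<beta> lam \<partial>lborel) = (mixed_diff (wave_int (lattice_symbol d i j \<beta>) \<beta>) p a b
      - mixed_diff (wave_int (lattice_symbol d i j 0) 0) p a b) / of_real (\<beta>\<^sup>2)"
    unfolding mixed_quotient_def using mixed_wave_int(1)
    by (simp add: mixed_wave_int(2))
  then have "Re (\<integral>lam. mixed_quotient \<beta> lam \<partial>lborel) = (Re (mixed_diff (wave_int (lattice_symbol d i j \<beta>) \<beta>) p a b)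
      - Re (mixed_diff (wave_int (lattice_symbol d i j 0) 0) p a b)) / \<beta>\<^sup>2"
    by (simp only: Re_divide_of_real minus_complex.simps)
  moreover have "mixed_diff (\<lambda>X Y. Re (f X Y - g X Y)) p a b = Re (mixed_diff f p a b) - Re (mixed_diff g p a b)" for f g
    by (simp add: mixed_diff_def)
  ultimately show ?thesis
    unfolding wave_diff_def[abs_def] mixed_diff_mult_left by simp
qed

definition mixed_limit :: "real \<Rightarrow> complex" where
  "mixed_limit lam = - of_real (1 / (4 * pi)) * (mixed_radial' lam (of_real \<bar>lam\<bar>) / of_real (2 * \<bar>lam\<bar>))"

lemma mixed_limit:
  shows "integrable lborel mixed_limit"
    and "((\<lambda>\<beta>. mixed_diff (wave_diff (lattice_symbol d i j) \<beta>) p a b)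
           \<longlongrightarrow> (\<integral>lam. Re (mixed_limit lam) \<partial>lborel)) (at_right 0)"
proof -
  obtain C where C: "C \<ge> 0"
    "\<And>lam k. \<bar>lam\<bar> \<le> k \<Longrightarrow> k > 0 \<Longrightarrow> norm (mixed_radial' lam (of_real k)) \<le> k * (C * exp (- (c / 2 * \<bar>lam\<bar>)))"
    using mixed_radial'_bound by blast
  let ?L = "\<lambda>lam. mixed_radial' lam (of_real \<bar>lam\<bar>) / of_real (2 * \<bar>lam\<bar>)"
  have m: "mixed_quotient \<beta> \<in> borel_measurable borel" for \<beta>
    unfolding mixed_quotient_def[abs_def]
    using mixed_wave_int(1)[THEN borel_measurable_integrable] by auto
  have AE0: "AE lam in lborel. lam \<noteq> (0::real)" by (rule AE_lborel_singleton)
  have mL: "?L \<in> borel_measurable borel"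
    unfolding mixed_radial'_def radial_def radial'_def bose_def bose'_def mixed_diff_def cwave_def by measurable
  have iw: "integrable lborel (\<lambda>lam. C * exp (- (c / 2 * \<bar>lam\<bar>)))"
    using c by (intro integrable_mult_right integrable_exp_neg_abs) auto
  have dom: "integrable lborel ?L" "(\<lambda>n. \<integral>lam. mixed_quotient (B n) lam \<partial>lborel) \<longlonglongrightarrow> (\<integral>lam. ?L lam \<partial>lborel)"
    if B: "\<And>n. B n > 0" "B \<longlonglongrightarrow> 0" for B
  proof -
    have 1: "AE lam in lborel. (\<lambda>n. mixed_quotient (B n) lam) \<longlonglongrightarrow> ?L lam"
      using AE0 by eventually_elim (rule mixed_quotient_tendsto[OF _ B])
    have 2: "AE lam in lborel. norm (mixed_quotient (B n) lam) \<le> C * exp (- (c / 2 * \<bar>lam\<bar>))" for n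
      using AE0 by eventually_elim (rule mixed_quotient_bound[OF C(2) C(1) _ B(1)])
    show "integrable lborel ?L"
      by (rule integrable_dominated_convergence[OF _ _ iw 1 2]) (use m mL in auto)
    show "(\<lambda>n. \<integral>lam. mixed_quotient (B n) lam \<partial>lborel) \<longlonglongrightarrow> (\<integral>lam. ?L lam \<partial>lborel)"
      by (rule integral_dominated_convergence[OF _ _ iw 1 2]) (use m mL in auto)
  qed
  \<comment> \<open>The limit integrand does not depend on the sequence, so one concrete null
    sequence settles its integrability.\<close>
  have iL: "integrable lborel ?L"
    using dom(1)[of "\<lambda>n. inverse (real (Suc n))"] LIMSEQ_inverse_real_of_nat by simp
  then show i: "integrable lborel mixed_limit"
    unfolding mixed_limit_def[abs_def] by (rule integrable_mult_right)
  have "((\<lambda>\<beta>. \<integral>lam. mixed_quotient \<beta> lam \<partial>lborel) \<longlongrightarrow> (\<integral>lam. ?L lam \<partial>lborel)) (at_right 0)"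
    unfolding tendsto_at_iff_sequentially o_def using dom(2) by auto
  then have "((\<lambda>\<beta>. mixed_diff (wave_diff (lattice_symbol d i j) \<beta>) p a b)
       \<longlongrightarrow> - (1 / (4 * pi)) * Re (\<integral>lam. ?L lam \<partial>lborel)) (at_right 0)"
    unfolding mixed_wave_diff by (intro tendsto_intros)
  also have "- (1 / (4 * pi)) * Re (\<integral>lam. ?L lam \<partial>lborel) = Re (- of_real (1 / (4 * pi)) * (\<integral>lam. ?L lam \<partial>lborel))"
    by simp
  also have "- of_real (1 / (4 * pi)) * (\<integral>lam. ?L lam \<partial>lborel) = (\<integral>lam. mixed_limit lam \<partial>lborel)"
    unfolding mixed_limit_def by (simp only: integral_mult_right_zero)
  also have "Re \<dots> = (\<integral>lam. Re (mixed_limit lam) \<partial>lborel)"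
    by (rule integral_Re[OF i, symmetric])
  finally show "((\<lambda>\<beta>. mixed_diff (wave_diff (lattice_symbol d i j) \<beta>) p a b)
           \<longlongrightarrow> (\<integral>lam. Re (mixed_limit lam) \<partial>lborel)) (at_right 0)" .
qed

end

section \<open>The integrands and the block matrices\<close>

text \<open>If the image sum starts at index \<open>p\<close>, the shift \<open>p d\<close> is absorbed into \<open>X = x - x' + p d\<close>; this turns the factor
  \<open>(p - (p - 1) e) / (1 - e)\<close> of \<^const>\<open>Phi1\<close> (\<open>p = 2\<close>) and \<^const>\<open>Phi2\<close> (\<open>p = 4\<close>) into \<open>e / (1 - e)\<close>.\<close>

definition Phi0 :: "real \<Rightarrow> real \<Rightarrow> real \<Rightarrow> real \<Rightarrow> complex^2^2" where
  "Phi0 d lam X Y =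
     cscale (complex_of_real (1 / (8 * pi) * (1 / (1 - exp (- (\<bar>lam\<bar> * d)))) * exp (- (\<bar>lam\<bar> * X)))
             * exp (\<i> * complex_of_real (lam * Y)))
       ((1 / \<bar>lam\<bar>) *\<^sub>R mat 1 - (X + exp (- (\<bar>lam\<bar> * d)) / (1 - exp (- (\<bar>lam\<bar> * d))) * d) *\<^sub>R J_mat lam)"

lemma shift_start:
  assumes "e \<noteq> (1::real)"
  shows "X + p * d + e / (1 - e) * d = X + (p - (p - 1) * e) / (1 - e) * d"
  using assms by (simp add: divide_simps) (simp add: algebra_simps)

lemma exp_lattice_factor: "exp (- (l * (X + p * d))) = exp (- (p * l * d)) * exp (- (l * X))" for l X p d :: real
  by (simp add: algebra_simps flip: exp_add)

lemma Phi1_eq_Phi0: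
  assumes "lam \<noteq> 0" "d > 0"
  shows "Phi1 d lam t s = Phi0 d lam (t$1 - s$1 + 2 * d) (t$2 - s$2)"
proof -
  have e: "exp (- (\<bar>lam\<bar> * d)) \<noteq> 1" using assms by simp
  show ?thesis
    unfolding Phi0_def Phi1_def exp_lattice_factor shift_start[OF e] by (simp add: mult_ac)
qed

lemma Phi2_eq_Phi0:
  assumes "lam \<noteq> 0" "d > 0"
  shows "Phi2 d \<xi> \<eta> lam t s = (\<Sum>n\<in>{-1..1::int}. Phi0 d lam (t$1 - s$1 - of_int n * \<xi> + 4 * d) (t$2 - s$2 - of_int n * \<eta>))"
proof -
  have e: "exp (- (\<bar>lam\<bar> * d)) \<noteq> 1" using assms by simp
  have s: "r *\<^sub>R cscale z A = cscale (of_real r * z) A" for r z A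
    by (simp add: cscale_def vec_eq_iff scaleR_conv_of_real[where 'a=complex])
  show ?thesis
    unfolding Phi0_def Phi2_def exp_lattice_factor shift_start[OF e] scaleR_sum_right s
    by (simp add: mult_ac)
qed

lemma scaleR_entry: "(r *\<^sub>R A) $ i $ j = of_real r * A $ i $ j" for A :: "complex^2^2"
  by (simp add: scaleR_conv_of_real[where 'a=complex])

text \<open>With \<open>n\<close> the order of the entry, \<open>(lam / k) ^ n\<close> becomes a
  power of the sign at \<open>k = |lam|\<close>, and the bracket reduces to
  \<open>(n - 1) / k + X + e d / (1 - e)\<close>. The coefficient times the power of the sign is the
  entry of \<open>- J\<close>; multiplied by \<open>n - 1\<close> it is the entry of the identity.
  This is the origin of the two terms of \<open>Phi0\<close>.\<close>

lemma radial_corner: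
  assumes lam: "lam \<noteq> 0" and d: "d > 0"
  shows "- of_real (1 / (4 * pi)) / of_real (2 * \<bar>lam\<bar>) *
      ((radial' d i j lam (of_real \<bar>lam\<bar>) - of_real X * radial d i j lam (of_real \<bar>lam\<bar>)) * cwave lam (of_real \<bar>lam\<bar>) X Y)
     = Phi0 d lam X Y $ i $ j"
proof -
  define k e where "k = \<bar>lam\<bar>" and "e = exp (- (k * d))"
  define q where "q = 1 - e"
  have k: "k > 0" using lam by (simp add: k_def)
  have q: "q \<noteq> 0" using k d by (simp add: q_def e_def)
  have ee: "exp (- (complex_of_real k * of_real d)) = of_real e" by (simp add: e_def exp_of_real[symmetric])
  have b: "bose d (of_real k) = of_real (k / q)" "bose' d (of_real k) = of_real (1 / q - k * d * e / q\<^sup>2)"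
    unfolding bose_def bose'_def ee by (simp_all add: q_def)
  have w: "cwave lam (of_real k) X Y = of_real (exp (- (k * X))) * exp (\<i> * of_real (lam * Y))"
    unfolding cwave_def exp_add by (simp add: exp_of_real[symmetric])
  have sg: "complex_of_real lam / of_real k = of_real (sgn lam)"
    using lam by (simp add: k_def sgn_real_def)
  have sg2: "(complex_of_real (sgn lam))\<^sup>2 = 1" using lam by (simp add: sgn_real_def)
  \<comment> \<open>Separates the matrix factor \<open>S\<close> from a purely real scalar
    identity.\<close>
  have gen: "P * (S * (u - v) - x * (S * K)) = R * M" if "P * (u - v - x * K) = R * C" "S * C = M"
    for P S u v x K R M C :: complex
  proof -
    have "P * (S * (u - v) - x * (S * K)) = S * (P * (u - v - x * K))" by (simp add: algebra_simps)
    also have "\<dots> = R * (S * C)" unfolding that(1) by simp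
    finally show ?thesis using that(2) by simp
  qed
  let ?c = "X + e / q * d"
  have main: "- of_real (1 / (4 * pi)) / of_real (2 * k) *
      (symbol_coeff i j * (of_real (sgn lam)) ^ symbol_ord i j * (of_real (1 / q - k * d * e / q\<^sup>2) - of_nat (symbol_ord i j) / of_real k * of_real (k / q))
       - of_real X * (symbol_coeff i j * (of_real (sgn lam)) ^ symbol_ord i j * of_real (k / q)))
     = of_real (1 / (8 * pi) * (1 / q)) * (((1 / k) *\<^sub>R mat 1 - ?c *\<^sub>R J_mat lam) $ i $ j)"
  proof -
    let ?n = "real (symbol_ord i j)"
    have "- (1 / (4 * pi)) / (2 * k) * ((1 / q - k * d * e / q\<^sup>2 - ?n / k * (k / q)) - X * (k / q))
      = 1 / (8 * pi) * (1 / q) * ((?n - 1) / k + ?c)"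
      using k q pi_gt_zero by (simp add: divide_simps power2_eq_square) (simp add: algebra_simps)
    then have "complex_of_real (- (1 / (4 * pi)) / (2 * k) * ((1 / q - k * d * e / q\<^sup>2 - ?n / k * (k / q)) - X * (k / q)))
      = of_real (1 / (8 * pi) * (1 / q) * ((?n - 1) / k + ?c))" by (simp only:)
    moreover have "complex_of_real (- (1 / (4 * pi)) / (2 * k) * ((1 / q - k * d * e / q\<^sup>2 - ?n / k * (k / q)) - X * (k / q)))
      = - of_real (1 / (4 * pi)) / of_real (2 * k) *
        (of_real (1 / q - k * d * e / q\<^sup>2) - of_nat (symbol_ord i j) / of_real k * of_real (k / q) - of_real X * of_real (k / q))"
      by (simp only: of_real_mult of_real_diff of_real_minus of_real_divide of_real_of_nat_eq)
    ultimately have "- of_real (1 / (4 * pi)) / of_real (2 * k) *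
        (of_real (1 / q - k * d * e / q\<^sup>2) - of_nat (symbol_ord i j) / of_real k * of_real (k / q) - of_real X * of_real (k / q))
      = complex_of_real (1 / (8 * pi) * (1 / q)) * of_real ((?n - 1) / k + ?c)"
      by (simp only: of_real_mult)
    moreover have "symbol_coeff i j * (of_real (sgn lam)) ^ symbol_ord i j * of_real ((?n - 1) / k + ?c)
        = ((1 / k) *\<^sub>R mat 1 - ?c *\<^sub>R J_mat lam) $ i $ j"
    proof -
      have "i \<in> {1, 2}" "j \<in> {1, 2}" by (use exhaust_2 in blast)+
      then show ?thesis
        by (auto simp: symbol_coeff_def symbol_ord_def sg2 J_mat_def mat_def scaleR_entry simp del: of_real_add of_real_divide of_real_mult vector_scaleR_component)
          (simp_all add: algebra_simps diff_divide_distrib)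
    qed
    ultimately show ?thesis by (rule gen)
  qed
  show ?thesis
    unfolding Phi0_def radial_def radial'_def k_def[symmetric] sg b w
    unfolding e_def[symmetric] q_def[symmetric]
    using arg_cong[OF main, of "\<lambda>z. z * (of_real (exp (- (k * X))) * exp (\<i> * of_real (lam * Y)))"]
    by (simp only: cscale_def vec_lambda_beta of_real_mult mult_ac)
qed

lemma mixed_limit_eq_Phi0:
  assumes "lam \<noteq> 0" and d: "d > 0"
    and c: "c > 0" "fst p \<ge> c" "fst p + fst a \<ge> c" "fst p + fst b \<ge> c" "fst p + fst a + fst b \<ge> c"
  shows "mixed_limit d p a b i j lam = mixed_diff (\<lambda>X Y. Phi0 d lam X Y $ i $ j) p a b"
proof -
  let ?k = "complex_of_real \<bar>lam\<bar>"
  have "mixed_radial' d p a b i j lam ?k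
      = mixed_diff (\<lambda>X Y. (radial' d i j lam ?k - of_real X * radial d i j lam ?k) * cwave lam ?k X Y) p a b"
    unfolding mixed_radial'_def[OF d c] mixed_diff_def by (simp add: algebra_simps)
  then show ?thesis
    unfolding mixed_limit_def[OF d c] radial_corner[OF assms(1,2), symmetric] mixed_diff_mult_left by simp
qed

section \<open>Entries of the block matrix products\<close>

lemma block_matrix_mult:
  "block_matrix M ** block_matrix N = block_matrix (\<lambda>i j. \<Sum>n\<in>UNIV. M i n ** N n j)"
  unfolding block_matrix_def matrix_matrix_mult_def
  by (simp add: vec_eq_iff sum_component sum.cartesian_product case_prod_unfold flip: UNIV_Times_UNIV)

lemma block_matrix_mult_diag: "block_matrix M ** block_diag B = block_matrix (\<lambda>i j. M i j ** B j)"
proof -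
  have "(\<Sum>n\<in>UNIV. M i n ** (if n = j then B n else 0)) = M i j ** B j" for i j
    by (subst sum.remove[of _ j]) (auto intro!: sum.neutral)
  then show ?thesis by (simp add: block_diag_def block_matrix_mult)
qed

lemma block_diag_mult_matrix: "block_diag B ** block_matrix M = block_matrix (\<lambda>i j. B i ** M i j)"
proof -
  have "(\<Sum>n\<in>UNIV. (if i = n then B i else 0) ** M n j) = B i ** M i j" for i j
    by (subst sum.remove[of _ i]) (auto intro!: sum.neutral)
  then show ?thesis by (simp add: block_diag_def block_matrix_mult)
qed

lemma mat_mult_left: "mat c ** A = cscale c (A :: complex^2^2)"
  by (simp add: vec_eq_iff matrix_matrix_mult_def mat_def cscale_def sum_2 forall_2)

lemma mat_mult_right: "A ** mat c = cscale c (A :: complex^2^2)"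
  by (simp add: vec_eq_iff matrix_matrix_mult_def mat_def cscale_def sum_2 forall_2)

lemma cscale_mult: "cscale c A ** B = cscale c (A ** B)"
  by (simp add: vec_eq_iff matrix_matrix_mult_def cscale_def sum_distrib_left mult.assoc)

text \<open>The blocks of \<open>L_west\<close>, \<open>R_west\<close> and \<open>D_pos\<close> are
  scalar and commute with the diagonal blocks. Exponentials of target and source thus merge into one
  of their difference, and the two terms with \<open>B\<close> combine to
  \<open>- (x - x') B\<close>.\<close>

lemma P_west_entry:
  "P_west (block_diag A) (block_diag B) lam t s $ (l, i) $ (j, b) = (\<Sum>n\<in>UNIV.
      of_real (exp (- (\<bar>lam n\<bar> * (t l $ 1 - s j $ 1)))) * exp (\<i> * of_real (lam n * (t l $ 2 - s j $ 2)))
      * (A n $ i $ b - of_real (t l $ 1 - s j $ 1) * B n $ i $ b))"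
proof -
  let ?L = "\<lambda>n. complex_of_real (exp (- (\<bar>lam n\<bar> * t l $ 1))) * exp (\<i> * complex_of_real (lam n * t l $ 2))"
  let ?R = "\<lambda>n. complex_of_real (exp (\<bar>lam n\<bar> * s j $ 1)) * exp (- (\<i> * complex_of_real (lam n * s j $ 2)))"
  have LR: "of_real (exp (- (\<bar>lam n\<bar> * (t l $ 1 - s j $ 1)))) * exp (\<i> * of_real (lam n * (t l $ 2 - s j $ 2))) = ?L n * ?R n" for n
    by (simp add: exp_of_real[symmetric] algebra_simps flip: exp_add)
  show ?thesis
    unfolding P_west_def L_west_def R_west_def D_pos_def block_matrix_mult_diag block_diag_mult_matrix block_matrix_mult
      mat_mult_left mat_mult_right cscale_mult LR
    unfolding block_matrix_def
    by (simp only: vector_minus_component vector_add_component vec_lambda_beta fst_conv snd_conv sum_component cscale_def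
        sum_distrib_left flip: sum_subtractf sum.distrib)
      (intro sum.cong refl, simp add: algebra_simps)
qed

lemma P1_west_entry:
  "P1_west d w lam t s $ (l, i) $ (j, b) = (\<Sum>n\<in>UNIV. of_real (w n) * Phi1 d (lam n) (t l) (s j) $ i $ b)"
  unfolding P1_west_def D1a_west_def D1b_west_def P_west_entry
proof (intro sum.cong refl)
  fix n
  let ?x = "t l $ 1 - s j $ 1" and ?y = "t l $ 2 - s j $ 2" and ?l = "lam n"
  define g h e x E il where "g = exp (- (2 * \<bar>?l\<bar> * d)) / (1 - exp (- (\<bar>?l\<bar> * d)))"
    and "h = (2 - exp (- (\<bar>?l\<bar> * d))) / (1 - exp (- (\<bar>?l\<bar> * d))) * d" and "e = exp (- (\<bar>?l\<bar> * ?x))"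
    and "x = ?x" and "E = exp (\<i> * complex_of_real (?l * ?y))" and "il = 1 / \<bar>?l\<bar>"
  note abstract = g_def[symmetric] h_def[symmetric] e_def[symmetric] E_def[symmetric] il_def[symmetric]
  show "complex_of_real (exp (- (\<bar>?l\<bar> * ?x))) * exp (\<i> * of_real (?l * ?y)) *
      (((w n / (8 * pi) * (exp (- (2 * \<bar>?l\<bar> * d)) / (1 - exp (- (\<bar>?l\<bar> * d))))) *\<^sub>R
       ((1 / \<bar>?l\<bar>) *\<^sub>R mat 1 - ((2 - exp (- (\<bar>?l\<bar> * d))) / (1 - exp (- (\<bar>?l\<bar> * d))) * d) *\<^sub>R J_mat ?l)) $ i $ b
       - of_real ?x * ((w n / (8 * pi) * (exp (- (2 * \<bar>?l\<bar> * d)) / (1 - exp (- (\<bar>?l\<bar> * d))))) *\<^sub>R J_mat ?l) $ i $ b)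
    = of_real (w n) * Phi1 d ?l (t l) (s j) $ i $ b"
    unfolding Phi1_def abstract x_def[symmetric]
    by (simp only: cscale_def vec_lambda_beta scaleR_entry vector_minus_component of_real_mult of_real_add of_real_divide)
      (simp add: field_simps)
qed

lemma sum_three: "(\<Sum>n\<in>{-1..1::int}. f n) = f (-1) + f 0 + f 1"
proof -
  have "{-1..1::int} = {-1, 0, 1}" by auto
  then show ?thesis by (simp add: add.assoc)
qed

text \<open>The offset of row \<open>n\<close> factors out of the exponentials. The factors for
  \<open>n = -1, 0, 1\<close> are \<open>E_minus\<close>, 1 and \<open>E_plus\<close>; the summands
  \<open>n * \<xi>\<close> in front of \<open>J\<close> collect to
  \<open>(E_plus - E_minus) * \<xi>\<close>, which is the last term of
  \<open>D2a_west\<close>.\<close>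

lemma P2_west_entry:
  "P2_west d \<xi> \<eta> w lam t s $ (l, i) $ (j, b) = (\<Sum>n\<in>UNIV. of_real (w n) * Phi2 d \<xi> \<eta> (lam n) (t l) (s j) $ i $ b)"
  unfolding P2_west_def D2a_west_def D2b_west_def P_west_entry
proof (intro sum.cong refl)
  fix n
  let ?x = "t l $ 1 - s j $ 1" and ?y = "t l $ 2 - s j $ 2" and ?l = "lam n"
  let ?E = "of_real (exp (- (\<bar>?l\<bar> * ?x))) * exp (\<i> * of_real (?l * ?y))"
  let ?g = "exp (- (4 * \<bar>?l\<bar> * d)) / (1 - exp (- (\<bar>?l\<bar> * d)))"
  define U where "U m = exp (of_real (of_int m) * (of_real (\<bar>?l\<bar> * \<xi>) - \<i> * of_real (?l * \<eta>)))" for m :: int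
  have s: "complex_of_real (?g * exp (- (\<bar>?l\<bar> * (?x - of_int m * \<xi>)))) * exp (\<i> * of_real (?l * (?y - of_int m * \<eta>)))
     = of_real ?g * (?E * U m)" for m
    unfolding U_def by (simp add: exp_of_real[symmetric] algebra_simps flip: exp_add)
  have U: "U (-1) = E_minus \<xi> \<eta> ?l" "U 0 = 1" "U 1 = E_plus \<xi> \<eta> ?l"
    by (simp_all add: U_def E_minus_def E_plus_def)
  define g h x E il where "g = ?g" and "h = (4 - 3 * exp (- (\<bar>?l\<bar> * d))) / (1 - exp (- (\<bar>?l\<bar> * d))) * d"
    and "x = ?x" and "E = ?E" and "il = 1 / \<bar>?l\<bar>"
  note abstract = g_def[symmetric] h_def[symmetric] E_def[symmetric] il_def[symmetric]
  show "?E * (((w n / (8 * pi) * ?g) *\<^sub>R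
       (cscale (E_minus \<xi> \<eta> ?l + E_plus \<xi> \<eta> ?l + 1)
          ((1 / \<bar>?l\<bar>) *\<^sub>R mat 1 - ((4 - 3 * exp (- (\<bar>?l\<bar> * d))) / (1 - exp (- (\<bar>?l\<bar> * d))) * d) *\<^sub>R J_mat ?l)
        - cscale (E_minus \<xi> \<eta> ?l - E_plus \<xi> \<eta> ?l) (\<xi> *\<^sub>R J_mat ?l))) $ i $ b
      - of_real ?x * ((w n / (8 * pi) * ?g) *\<^sub>R cscale (E_minus \<xi> \<eta> ?l + E_plus \<xi> \<eta> ?l + 1) (J_mat ?l)) $ i $ b)
     = of_real (w n) * Phi2 d \<xi> \<eta> ?l (t l) (s j) $ i $ b"
    unfolding Phi2_def s
    unfolding sum_three U
    unfolding abstract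
    unfolding x_def[symmetric]
    by (simp only: cscale_def vec_lambda_beta scaleR_entry vector_minus_component vector_add_component
        of_real_mult of_real_add of_real_divide of_real_diff)
       (simp add: field_simps)
qed

section \<open>Charge-neutral potentials\<close>

text \<open>Common form of both settings: \<open>N\<close> indexes the rows of images, and
  \<open>(h n, g n)\<close> is the offset of the first image in row \<open>n\<close>. Positivity of
  the four abscissas is all that is needed from the geometry.\<close>

lemma kernel_limit:
  fixes K :: "real \<Rightarrow> real^2 \<Rightarrow> real^2 \<Rightarrow> real^2^2" and \<Phi> :: "real \<Rightarrow> real^2 \<Rightarrow> real^2 \<Rightarrow> complex^2^2"
    and h g :: "'n \<Rightarrow> real"
  assumes d: "d > 0" and N: "finite N"
    and pos: "\<And>u v n. u \<in> C \<Longrightarrow> v \<in> C \<Longrightarrow> n \<in> N \<Longrightarrow> u$1 - v$1 + h n > 0"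
    and K: "\<And>\<beta> u v. \<beta> > 0 \<Longrightarrow> u \<in> C \<Longrightarrow> v \<in> C \<Longrightarrow> K \<beta> u v $ i $ j =
      (\<Sum>n\<in>N. wave_diff (lattice_symbol d i j) \<beta> (u$1 - v$1 + h n) (u$2 - v$2 + g n))"
    and \<Phi>: "\<And>lam u v. lam \<noteq> 0 \<Longrightarrow> \<Phi> lam u v = (\<Sum>n\<in>N. Phi0 d lam (u$1 - v$1 + h n) (u$2 - v$2 + g n))"
    and in_C: "t \<in> C" "t0 \<in> C" "s \<in> C" "s0 \<in> C"
  shows "((\<lambda>\<beta>. (K \<beta> t s - K \<beta> t0 s - K \<beta> t s0 + K \<beta> t0 s0) $ i $ j)
     \<longlongrightarrow> (LBINT x. Re (Psi \<Phi> t t0 s s0 x $ i $ j))) (at_right 0)"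
proof -
  let ?p = "\<lambda>n. (t$1 - s$1 + h n, t$2 - s$2 + g n)"
  \<comment> \<open>The sign of the source displacement is reversed because \<open>s\<close> enters
    through \<open>t - s\<close>; the corners are then the four pairs in \<open>Psi\<close>.\<close>
  let ?a = "(t0$1 - t$1, t0$2 - t$2)" and ?b = "(s$1 - s0$1, s$2 - s0$2)"
  have mixed: "mixed_diff f (?p n) ?a ?b = f (t$1 - s$1 + h n) (t$2 - s$2 + g n) - f (t0$1 - s$1 + h n) (t0$2 - s$2 + g n)
      - f (t$1 - s0$1 + h n) (t$2 - s0$2 + g n) + f (t0$1 - s0$1 + h n) (t0$2 - s0$2 + g n)"
    for n and f :: "real \<Rightarrow> real \<Rightarrow> 'b::real_normed_vector"
    by (simp add: mixed_diff_def algebra_simps)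
  have lim: "integrable lborel (mixed_limit d (?p n) ?a ?b i j)"
      "((\<lambda>\<beta>. mixed_diff (wave_diff (lattice_symbol d i j) \<beta>) (?p n) ?a ?b)
         \<longlongrightarrow> (\<integral>lam. Re (mixed_limit d (?p n) ?a ?b i j lam) \<partial>lborel)) (at_right 0)"
      "\<And>lam. lam \<noteq> 0 \<Longrightarrow> mixed_limit d (?p n) ?a ?b i j lam = mixed_diff (\<lambda>X Y. Phi0 d lam X Y $ i $ j) (?p n) ?a ?b"
    if n: "n \<in> N" for n
  proof -
    define c where "c = Min {t$1 - s$1 + h n, t0$1 - s$1 + h n, t$1 - s0$1 + h n, t0$1 - s0$1 + h n}"
    have c: "c > 0" unfolding c_def using pos in_C n by (subst Min_gr_iff) auto
    have cs: "c \<le> fst (?p n)" "c \<le> fst (?p n) + fst ?a" "c \<le> fst (?p n) + fst ?b" "c \<le> fst (?p n) + fst ?a + fst ?b"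
      unfolding c_def by (auto simp: algebra_simps intro!: Min_le)
    show "integrable lborel (mixed_limit d (?p n) ?a ?b i j)"
      "((\<lambda>\<beta>. mixed_diff (wave_diff (lattice_symbol d i j) \<beta>) (?p n) ?a ?b)
         \<longlongrightarrow> (\<integral>lam. Re (mixed_limit d (?p n) ?a ?b i j lam) \<partial>lborel)) (at_right 0)"
      by (rule mixed_limit[OF d c cs])+
    show "mixed_limit d (?p n) ?a ?b i j lam = mixed_diff (\<lambda>X Y. Phi0 d lam X Y $ i $ j) (?p n) ?a ?b" if "lam \<noteq> 0" for lam
      by (rule mixed_limit_eq_Phi0[OF that d c cs])
  qed
  have "((\<lambda>\<beta>. \<Sum>n\<in>N. mixed_diff (wave_diff (lattice_symbol d i j) \<beta>) (?p n) ?a ?b)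
         \<longlongrightarrow> (\<Sum>n\<in>N. \<integral>lam. Re (mixed_limit d (?p n) ?a ?b i j lam) \<partial>lborel)) (at_right 0)"
    by (intro tendsto_sum lim)
  moreover have "\<forall>\<^sub>F \<beta> in at_right 0. (\<Sum>n\<in>N. mixed_diff (wave_diff (lattice_symbol d i j) \<beta>) (?p n) ?a ?b)
      = (K \<beta> t s - K \<beta> t0 s - K \<beta> t s0 + K \<beta> t0 s0) $ i $ j"
  proof -
    have "(\<Sum>n\<in>N. mixed_diff (wave_diff (lattice_symbol d i j) \<beta>) (?p n) ?a ?b)
      = (K \<beta> t s - K \<beta> t0 s - K \<beta> t s0 + K \<beta> t0 s0) $ i $ j" if "\<beta> > 0" for \<beta>
      unfolding mixed using K[OF that] in_C by (simp add: sum.distrib sum_subtractf)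
    then show ?thesis by (auto simp: eventually_at_filter)
  qed
  moreover have "(\<Sum>n\<in>N. \<integral>lam. Re (mixed_limit d (?p n) ?a ?b i j lam) \<partial>lborel)
      = (LBINT x. Re (Psi \<Phi> t t0 s s0 x $ i $ j))"
  proof -
    have i: "integrable lborel (\<lambda>lam. Re (mixed_limit d (?p n) ?a ?b i j lam))" if "n \<in> N" for n
      using lim(1)[OF that] by (rule integrable_Re)
    have eq: "Re (Psi \<Phi> t t0 s s0 x $ i $ j) = (\<Sum>n\<in>N. Re (mixed_limit d (?p n) ?a ?b i j x))" if "x \<noteq> 0" for x
    proof -
      have "(\<Sum>n\<in>N. mixed_limit d (?p n) ?a ?b i j x) = (\<Sum>n\<in>N. mixed_diff (\<lambda>X Y. Phi0 d x X Y $ i $ j) (?p n) ?a ?b)"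
        by (intro sum.cong refl lim(3) that)
      also have "\<dots> = Psi \<Phi> t t0 s s0 x $ i $ j"
        unfolding mixed Psi_def \<Phi>[OF that] by (simp add: sum.distrib sum_subtractf sum_component)
      finally show ?thesis by (metis Re_sum)
    qed
    let ?S = "\<lambda>x. \<Sum>n\<in>N. Re (mixed_limit d (?p n) ?a ?b i j x)"
    have "(\<Sum>n\<in>N. \<integral>lam. Re (mixed_limit d (?p n) ?a ?b i j lam) \<partial>lborel) = (\<integral>x. ?S x \<partial>lborel)"
      using i by (subst Bochner_Integration.integral_sum) auto
    also have "\<dots> = (LBINT x. Re (Psi \<Phi> t t0 s s0 x $ i $ j))"
    proof (rule integral_cong_AE)
      show m: "?S \<in> borel_measurable lborel"
        using i by (intro borel_measurable_sum borel_measurable_integrable)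
      \<comment> \<open>The assumption on \<Phi> says nothing at 0, so measurability of the
        integrand is obtained by altering \<open>?S\<close> at this single point.\<close>
      have "(\<lambda>x. if x = 0 then Re (Psi \<Phi> t t0 s s0 0 $ i $ j) else ?S x) \<in> borel_measurable borel"
        using m by (intro measurable_If) auto
      also have "(\<lambda>x. if x = 0 then Re (Psi \<Phi> t t0 s s0 0 $ i $ j) else ?S x) = (\<lambda>x. Re (Psi \<Phi> t t0 s s0 x $ i $ j))"
        using eq by auto
      finally show "(\<lambda>x. Re (Psi \<Phi> t t0 s s0 x $ i $ j)) \<in> borel_measurable lborel" by simp
      show "AE x in lborel. ?S x = Re (Psi \<Phi> t t0 s s0 x $ i $ j)"
        using AE_lborel_singleton[of 0] by eventually_elim (simp add: eq)
    qed
    finally show ?thesis .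
  qed
  ultimately show ?thesis using Lim_transform_eventually by fastforce
qed

lemma matrix_vector_mult_2: "((A :: real^2^2) *v x) $ i = (\<Sum>b\<in>UNIV. A $ i $ b * x $ b)"
  by (simp add: matrix_vector_mult_def)

text \<open>By neutrality any term taken at one reference source \<open>s0\<close> sums to 0 against
  \<open>q\<close>, so it can be subtracted both in the potential and in the quadrature sum. Each
  charge then multiplies a single mixed difference with error at most \<epsilon>, hence no further
  constant in the bound.\<close>

lemma neutral_quadrature_bound:
  fixes K :: "real \<Rightarrow> real^2 \<Rightarrow> real^2 \<Rightarrow> real^2^2" and \<Phi> :: "real \<Rightarrow> real^2 \<Rightarrow> real^2 \<Rightarrow> complex^2^2"
    and s :: "'s::finite \<Rightarrow> real^2" and t :: "'t::finite \<Rightarrow> real^2" and q :: "'s \<Rightarrow> real^2"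
    and w lam :: "'q::finite \<Rightarrow> real"
  assumes lim: "\<And>t t0 s s0 i j. t \<in> C \<Longrightarrow> t0 \<in> C \<Longrightarrow> s \<in> C \<Longrightarrow> s0 \<in> C \<Longrightarrow>
      ((\<lambda>\<beta>. (K \<beta> t s - K \<beta> t0 s - K \<beta> t s0 + K \<beta> t0 s0) $ i $ j)
     \<longlongrightarrow> (LBINT x. Re (Psi \<Phi> t t0 s s0 x $ i $ j))) (at_right 0)"
    and quad: "quadrature_of_precision \<epsilon> C \<Phi> w lam"
    and P: "\<And>l i j b. P $ (l, i) $ (j, b) = (\<Sum>n\<in>UNIV. of_real (w n) * \<Phi> (lam n) (t l) (s j) $ i $ b)"
    and s: "\<And>j. s j \<in> C" and t: "\<And>l. t l \<in> C" and q: "(\<Sum>j\<in>UNIV. q j) = 0"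
  shows "\<exists>\<Delta> :: real^2.
     ((\<lambda>\<beta>. \<Sum>j\<in>UNIV. (K \<beta> (t l) (s j) - K \<beta> (t l') (s j)) *v q j) \<longlongrightarrow> \<Delta>) (at_right 0) \<and>
     (\<forall>i. \<bar>\<Delta> $ i - Re ((P *v block_vector q) $ (l, i) - (P *v block_vector q) $ (l', i))\<bar>
          \<le> \<epsilon> * (\<Sum>j\<in>UNIV. \<bar>q j $ 1\<bar> + \<bar>q j $ 2\<bar>))"
proof -
  \<comment> \<open>An arbitrary one of the given sources; only its membership in \<open>C\<close>
    matters.\<close>
  define s0 where "s0 = s undefined"
  have s0: "s0 \<in> C" using s by (simp add: s0_def)
  have neutral: "(\<Sum>j\<in>UNIV. q j $ b) = 0" for b
    using q by (metis sum_component zero_index)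
  define I where "I j i b = (LBINT x. Re (Psi \<Phi> (t l) (t l') (s j) s0 x $ i $ b))" for j i b
  define \<Delta> :: "real^2" where "\<Delta> = (\<chi> i. \<Sum>j\<in>UNIV. \<Sum>b\<in>UNIV. I j i b * q j $ b)"
  have "((\<lambda>\<beta>. \<Sum>j\<in>UNIV. (K \<beta> (t l) (s j) - K \<beta> (t l') (s j)) *v q j) \<longlongrightarrow> \<Delta>) (at_right 0)"
  proof (rule vec_tendstoI)
    fix i
    have "((\<lambda>\<beta>. \<Sum>j\<in>UNIV. \<Sum>b\<in>UNIV. (K \<beta> (t l) (s j) - K \<beta> (t l') (s j) - K \<beta> (t l) s0 + K \<beta> (t l') s0) $ i $ b * q j $ b)
        \<longlongrightarrow> \<Delta> $ i) (at_right 0)"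
      unfolding \<Delta>_def I_def vec_lambda_beta by (intro tendsto_sum tendsto_mult tendsto_const lim s t s0)
    moreover have "(\<Sum>j\<in>UNIV. \<Sum>b\<in>UNIV. (K \<beta> (t l) (s j) - K \<beta> (t l') (s j) - K \<beta> (t l) s0 + K \<beta> (t l') s0) $ i $ b * q j $ b)
        = (\<Sum>j\<in>UNIV. (K \<beta> (t l) (s j) - K \<beta> (t l') (s j)) *v q j) $ i" for \<beta>
    proof -
      have "(\<Sum>j\<in>UNIV. \<Sum>b\<in>UNIV. (K \<beta> (t l) (s j) - K \<beta> (t l') (s j) - K \<beta> (t l) s0 + K \<beta> (t l') s0) $ i $ b * q j $ b)
        = (\<Sum>j\<in>UNIV. \<Sum>b\<in>UNIV. (K \<beta> (t l) (s j) - K \<beta> (t l') (s j)) $ i $ b * q j $ b)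
          - (\<Sum>j\<in>UNIV. \<Sum>b\<in>UNIV. (K \<beta> (t l) s0 - K \<beta> (t l') s0) $ i $ b * q j $ b)"
        by (simp add: sum_subtractf[symmetric] algebra_simps)
      also have "(\<Sum>j\<in>UNIV. \<Sum>b\<in>UNIV. (K \<beta> (t l) s0 - K \<beta> (t l') s0) $ i $ b * q j $ b) = 0"
        by (subst sum.swap) (simp only: sum_distrib_left[symmetric] neutral mult_zero_right sum.neutral_const)
      finally show ?thesis by (simp add: sum_component matrix_vector_mult_2)
    qed
    ultimately show "((\<lambda>\<beta>. (\<Sum>j\<in>UNIV. (K \<beta> (t l) (s j) - K \<beta> (t l') (s j)) *v q j) $ i) \<longlongrightarrow> \<Delta> $ i) (at_right 0)"
      by simp
  qed
  moreover have "\<bar>\<Delta> $ i - Re ((P *v block_vector q) $ (l, i) - (P *v block_vector q) $ (l', i))\<bar>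
          \<le> \<epsilon> * (\<Sum>j\<in>UNIV. \<bar>q j $ 1\<bar> + \<bar>q j $ 2\<bar>)" for i
  proof -
    define Q where "Q u v b = (\<Sum>n\<in>UNIV. w n * Re (\<Phi> (lam n) u v $ i $ b))" for u v b
    have Pq: "Re ((P *v block_vector q) $ (l, i)) = (\<Sum>j\<in>UNIV. \<Sum>b\<in>UNIV. Q (t l) (s j) b * q j $ b)" for l
    proof -
      have "(P *v block_vector q) $ (l, i) = (\<Sum>j\<in>UNIV. \<Sum>b\<in>UNIV. P $ (l, i) $ (j, b) * of_real (q j $ b))"
        by (simp add: matrix_vector_mult_def block_vector_def sum.cartesian_product case_prod_unfold flip: UNIV_Times_UNIV)
      then show ?thesis by (simp add: P Q_def)
    qed
    define E where "E j b = I j i b - (\<Sum>n\<in>UNIV. w n * Re (Psi \<Phi> (t l) (t l') (s j) s0 (lam n) $ i $ b))" for j b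
    have QE: "(\<Sum>n\<in>UNIV. w n * Re (Psi \<Phi> (t l) (t l') (s j) s0 (lam n) $ i $ b))
        = Q (t l) (s j) b - Q (t l') (s j) b - (Q (t l) s0 b - Q (t l') s0 b)" for j b
      by (simp add: Q_def Psi_def sum_subtractf[symmetric] algebra_simps)
    have E: "\<bar>E j b\<bar> \<le> \<epsilon>" for j b
      using quad s t s0 unfolding quadrature_of_precision_def E_def I_def by blast
    have "\<Delta> $ i - Re ((P *v block_vector q) $ (l, i) - (P *v block_vector q) $ (l', i))
      = (\<Sum>j\<in>UNIV. \<Sum>b\<in>UNIV. (I j i b - (Q (t l) (s j) b - Q (t l') (s j) b)) * q j $ b)"
      unfolding minus_complex.simps Pq \<Delta>_def vec_lambda_beta by (simp add: sum_subtractf[symmetric] algebra_simps)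
    also have "\<dots> = (\<Sum>j\<in>UNIV. \<Sum>b\<in>UNIV. E j b * q j $ b)
        - (\<Sum>j\<in>UNIV. \<Sum>b\<in>UNIV. (Q (t l) s0 b - Q (t l') s0 b) * q j $ b)"
      unfolding E_def QE by (simp add: sum_subtractf[symmetric] algebra_simps)
    also have "(\<Sum>j\<in>UNIV. \<Sum>b\<in>UNIV. (Q (t l) s0 b - Q (t l') s0 b) * q j $ b) = 0"
      by (subst sum.swap) (simp only: sum_distrib_left[symmetric] neutral mult_zero_right sum.neutral_const)
    finally have "\<Delta> $ i - Re ((P *v block_vector q) $ (l, i) - (P *v block_vector q) $ (l', i))
      = (\<Sum>j\<in>UNIV. \<Sum>b\<in>UNIV. E j b * q j $ b)" by simp
    also have "\<bar>\<dots>\<bar> \<le> (\<Sum>j\<in>UNIV. \<Sum>b\<in>UNIV. \<epsilon> * \<bar>q j $ b\<bar>)"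
      by (intro order_trans[OF sum_abs] sum_mono) (auto simp: abs_mult intro!: mult_right_mono E)
    also have "\<dots> = \<epsilon> * (\<Sum>j\<in>UNIV. \<bar>q j $ 1\<bar> + \<bar>q j $ 2\<bar>)"
      by (simp add: sum_2 sum_distrib_left distrib_left)
    finally show ?thesis .
  qed
  ultimately show ?thesis by blast
qed

section \<open>The images lie strictly to the west of the cell\<close>

lemma cell1_diff:
  assumes "u \<in> cell1 d \<eta>" "v \<in> cell1 d \<eta>" "d > 0"
  shows "u$1 - v$1 + 2 * d > 0"
  using assms by (auto simp: cell1_def)

text \<open>Since \<open>|\<xi>| \<le> d\<close>, abscissas in the cell are at most
  \<open>d / 2 + |\<xi>| / 2 \<le> d\<close> in absolute value. Two points and one row shift cost at
  most \<open>3 d\<close>, so the images from column 4 on leave a margin of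
  \<open>d\<close>.\<close>

lemma cell2_diff:
  assumes "u \<in> cell2 d \<xi> \<eta>" "v \<in> cell2 d \<xi> \<eta>" "d > 0" "sqrt (\<xi>\<^sup>2 + \<eta>\<^sup>2) \<le> d" "n \<in> {-1..1::int}"
  shows "u$1 - v$1 - of_int n * \<xi> + 4 * d > 0"
proof -
  have \<xi>: "\<bar>\<xi>\<bar> \<le> d" using assms(4) real_sqrt_ge_abs1[of \<xi> \<eta>] by linarith
  have b: "\<bar>u$1\<bar> \<le> d" if u: "u \<in> cell2 d \<xi> \<eta>" for u
  proof -
    obtain x y where xy: "u = x *\<^sub>R e1 d + y *\<^sub>R e2 \<xi> \<eta>" "\<bar>x\<bar> \<le> 1/2" "\<bar>y\<bar> \<le> 1/2"
      using u by (auto simp: cell2_def abs_le_iff)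
    have "\<bar>x\<bar> * \<bar>d\<bar> \<le> 1/2 * d" "\<bar>y\<bar> * \<bar>\<xi>\<bar> \<le> 1/2 * d"
      using xy \<xi> assms(3) by (intro mult_mono; simp)+
    moreover have "\<bar>u$1\<bar> \<le> \<bar>x\<bar> * \<bar>d\<bar> + \<bar>y\<bar> * \<bar>\<xi>\<bar>"
      unfolding xy(1) by (simp add: e1_def e2_def flip: abs_mult)
    ultimately show ?thesis by linarith
  qed
  have "n = -1 \<or> n = 0 \<or> n = 1" using assms(5) by auto
  then have "of_int n * \<xi> \<le> d" using \<xi> assms(3) by auto
  then show ?thesis using b[OF assms(1)] b[OF assms(2)] assms(3) by linarith
qed

theorem theorem9:
  fixes \<epsilon> d \<eta> \<xi> :: real
    and w1 lam1 :: "'q1::finite \<Rightarrow> real"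
    and w2 lam2 :: "'q2::finite \<Rightarrow> real"
  assumes "\<epsilon> > 0" and "d > 0" and "\<eta> > 0"
  shows
    "(quadrature_of_precision \<epsilon> (cell1 d \<eta>) (Phi1 d) w1 lam1 \<longrightarrow>
        (\<forall>(s :: 's::finite \<Rightarrow> real^2) (t :: 't::finite \<Rightarrow> real^2) (q :: 's \<Rightarrow> real^2).
           (\<forall>j. s j \<in> cell1 d \<eta>) \<longrightarrow> (\<forall>l. t l \<in> cell1 d \<eta>) \<longrightarrow> (\<Sum>j\<in>UNIV. q j) = 0 \<longrightarrow>
           (\<forall>l l'. \<exists>\<Delta> :: real^2.
              ((\<lambda>\<beta>. \<Sum>j\<in>UNIV. (K1_west d \<beta> (t l) (s j) - K1_west d \<beta> (t l') (s j)) *v q j)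
                 \<longlongrightarrow> \<Delta>) (at_right 0) \<and>
              (\<forall>i. \<bar>\<Delta> $ i - Re ((P1_west d w1 lam1 t s *v block_vector q) $ (l, i)
                                - (P1_west d w1 lam1 t s *v block_vector q) $ (l', i))\<bar>
                   \<le> \<epsilon> * (\<Sum>j\<in>UNIV. \<bar>q j $ 1\<bar> + \<bar>q j $ 2\<bar>)))))
     \<and>
     (d \<ge> sqrt (\<xi>^2 + \<eta>^2) \<longrightarrow>
      quadrature_of_precision \<epsilon> (cell2 d \<xi> \<eta>) (Phi2 d \<xi> \<eta>) w2 lam2 \<longrightarrow>
        (\<forall>(s :: 's \<Rightarrow> real^2) (t :: 't \<Rightarrow> real^2) (q :: 's \<Rightarrow> real^2).
           (\<forall>j. s j \<in> cell2 d \<xi> \<eta>) \<longrightarrow> (\<forall>l. t l \<in> cell2 d \<xi> \<eta>) \<longrightarrow> (\<Sum>j\<in>UNIV. q j) = 0 \<longrightarrow>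
           (\<forall>l l'. \<exists>\<Delta> :: real^2.
              ((\<lambda>\<beta>. \<Sum>j\<in>UNIV. (K2_west d \<xi> \<eta> \<beta> (t l) (s j) - K2_west d \<xi> \<eta> \<beta> (t l') (s j)) *v q j)
                 \<longlongrightarrow> \<Delta>) (at_right 0) \<and>
              (\<forall>i. \<bar>\<Delta> $ i - Re ((P2_west d \<xi> \<eta> w2 lam2 t s *v block_vector q) $ (l, i)
                                - (P2_west d \<xi> \<eta> w2 lam2 t s *v block_vector q) $ (l', i))\<bar>
                   \<le> \<epsilon> * (\<Sum>j\<in>UNIV. \<bar>q j $ 1\<bar> + \<bar>q j $ 2\<bar>)))))"
proof (intro conjI impI allI, goal_cases)
  case (1 s t q l l')
  show ?case
  proof (rule neutral_quadrature_bound[where C = "cell1 d \<eta>" and \<Phi> = "Phi1 d" and w = w1 and lam = lam1])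
    fix t t0 s s0 :: "real^2" and i j :: 2
    assume "t \<in> cell1 d \<eta>" "t0 \<in> cell1 d \<eta>" "s \<in> cell1 d \<eta>" "s0 \<in> cell1 d \<eta>"
    then show "((\<lambda>\<beta>. (K1_west d \<beta> t s - K1_west d \<beta> t0 s - K1_west d \<beta> t s0 + K1_west d \<beta> t0 s0) $ i $ j)
        \<longlongrightarrow> (LBINT x. Re (Psi (Phi1 d) t t0 s s0 x $ i $ j))) (at_right 0)"
      \<comment> \<open>A single row: the images begin at index -2, hence the offset
        \<open>2 * d\<close>.\<close>
      by (intro kernel_limit[where N = "{()}" and h = "\<lambda>_. 2 * d" and g = "\<lambda>_. 0" and C = "cell1 d \<eta>"])
        (auto simp: assms cell1_diff K1_west_eq Phi1_eq_Phi0)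
  qed (use 1 P1_west_entry in auto)
next
  case (2 s t q l l')
  show ?case
  proof (rule neutral_quadrature_bound[where C = "cell2 d \<xi> \<eta>" and \<Phi> = "Phi2 d \<xi> \<eta>" and w = w2 and lam = lam2])
    fix t t0 s s0 :: "real^2" and i j :: 2
    assume "t \<in> cell2 d \<xi> \<eta>" "t0 \<in> cell2 d \<xi> \<eta>" "s \<in> cell2 d \<xi> \<eta>" "s0 \<in> cell2 d \<xi> \<eta>"
    moreover have pos: "u$1 - v$1 - of_int n * \<xi> + 4 * d > 0"
      if "u \<in> cell2 d \<xi> \<eta>" "v \<in> cell2 d \<xi> \<eta>" "n \<in> {-1..1}" for u v and n :: int
      using cell2_diff that 2(1) assms(2) by blast
    moreover have "K2_west d \<xi> \<eta> \<beta> u v $ i $ j = (\<Sum>n\<in>{-1..1::int}. wave_diff (lattice_symbol d i j) \<beta>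
        (u$1 - v$1 + (4 * d - of_int n * \<xi>)) (u$2 - v$2 + - (of_int n * \<eta>)))"
      if "\<beta> > 0" "u \<in> cell2 d \<xi> \<eta>" "v \<in> cell2 d \<xi> \<eta>" for \<beta> u v
      using K2_west_eq[OF that(1) assms(2) pos[OF that(2,3)], of \<eta>]
      by (simp add: sum_component algebra_simps)
    moreover have "Phi2 d \<xi> \<eta> lam u v = (\<Sum>n\<in>{-1..1::int}. Phi0 d lam
        (u$1 - v$1 + (4 * d - of_int n * \<xi>)) (u$2 - v$2 + - (of_int n * \<eta>)))"
      if "lam \<noteq> 0" for lam u v
      using Phi2_eq_Phi0[OF that assms(2), of \<xi> \<eta> u v] by (simp add: algebra_simps)
    ultimately show "((\<lambda>\<beta>. (K2_west d \<xi> \<eta> \<beta> t s - K2_west d \<xi> \<eta> \<beta> t0 s - K2_west d \<xi> \<eta> \<beta> t s0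
          + K2_west d \<xi> \<eta> \<beta> t0 s0) $ i $ j)
        \<longlongrightarrow> (LBINT x. Re (Psi (Phi2 d \<xi> \<eta>) t t0 s s0 x $ i $ j))) (at_right 0)"
      \<comment> \<open>Three rows beginning at column -4; row \<open>n\<close> is displaced by
        \<open>n\<close> times the second lattice vector, which enters the offsets with a minus
        sign.\<close>
      by (intro kernel_limit[where N = "{-1..1::int}" and h = "\<lambda>n. 4 * d - of_int n * \<xi>"
            and g = "\<lambda>n. - (of_int n * \<eta>)" and C = "cell2 d \<xi> \<eta>"] assms(2))
        (simp_all add: assms(2) algebra_simps)
  qed (use 2 P2_west_entry in auto)
qed

end
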